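(* The Kadec-Klee property and the uniform Kadec-Klee property are equivalent for JB$^*$-triples; that is, a (complex) JB$^*$-triple $E$ has the Kadec-Klee property if and only if it has the uniform Kadec-Klee property.
   Context: JB$^*$-triple: a complex Banach space $E$ with a continuous triple product $\{\cdot,\cdot,\cdot\}:E\times E\times E\to E$ which is bilinear and symmetric in the outer variables and conjugate linear in the middle one, such that, writing $L(a,b)x=\{a,b,x\}$: (1) $L(a,b)\{x,y,z\}=\{L(a,b)x,y,z\}-\{x,L(b,a)y,z\}+\{x,y,L(a,b)z\}$ for all $a,b,x,y,z\in E$; (2) $L(a,a)$ is a hermitian operator with non-negative spectrum for every $a\in E$; (3) $\|\{a,a,a\}\|=\|a\|^3$ for every $a\in E$. Kadec-Klee property (KKP) of a Banach space $X$: every sequence in the unit sphere of $X$ which converges weakly to a point of the unit sphere converges to it in norm. Uniform Kadec-Klee (UKK) property of $X$: for a sequence $(x_n)$ put $\mathrm{sep}(x_n)=\inf\{\|x_n-x_m\|:n\neq m\}$; for each $\varepsilon>0$ there exists $\delta>0$ such that every sequence $(x_n)$ in the closed unit ball of $X$ with $\mathrm{sep}(x_n)\geq\varepsilon$ and $x_n\to x$ weakly satisfies $\|x\|<1-\delta$. *)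

theory Defs
  imports "HOL-Analysis.Analysis"
begin

section \<open>Complex Banach spaces\<close>

class complex_vector = real_vector +
  fixes scaleC :: "complex \<Rightarrow> 'a \<Rightarrow> 'a"  (infixr \<open>*\<^sub>C\<close> 75)
  assumes scaleC_add_right: "c *\<^sub>C (x + y) = c *\<^sub>C x + c *\<^sub>C y"
    and scaleC_add_left: "(c + d) *\<^sub>C x = c *\<^sub>C x + d *\<^sub>C x"
    and scaleC_scaleC: "c *\<^sub>C d *\<^sub>C x = (c * d) *\<^sub>C x"
    and scaleR_scaleC: "r *\<^sub>R x = complex_of_real r *\<^sub>C x"

class complex_normed_vector = complex_vector + real_normed_vector +
  assumes norm_scaleC: "norm (c *\<^sub>C x) = cmod c * norm x"

class complex_banach = complex_normed_vector + complete_space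

subclass (in complex_banach) banach ..

instantiation complex :: complex_banach
begin

definition scaleC_complex :: "complex \<Rightarrow> complex \<Rightarrow> complex"
  where "scaleC_complex c z = c * z"

instance
  by standard
    (simp_all add: scaleC_complex_def algebra_simps norm_mult scaleR_conv_of_real)

end

definition bounded_clinear ::
    "('a::complex_normed_vector \<Rightarrow> 'b::complex_normed_vector) \<Rightarrow> bool"
  where "bounded_clinear f \<longleftrightarrow> bounded_linear f \<and> (\<forall>c x. f (c *\<^sub>C x) = c *\<^sub>C f x)"


section \<open>Hermitian operators and spectrum\<close>

text \<open>\<open>exp_op T\<close> is the exponential of the operator \<open>T\<close>, evaluated pointwise; the series
  converges absolutely when \<open>T\<close> is bounded.\<close>

definition exp_op :: "('a::complex_banach \<Rightarrow> 'a) \<Rightarrow> 'a \<Rightarrow> 'a"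
  where "exp_op T x = (\<Sum>n. (T ^^ n) x /\<^sub>R fact n)"

text \<open>A bounded operator \<open>T\<close> is hermitian if \<open>exp (itT)\<close> is an isometry for every real \<open>t\<close>.
  Surjectivity of these isometries is automatic, since \<open>exp (-itT)\<close> is the inverse.\<close>

definition hermitian_op :: "('a::complex_banach \<Rightarrow> 'a) \<Rightarrow> bool"
  where "hermitian_op T \<longleftrightarrow> bounded_clinear T \<and>
    (\<forall>t::real. \<forall>x. norm (exp_op (\<lambda>y. (\<i> * complex_of_real t) *\<^sub>C T y) x) = norm x)"

definition op_spectrum :: "('a::complex_banach \<Rightarrow> 'a) \<Rightarrow> complex set"
  where "op_spectrum T =
    {c. \<not> (\<exists>S. bounded_clinear S \<and>
          (\<forall>x. S (c *\<^sub>C x - T x) = x) \<and> (\<forall>x. c *\<^sub>C S x - T (S x) = x))}"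


section \<open>JB*-triples\<close>

locale jb_star_triple =
  fixes triple :: "'a::complex_banach \<Rightarrow> 'a \<Rightarrow> 'a \<Rightarrow> 'a"
  assumes continuous_triple: "continuous_on UNIV (\<lambda>(x, y, z). triple x y z)"
    and triple_commute: "triple x y z = triple z y x"
    and triple_add_left: "triple (x + x') y z = triple x y z + triple x' y z"
    and triple_scaleC_left: "triple (c *\<^sub>C x) y z = c *\<^sub>C triple x y z"
    and triple_add_middle: "triple x (y + y') z = triple x y z + triple x y' z"
    and triple_scaleC_middle: "triple x (c *\<^sub>C y) z = cnj c *\<^sub>C triple x y z"
    and jordan_identity:
      "triple a b (triple x y z) =
        triple (triple a b x) y z - triple x (triple b a y) z + triple x y (triple a b z)"
    and hermitian_box: "hermitian_op (triple a a)"
    and nonneg_spectrum_box: "op_spectrum (triple a a) \<subseteq> complex_of_real ` {0..}"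
    and norm_cube: "norm (triple a a a) = norm a ^ 3"


section \<open>Kadec-Klee properties\<close>

definition weakly_tendsto :: "(nat \<Rightarrow> 'a::complex_banach) \<Rightarrow> 'a \<Rightarrow> bool"
  where "weakly_tendsto x l \<longleftrightarrow>
    (\<forall>f :: 'a \<Rightarrow> complex. bounded_clinear f \<longrightarrow> (\<lambda>n. f (x n)) \<longlonglongrightarrow> f l)"

definition sep :: "(nat \<Rightarrow> 'a::complex_banach) \<Rightarrow> real"
  where "sep x = Inf {norm (x n - x m) | n m. n \<noteq> m}"

definition kadec_klee :: "'a::complex_banach itself \<Rightarrow> bool"
  where "kadec_klee (_ :: 'a itself) \<longleftrightarrow>
    (\<forall>(x :: nat \<Rightarrow> 'a) l. (\<forall>n. x n \<in> sphere 0 1) \<longrightarrow> l \<in> sphere 0 1 \<longrightarrow>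
      weakly_tendsto x l \<longrightarrow> x \<longlonglongrightarrow> l)"

definition uniform_kadec_klee :: "'a::complex_banach itself \<Rightarrow> bool"
  where "uniform_kadec_klee (_ :: 'a itself) \<longleftrightarrow>
    (\<forall>\<epsilon>>0. \<exists>\<delta>>0. \<forall>(x :: nat \<Rightarrow> 'a) l. (\<forall>n. x n \<in> cball 0 1) \<longrightarrow> sep x \<ge> \<epsilon> \<longrightarrow>
      weakly_tendsto x l \<longrightarrow> norm l < 1 - \<delta>)"

end

theory Submission
  imports Defs "HOL-Computational_Algebra.Polynomial"
begin

text \<open>
  The uniform property implies the Kadec-Klee property in every Banach space: if a sequence on the
  unit sphere converges weakly but not in norm to a point of the sphere, lower semicontinuity of
  the norm yields a separated subsequence.

  For the converse, iterating \<open>norm {x, x, x} = norm x ^ 3\<close> shows that sums of orthogonal elements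
  carry the maximum norm, so by the Kadec-Klee property there is no infinite sequence of nonzero
  orthogonal elements. A functional calculus for \<open>sin (t L(a, a))\<close>, which needs only that
  \<open>exp (i t L(a, a))\<close> is an isometry, then shows that every \<open>a\<close> is a finite combination of orthogonal
  tripotents. It follows that every \<open>l\<close> is \<open>norm l\<close> times a minimal tripotent \<open>f\<close> plus an element
  of the Peirce space \<open>E0(f)\<close>. Let \<open>x n\<close> in the unit ball converge weakly to \<open>l\<close>. The component of
  \<open>x n - l\<close> in \<open>E2(f)\<close>, which is the complex line through \<open>f\<close>, tends to zero; so does the one in \<open>E0(f)\<close>,
  by the Kadec-Klee property applied to \<open>f + z\<close> with \<open>z\<close> in \<open>E0(f)\<close>; and the one in \<open>E1(f)\<close> is small
  when \<open>norm l\<close> is close to one, because \<open>y\<close> in \<open>E1(f)\<close> contributes at least \<open>(norm y)\<^sup>2 / 2\<close> to the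
  \<open>f\<close>-coefficient of \<open>{y, y, f}\<close>.
\<close>

section \<open>The Hahn-Banach theorem and weak limits\<close>

text \<open>The calculus is built from the axioms alone, without representing the triple by
  functions. That \<open>exp (i t L(a, a))\<close> is isometric bounds a polynomial of degree d in
  the sine by its maximum on [-1, 1] only up to the factor 2 d + 1. Since these operators pass
  through the triple product, the bound can be applied to iterated cubes, where the factor is lost
  in the roots of order 3 ^ n. A small t makes the sine injective on the relevant interval, so its
  eigenvectors are eigenvectors of L(a, a). The space E1(f) is what forces a quantitative argument.
  In a Hilbert space, which is a JB*-triple with the Kadec-Klee property, E1(f) is the orthogonal
  complement of the unit vector f, and weakly null sequences there need not tend to zero in norm.
  Only the constraint that x n stays in the unit ball keeps the E1(f)-component small, of order sqrt
  (1 - norm l).\<close>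

lemma scaleC_one [simp]: "1 *\<^sub>C x = (x::'a::complex_vector)"
  using scaleR_scaleC[of 1 x] by simp

lemma scaleC_zero_left [simp]: "0 *\<^sub>C x = (0::'a::complex_vector)"
  using scaleR_scaleC[of 0 x] by simp

lemma scaleC_scaleR_commute: "c *\<^sub>C r *\<^sub>R x = r *\<^sub>R c *\<^sub>C (x::'a::complex_vector)"
  by (simp add: scaleR_scaleC scaleC_scaleC mult.commute)

lemma bounded_linear_scaleC: "bounded_linear (\<lambda>x::'a::complex_normed_vector. c *\<^sub>C x)"
  by (rule bounded_linear_intro[where K="cmod c"])
    (simp_all add: scaleC_add_right scaleC_scaleR_commute norm_scaleC mult.commute)

lemma scaleC_diff_left: "(c - d) *\<^sub>C x = c *\<^sub>C x - d *\<^sub>C (x::'a::complex_vector)"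
  using scaleC_add_left[of "c - d" d x] by simp

lemma scaleC_minus_left: "(- c) *\<^sub>C x = - (c *\<^sub>C (x::'a::complex_vector))"
  using scaleC_diff_left[of 0 c x] by simp

lemma scaleC_diff_right: "c *\<^sub>C (x - y) = c *\<^sub>C x - c *\<^sub>C (y::'a::complex_vector)"
  using scaleC_add_right[of c "x - y" y] by simp

lemma scaleC_zero_right [simp]: "c *\<^sub>C 0 = (0::'a::complex_vector)"
  using scaleC_diff_right[of c 0 "0::'a"] by simp

lemma scaleR_3: "3 *\<^sub>R x = x + x + (x::'a::real_vector)"
  using scaleR_left_distrib[of 2 1 x] by (simp add: scaleR_2)

lemma scaleR_4: "4 *\<^sub>R x = x + x + x + (x::'a::real_vector)"
  using scaleR_left_distrib[of 3 1 x] by (simp add: scaleR_3)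

text \<open>Positive homogeneity is stated as an inequality because this is what passes to infima;
  scaling back by the inverse gives equality in \<open>sublinear_scale_eq\<close>.\<close>

definition sublinear :: "('a::real_normed_vector \<Rightarrow> real) \<Rightarrow> bool"
  where "sublinear p \<longleftrightarrow> (\<forall>x y. p (x + y) \<le> p x + p y) \<and> (\<forall>t>0. \<forall>x. p (t *\<^sub>R x) \<le> t * p x)"

lemma sublinear_add: "sublinear p \<Longrightarrow> p (x + y) \<le> p x + p y"
  and sublinear_scale: "sublinear p \<Longrightarrow> t > 0 \<Longrightarrow> p (t *\<^sub>R x) \<le> t * p x"
  by (auto simp: sublinear_def)

lemma sublinear_zero: assumes "sublinear p" shows "p 0 = 0"
  using sublinear_scale[OF assms, of 2 0] sublinear_scale[OF assms, of "1/2" 0] by simp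

lemma sublinear_scale_eq:
  assumes "sublinear p" "t > 0" shows "p (t *\<^sub>R x) = t * p x"
proof (rule antisym)
  have "p (inverse t *\<^sub>R t *\<^sub>R x) \<le> inverse t * p (t *\<^sub>R x)"
    using assms by (intro sublinear_scale) auto
  then show "t * p x \<le> p (t *\<^sub>R x)"
    using assms(2) by (simp add: field_simps)
qed (use assms sublinear_scale in auto)

lemma sublinear_minus: assumes "sublinear p" shows "- p (- x) \<le> p x"
  using sublinear_add[OF assms, of x "- x"] sublinear_zero[OF assms] by simp

text \<open>The witness is the infimum over t \<ge> 0 of p (x + t y) - t p y: t = 0 keeps it below
  p, and t = 1 gives the value at -y. Applied to the norm it prepares a norming functional; applied
  to a minimal functional it forces oddness.\<close>

lemma sublinear_shift:
  assumes p: "sublinear p"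
  obtains q where "sublinear q" "q \<le> p" "q (- y) \<le> - p y"
proof
  define f where "f = (\<lambda>x t. p (x + t *\<^sub>R y) - t * p y)"
  define q where "q = (\<lambda>x. INF t\<in>{0..}. f x t)"
  have py: "p (t *\<^sub>R y) = t * p y" if "t \<ge> 0" for t
    using that sublinear_scale_eq[OF p, of t y] sublinear_zero[OF p] by (cases "t = 0") auto
  \<comment> \<open>The bound does not depend on t, so the infimum is finite.\<close>
  have low: "- p (- x) \<le> f x t" if "t \<ge> 0" for x t
    using sublinear_add[OF p, of "x + t *\<^sub>R y" "- x"] py[OF that] by (simp add: f_def)
  have bdd: "bdd_below (f x ` {0..})" for x
    by (intro bdd_belowI2[where m="- p (- x)"]) (use low in auto)
  have q_le: "q x \<le> f x t" if "t \<ge> 0" for x t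
    unfolding q_def using that by (intro cINF_lower bdd) auto
  have q_ge: "m \<le> q x" if "\<And>t. t \<ge> 0 \<Longrightarrow> m \<le> f x t" for m x
    unfolding q_def using that by (intro cINF_greatest) auto
  have "q (x + x') \<le> q x + q x'" for x x'
  proof -
    have "q (x + x') - f x' t' \<le> f x t" if "t \<ge> 0" "t' \<ge> 0" for t t'
      using q_le[of "t + t'" "x + x'"] that
        sublinear_add[OF p, of "x + t *\<^sub>R y" "x' + t' *\<^sub>R y"]
      by (simp add: f_def algebra_simps)
    then have "q (x + x') - f x' t' \<le> q x" if "t' \<ge> 0" for t'
      using that by (intro q_ge)
    then have "q (x + x') - q x \<le> q x'"
      by (intro q_ge) (simp add: algebra_simps)
    then show ?thesis by simp
  qed
  moreover have "q (s *\<^sub>R x) \<le> s * q x" if "s > 0" for s x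
  proof -
    have "q (s *\<^sub>R x) / s \<le> f x t" if "t \<ge> 0" for t
    proof -
      have "q (s *\<^sub>R x) \<le> f (s *\<^sub>R x) (s * t)"
        using that \<open>s > 0\<close> by (intro q_le) simp
      also have "\<dots> = s * f x t"
        using sublinear_scale_eq[OF p \<open>s > 0\<close>, of "x + t *\<^sub>R y"]
        by (simp add: f_def algebra_simps)
      finally show ?thesis using \<open>s > 0\<close> by (simp add: field_simps)
    qed
    then have "q (s *\<^sub>R x) / s \<le> q x" by (rule q_ge)
    then show ?thesis using \<open>s > 0\<close> by (simp add: field_simps)
  qed
  ultimately show "sublinear q" by (simp add: sublinear_def)
  show "q \<le> p" using q_le[of 0] by (auto simp: le_fun_def f_def)
  show "q (- y) \<le> - p y" using q_le[of 1 "- y"] sublinear_zero[OF p] by (simp add: f_def)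
qed

lemma sublinear_minimal:
  assumes p0: "sublinear (p0 :: 'a::real_normed_vector \<Rightarrow> real)"
  obtains p where "sublinear p" "p \<le> p0" "\<And>q. sublinear q \<Longrightarrow> q \<le> p \<Longrightarrow> q = p"
proof -
  define A where "A = {p. sublinear p \<and> p \<le> p0}"
  define P where "P = (\<lambda>p q :: 'a \<Rightarrow> real. q \<le> p)"
  have "\<exists>m\<in>A. \<forall>q\<in>A. P m q \<longrightarrow> q = m"
  proof (rule predicate_Zorn)
    show "partial_order_on A (relation_of P A)"
      by (auto simp: P_def partial_order_on_relation_ofI)
    fix C assume "C \<in> Chains (relation_of P A)"
    then have CA: "C \<subseteq> A" and ch: "\<And>q r. q \<in> C \<Longrightarrow> r \<in> C \<Longrightarrow> q \<le> r \<or> r \<le> q"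
      by (auto simp: Chains_def relation_of_def P_def)
    show "\<exists>u\<in>A. \<forall>q\<in>C. P q u"
    proof (cases "C = {}")
      case True
      then show ?thesis using p0 by (auto simp: A_def)
    next
      case False
      define u where "u = (\<lambda>x. INF q\<in>C. q x)"
      have sub: "sublinear q" and le: "q x \<le> p0 x" if "q \<in> C" for q x
        using that CA by (auto simp: A_def le_fun_def)
      have bdd: "bdd_below ((\<lambda>q. q x) ` C)" for x
      proof (intro bdd_belowI2)
        fix q assume "q \<in> C"
        then show "- p0 (- x) \<le> q x"
          using sublinear_minus[OF sub, of q x] le[of q "- x"] by simp
      qed
      have u_le: "u x \<le> q x" if "q \<in> C" for q x
        unfolding u_def using that by (intro cINF_lower bdd)
      have u_ge: "m \<le> u x" if "\<And>q. q \<in> C \<Longrightarrow> m \<le> q x" for m x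
        unfolding u_def using that False by (intro cINF_greatest) auto
      have "u (x + y) \<le> u x + u y" for x y
      proof -
        \<comment> \<open>Two members of a chain are comparable, and the smaller one serves for both
          arguments; this is why the infimum of a chain is subadditive.\<close>
        have "u (x + y) \<le> q x + r y" if qr: "q \<in> C" "r \<in> C" for q r
        proof -
          obtain s where s: "s \<in> C" "s \<le> q" "s \<le> r" using ch[OF qr] qr by auto
          have "u (x + y) \<le> s x + s y"
            using u_le[OF s(1), of "x + y"] sublinear_add[OF sub[OF s(1)], of x y] by simp
          then show ?thesis
            using le_funD[OF s(2), of x] le_funD[OF s(3), of y] by simp
        qed
        then have "u (x + y) - r y \<le> u x" if "r \<in> C" for r
          using that by (intro u_ge) (simp add: algebra_simps)
        then have "u (x + y) - u x \<le> u y"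
          by (intro u_ge) (simp add: algebra_simps)
        then show ?thesis by simp
      qed
      moreover have "u (t *\<^sub>R x) \<le> t * u x" if "t > 0" for t x
      proof -
        have "u (t *\<^sub>R x) / t \<le> q x" if "q \<in> C" for q
          using u_le[OF that, of "t *\<^sub>R x"] sublinear_scale[OF sub[OF that] \<open>t > 0\<close>, of x] \<open>t > 0\<close>
          by (simp add: field_simps)
        then have "u (t *\<^sub>R x) / t \<le> u x" by (rule u_ge)
        then show ?thesis using \<open>t > 0\<close> by (simp add: field_simps)
      qed
      ultimately have "sublinear u" by (simp add: sublinear_def)
      moreover obtain q where "q \<in> C" using False by blast
      then have "u x \<le> p0 x" for x using u_le[of q x] le[of q x] by simp
      ultimately show ?thesis using u_le by (auto simp: A_def P_def le_fun_def)
    qed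
  qed
  then obtain p where p: "p \<in> A" "\<And>q. q \<in> A \<Longrightarrow> q \<le> p \<Longrightarrow> q = p"
    by (auto simp: P_def)
  show thesis
  proof (rule that[of p])
    show "sublinear p" "p \<le> p0" using p(1) by (auto simp: A_def)
    show "q = p" if "sublinear q" "q \<le> p" for q
      using that p(1) order_trans[OF that(2), of p0] by (intro p(2)) (auto simp: A_def)
  qed
qed

text \<open>A minimal sublinear functional is linear: otherwise \<open>sublinear_shift\<close> would make it smaller.\<close>

lemma hahn_banach_real:
  fixes z :: "'a::real_normed_vector"
  obtains f where "bounded_linear f" "f z = norm z" "\<And>x. \<bar>f x\<bar> \<le> norm x"
proof -
  \<comment> \<open>Shifting the norm along z before minimising: every linear p below
    \<open>p0\<close> then satisfies p (- z) \<le> - norm z, hence p z = norm z.\<close>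
  have "sublinear (norm :: 'a \<Rightarrow> real)" by (simp add: sublinear_def norm_triangle_ineq)
  then obtain p0 where p0: "sublinear p0" "p0 \<le> norm" "p0 (- z) \<le> - norm z"
    by (rule sublinear_shift)
  obtain p where p: "sublinear p" "p \<le> p0" and min: "\<And>q. sublinear q \<Longrightarrow> q \<le> p \<Longrightarrow> q = p"
    by (rule sublinear_minimal[OF p0(1)]) blast
  have minus: "p (- y) = - p y" for y
  proof -
    obtain q where "sublinear q" "q \<le> p" "q (- y) \<le> - p y" using sublinear_shift[OF p(1)] .
    then show ?thesis using min[of q] sublinear_minus[OF p(1), of y] by simp
  qed
  have add: "p (x + y) = p x + p y" for x y
    using sublinear_add[OF p(1), of x y] sublinear_add[OF p(1), of "x + y" "- y"] minus[of y] by simp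
  have scale: "p (t *\<^sub>R x) = t * p x" for t x
    using sublinear_scale_eq[OF p(1), of t x] sublinear_scale_eq[OF p(1), of "- t" x]
      sublinear_zero[OF p(1)] minus[of "t *\<^sub>R x"]
    by (cases t "0::real" rule: linorder_cases) auto
  have le: "p x \<le> norm x" for x
    using p(2) p0(2) by (meson le_funD order_trans)
  have abs: "\<bar>p x\<bar> \<le> norm x" for x
    using le[of x] le[of "- x"] minus[of x] by simp
  show thesis
  proof (rule that[of p])
    show "bounded_linear p"
      by (rule bounded_linear_intro[where K=1]) (simp_all add: add scale abs)
    show "p z = norm z"
      using le_funD[OF p(2), of "- z"] p0(3) minus[of z] le[of z] by simp
  qed (rule abs)
qed

text \<open>Complexification: f x - i f (i x) is complex linear with real part f.\<close>

lemma hahn_banach: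
  fixes z :: "'a::complex_normed_vector"
  obtains g :: "'a \<Rightarrow> complex"
    where "bounded_clinear g" "Re (g z) = norm z" "\<And>x. Re (g x) \<le> norm x"
proof -
  obtain f where f: "bounded_linear f" "f z = norm z" "\<And>x. \<bar>f x\<bar> \<le> norm x"
    using hahn_banach_real[of z] by blast
  interpret f: bounded_linear f by fact
  define g where "g x = complex_of_real (f x) - \<i> * complex_of_real (f (\<i> *\<^sub>C x))" for x
  have "g (c *\<^sub>C x) = c *\<^sub>C g x" for c x
  proof -
    have eq: "complex_of_real (Re c) + complex_of_real (Im c) * \<i> = c"
      "complex_of_real (Re c) * \<i> - complex_of_real (Im c) = \<i> * c"
      by (simp_all add: complex_eq_iff)
    have c: "c *\<^sub>C x = Re c *\<^sub>R x + Im c *\<^sub>R \<i> *\<^sub>C x"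
      by (simp add: scaleR_scaleC scaleC_scaleC eq flip: scaleC_add_left)
    have "\<i> *\<^sub>C c *\<^sub>C x = Re c *\<^sub>R \<i> *\<^sub>C x + (- Im c) *\<^sub>R x"
      by (simp add: scaleR_scaleC scaleC_scaleC eq flip: scaleC_add_left)
    then have ic: "f (\<i> *\<^sub>C c *\<^sub>C x) = Re c * f (\<i> *\<^sub>C x) - Im c * f x"
      by (simp add: f.add f.scaleR f.diff)
    show ?thesis
      unfolding g_def ic by (subst c) (simp add: f.add f.scaleR scaleC_complex_def complex_eq_iff)
  qed
  moreover have "bounded_linear g"
    unfolding g_def
    by (intro bounded_linear_sub bounded_linear_mult_right[THEN bounded_linear_compose]
        bounded_linear_of_real[THEN bounded_linear_compose] f(1)
        bounded_linear_compose[OF f(1) bounded_linear_scaleC])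
  ultimately have "bounded_clinear g" by (simp add: bounded_clinear_def)
  then show thesis
    by (rule that[of g]) (use f in \<open>auto simp: g_def abs_le_iff\<close>)
qed

section \<open>Weak convergence and separated sequences\<close>

lemma weakly_tendsto_subseq:
  "weakly_tendsto x l \<Longrightarrow> strict_mono r \<Longrightarrow> weakly_tendsto (x \<circ> r) l"
  unfolding weakly_tendsto_def using LIMSEQ_subseq_LIMSEQ[of "\<lambda>n. _ (x n)" _ r] by (auto simp: o_def)

text \<open>Lower semicontinuity of the norm, localised: the real part of a functional norming w - l
  converges along w - x n and bounds its norm from below.\<close>

lemma weakly_tendsto_dist_bound:
  assumes x: "weakly_tendsto x l" and e: "e < norm (w - l)"
  shows "\<forall>\<^sub>F n in sequentially. e < norm (w - x n)"
proof -
  obtain g :: "'a \<Rightarrow> complex" where g: "bounded_clinear g" "Re (g (w - l)) = norm (w - l)"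
    "\<And>x. Re (g x) \<le> norm x" using hahn_banach[of "w - l"] by blast
  interpret g: bounded_linear g using g(1) by (simp add: bounded_clinear_def)
  have "(\<lambda>n. Re (g w - g (x n))) \<longlonglongrightarrow> Re (g w - g l)"
    using x g(1) by (intro tendsto_intros) (auto simp: weakly_tendsto_def)
  then have "(\<lambda>n. Re (g (w - x n))) \<longlonglongrightarrow> norm (w - l)"
    using g(2) by (simp add: g.diff)
  from order_tendstoD(1)[OF this e] show ?thesis
    by eventually_elim (rule less_le_trans[OF _ g(3)])
qed

lemma le_sepI:
  assumes "\<And>n m. n \<noteq> m \<Longrightarrow> e \<le> norm (x n - x m)"
  shows "e \<le> sep x"
  unfolding sep_def
proof (rule cInf_greatest)
  have "norm (x 0 - x (Suc 0)) \<in> {norm (x n - x m) | n m. n \<noteq> m}"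
    by (intro CollectI exI[of _ 0] exI[of _ "Suc 0"]) simp
  then show "{norm (x n - x m) | n m. n \<noteq> m} \<noteq> {}" by blast
qed (use assms in auto)

lemma sep_le:
  assumes "n \<noteq> m"
  shows "sep x \<le> norm (x n - x m)"
  unfolding sep_def using assms by (intro cInf_lower bdd_belowI[where m=0]) auto

lemma uniform_kadec_klee_imp_kadec_klee:
  assumes ukk: "uniform_kadec_klee TYPE('a::complex_banach)"
  shows "kadec_klee TYPE('a)"
  unfolding kadec_klee_def
proof (intro allI impI)
  fix x :: "nat \<Rightarrow> 'a" and l
  assume x: "\<forall>n. x n \<in> sphere 0 1" and l: "l \<in> sphere 0 1" and w: "weakly_tendsto x l"
  show "x \<longlonglongrightarrow> l"
  proof (rule ccontr)
    assume "\<not> x \<longlonglongrightarrow> l"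
    then obtain e where e: "e > 0" "\<exists>\<^sub>F n in sequentially. \<not> dist (x n) l < e"
      by (auto simp: tendsto_iff not_eventually)
    obtain r :: "nat \<Rightarrow> nat" where r: "strict_mono r" "\<And>n. e \<le> norm (x (r n) - l)"
    proof -
      have "infinite {n. \<not> dist (x n) l < e}"
        using e(2) by (simp add: frequently_cofinite flip: cofinite_eq_sequentially)
      from infinite_enumerate[OF this] that show thesis
        by (auto simp: dist_norm not_less)
    qed
    define y where "y = x \<circ> r"
    have wy: "weakly_tendsto y l" unfolding y_def by (intro weakly_tendsto_subseq w r)
    \<comment> \<open>The weak limit l lies farther than e / 2 from y k, so almost all members of
      the sequence do as well.\<close>
    have "\<exists>N. \<forall>n\<ge>N. e / 2 \<le> norm (y k - y n)" for k
    proof -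
      have "e / 2 < norm (y k - l)" using r(2)[of k] e(1) by (simp add: y_def)
      from weakly_tendsto_dist_bound[OF wy this] show ?thesis
        unfolding eventually_sequentially using less_imp_le by blast
    qed
    then obtain N where N: "\<And>k n. N k \<le> n \<Longrightarrow> e / 2 \<le> norm (y k - y n)" by metis
    \<comment> \<open>The sum dominates N at every index up to the current one, so each new index is
      admissible for all earlier ones at once.\<close>
    define s where "s = rec_nat 0 (\<lambda>_ m. (\<Sum>i\<le>m. N i) + m + 1)"
    have s_Suc: "s (Suc j) = (\<Sum>i\<le>s j. N i) + s j + 1" for j by (simp add: s_def)
    have sm: "strict_mono s" by (simp add: strict_mono_Suc_iff s_Suc)
    have sep1: "e / 2 \<le> norm (y (s i) - y (s j))" if "i < j" for i j
    proof (rule N)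
      obtain k where k: "j = Suc k" "i \<le> k" using \<open>i < j\<close> less_Suc_eq_le by (cases j) auto
      then have "s i \<le> s k" using sm by (simp add: strict_mono_less_eq)
      then have "N (s i) \<le> (\<Sum>i\<le>s k. N i)" by (intro member_le_sum) auto
      then show "N (s i) \<le> s j" by (simp add: k s_Suc)
    qed
    have "e / 2 \<le> sep (y \<circ> s)"
    proof (rule le_sepI)
      fix n m :: nat assume "n \<noteq> m"
      then show "e / 2 \<le> norm ((y \<circ> s) n - (y \<circ> s) m)"
        using sep1[of n m] sep1[of m n] by (cases n m rule: linorder_cases) (auto simp: norm_minus_commute)
    qed
    moreover have "weakly_tendsto (y \<circ> s) l" by (intro weakly_tendsto_subseq wy sm)
    moreover have "\<forall>n. (y \<circ> s) n \<in> cball 0 1" using x by (simp add: y_def)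
    moreover obtain d where "d > 0" "\<forall>(x :: nat \<Rightarrow> 'a) l. (\<forall>n. x n \<in> cball 0 1) \<longrightarrow> sep x \<ge> e / 2 \<longrightarrow>
      weakly_tendsto x l \<longrightarrow> norm l < 1 - d"
      using ukk[unfolded uniform_kadec_klee_def, rule_format, of "e / 2"] e(1) by auto
    ultimately have "norm l < 1 - d" by blast
    with l \<open>d > 0\<close> show False by simp
  qed
qed

section \<open>The Peirce decomposition\<close>

context jb_star_triple
begin

lemma triple_add_right: "triple x y (z + z') = triple x y z + triple x y z'"
  by (simp add: triple_commute[of x] triple_add_left)

lemma triple_scaleC_right: "triple x y (c *\<^sub>C z) = c *\<^sub>C triple x y z"
  by (simp add: triple_commute[of x] triple_scaleC_left)

lemma triple_scaleR_left: "triple (r *\<^sub>R x) y z = r *\<^sub>R triple x y z"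
  and triple_scaleR_middle: "triple x (r *\<^sub>R y) z = r *\<^sub>R triple x y z"
  and triple_scaleR_right: "triple x y (r *\<^sub>R z) = r *\<^sub>R triple x y z"
  by (simp_all add: scaleR_scaleC triple_scaleC_left triple_scaleC_middle triple_scaleC_right)

lemma linear_triple:
  "linear (\<lambda>x. triple x y z)" "linear (\<lambda>y. triple x y z)" "linear (\<lambda>z. triple x y z)"
  by (rule linearI; simp add: triple_add_left triple_add_middle triple_add_right
      triple_scaleR_left triple_scaleR_middle triple_scaleR_right)+

lemmas triple_zero [simp] = linear_triple[THEN linear_0]
lemmas triple_minus = linear_triple[THEN linear_neg]
lemmas triple_diff = linear_triple[THEN linear_diff]
lemmas triple_sum = linear_triple[THEN linear_sum]

lemmas triple_linear = triple_add_left triple_add_middle triple_add_right triple_diff triple_minus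
  triple_scaleR_left triple_scaleR_middle triple_scaleR_right

lemma triple_bound:
  obtains M where "M > 0" "\<And>x y z. norm (triple x y z) \<le> M * (norm x * norm y * norm z)"
proof -
  have "continuous (at (0, 0, 0)) (\<lambda>(x, y, z). triple x y z)"
    using continuous_triple by (simp add: continuous_on_eq_continuous_at)
  from this[unfolded continuous_at_eps_delta, rule_format, of 1]
  obtain d where d0: "d > 0" "\<And>p. dist p (0, 0, 0) < d \<Longrightarrow> norm (case p of (x, y, z) \<Rightarrow> triple x y z) < 1"
    by auto
  have d: "d > 0" "\<And>x y z. norm (x, y, z) < d \<Longrightarrow> norm (triple x y z) < 1"
    using d0(1) d0(2)[of "(_, _, _)"] by (simp_all add: dist_norm)
  \<comment> \<open>Three vectors of norm d / 4 have joint norm at most 3 d / 4, inside the ball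
    provided by continuity at the origin; homogeneity does the rest.\<close>
  define r where "r = d / 4"
  have r: "r > 0" using d(1) by (simp add: r_def)
  have *: "norm (triple x y z) < 1" if "norm x = r" "norm y = r" "norm z = r" for x y z
  proof (rule d(2))
    have "norm (x, y, z) \<le> norm x + (norm y + norm z)"
      by (meson add_left_mono norm_Pair_le order_trans)
    then show "norm (x, y, z) < d" using that d(1) by (simp add: r_def)
  qed
  show thesis
  proof
    show "inverse r ^ 3 > 0" using r by simp
    fix x y z
    show "norm (triple x y z) \<le> inverse r ^ 3 * (norm x * norm y * norm z)"
    proof (cases "x = 0 \<or> y = 0 \<or> z = 0")
      case False
      define u where "u w = (r / norm w) *\<^sub>R w" for w :: 'a
      have u: "w = (norm w / r) *\<^sub>R u w" "norm (u w) = r" if "w \<noteq> 0" for w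
        using r that by (simp_all add: u_def)
      have "triple x y z = (norm x / r * (norm y / r * (norm z / r))) *\<^sub>R triple (u x) (u y) (u z)"
        using False by (subst (1) u(1)[of x], simp, subst (1) u(1)[of y], simp, subst (1) u(1)[of z], simp)
          (simp add: triple_linear)
      then have "norm (triple x y z) = norm x / r * (norm y / r * (norm z / r)) * norm (triple (u x) (u y) (u z))"
        using r by (simp add: abs_mult)
      also have "\<dots> \<le> norm x / r * (norm y / r * (norm z / r)) * 1"
        using * u(2) False r by (intro mult_left_mono) (auto intro: less_imp_le)
      finally show ?thesis using r by (simp add: field_simps power3_eq_cube)
    qed auto
  qed
qed

lemma bounded_linear_triple:
  "bounded_linear (\<lambda>x. triple x y z)" "bounded_linear (\<lambda>y. triple x y z)"
  "bounded_linear (\<lambda>z. triple x y z)"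
proof -
  obtain M where M: "M > 0" "\<And>x y z. norm (triple x y z) \<le> M * (norm x * norm y * norm z)"
    using triple_bound by blast
  show "bounded_linear (\<lambda>x. triple x y z)"
    by (rule bounded_linear_intro[where K="M * (norm y * norm z)"])
      (use M(2)[of _ y z] in \<open>simp_all add: triple_linear mult_ac\<close>)
  show "bounded_linear (\<lambda>y. triple x y z)"
    by (rule bounded_linear_intro[where K="M * (norm x * norm z)"])
      (use M(2)[of x _ z] in \<open>simp_all add: triple_linear mult_ac\<close>)
  show "bounded_linear (\<lambda>z. triple x y z)"
    by (rule bounded_linear_intro[where K="M * (norm x * norm y)"])
      (use M(2)[of x y] in \<open>simp_all add: triple_linear mult_ac\<close>)
qed

lemma tendsto_triple [tendsto_intros]:
  assumes "(f \<longlongrightarrow> x) F" "(g \<longlongrightarrow> y) F" "(h \<longlongrightarrow> z) F"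
  shows "((\<lambda>t. triple (f t) (g t) (h t)) \<longlongrightarrow> triple x y z) F"
proof -
  have "isCont (\<lambda>(x, y, z). triple x y z) (x, y, z)"
    using continuous_triple by (simp add: continuous_on_eq_continuous_at)
  from isCont_tendsto_compose[OF this tendsto_Pair[OF assms(1) tendsto_Pair[OF assms(2,3)]]]
  show ?thesis by simp
qed

lemma jordan_identity_middle:
  "triple x (triple b a y) z = triple (triple a b x) y z + triple x y (triple a b z) - triple a b (triple x y z)"
  by (simp add: jordan_identity[of a b x y z])

section \<open>Tripotents and their Peirce spaces\<close>

definition tripotent :: "'a \<Rightarrow> bool"
  where "tripotent e \<longleftrightarrow> triple e e e = e"

text \<open>The index is the eigenvalue of L(e, e), not the usual Peirce number: E2, E1, E0 are
  \<open>peirce e 1\<close>, \<open>peirce e (1/2)\<close>, \<open>peirce e 0\<close>. The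
  projections \<open>peirce2\<close>, \<open>peirce1\<close>, \<open>peirce0\<close> below carry the
  usual numbers.\<close>

definition peirce :: "'a \<Rightarrow> real \<Rightarrow> 'a set"
  where "peirce e c = {x. triple e e x = c *\<^sub>R x}"

lemma mem_peirce: "x \<in> peirce e c \<longleftrightarrow> triple e e x = c *\<^sub>R x"
  by (simp add: peirce_def)

lemma subspace_peirce: "subspace (peirce e c)"
  by (auto simp: subspace_def mem_peirce triple_linear algebra_simps)

lemma closed_peirce: "closed (peirce e c)"
  unfolding peirce_def
  by (intro closed_Collect_eq continuous_intros linear_continuous_on bounded_linear_triple)

lemma tripotent_mem_peirce: "tripotent e \<Longrightarrow> e \<in> peirce e 1"
  by (simp add: tripotent_def mem_peirce)

lemma norm_tripotent:
  assumes "tripotent e" "e \<noteq> 0" shows "norm e = 1"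
proof -
  have "norm e ^ 3 = norm e" using norm_cube[of e] assms(1) by (simp add: tripotent_def)
  then have "norm e ^ 2 = 1" using assms(2) by (simp add: power3_eq_cube power2_eq_square)
  then show ?thesis by (simp add: power2_eq_1_iff) (smt (verit) norm_ge_zero)
qed

text \<open>The Jordan identity with a = b = e; its negative middle term is the source of -
  j.\<close>

lemma peirce_rule:
  assumes "x \<in> peirce e i" "y \<in> peirce e j" "z \<in> peirce e k"
  shows "triple x y z \<in> peirce e (i - j + k)"
  using assms jordan_identity[of e e x y z]
  by (simp add: mem_peirce triple_linear algebra_simps)

text \<open>The Jordan identity is used for L(e, e) on {e, x, e} and for L(e, x) on {e, e, e};
  eliminating the common term {e, {e, e, x}, e} leaves three times the claim.\<close>

lemma box_triple_self:
  assumes "tripotent e" shows "triple e e (triple e x e) = triple e x e"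
proof -
  let ?q = "triple e x e"
  have e: "triple e e e = e" using assms by (simp add: tripotent_def)
  have 1: "triple e e ?q = ?q - triple e (triple e e x) e + ?q"
    using jordan_identity[of e e e x e] e by simp
  have 2: "?q = triple e e ?q - triple e (triple e e x) e + triple e e ?q"
    using jordan_identity[of e x e e e] e
    by (simp add: triple_commute[of x e e] triple_commute[of ?q e e])
  have "triple e (triple e e x) e = ?q - triple e e ?q + ?q"
    using 1 by (simp add: algebra_simps)
  with 2 have "3 *\<^sub>R (triple e e ?q - ?q) = 0"
    by (simp add: scaleR_3 algebra_simps)
  then show ?thesis by simp
qed

text \<open>With Q x = {e, x, e} and L = L(e, e) this reads Q Q = 2 L L - L, the polynomial that
  later defines \<open>peirce2\<close>.\<close>

lemma triple_triple_self:
  assumes "tripotent e"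
  shows "triple e (triple e x e) e = 2 *\<^sub>R triple e e (triple e e x) - triple e e x"
  using jordan_identity_middle[of e e x e e] assms
  by (simp add: tripotent_def scaleR_2 triple_commute[of x e e] triple_commute[of "triple e e x" e e])

text \<open>L fixes the range of Q, hence L (2 L L - L) = 2 L L - L. The polynomial is t (2 t - 1)
  (t - 1), which leaves the eigenvalues 0, 1/2 and 1.\<close>

lemma box_cubic:
  assumes "tripotent e"
  shows "2 *\<^sub>R triple e e (triple e e (triple e e x)) - 3 *\<^sub>R triple e e (triple e e x) + triple e e x = 0"
proof -
  have "triple e e (2 *\<^sub>R triple e e (triple e e x) - triple e e x)
      = 2 *\<^sub>R triple e e (triple e e x) - triple e e x"
    using box_triple_self[OF assms, of "triple e x e"] by (simp add: triple_triple_self[OF assms])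
  then show ?thesis by (simp add: triple_linear scaleR_2 scaleR_3 algebra_simps)
qed

lemma peirce_trivial:
  assumes e: "tripotent e" and x: "x \<in> peirce e c" and c: "c \<notin> {0, 1/2, 1}"
  shows "x = 0"
proof -
  have "(2 * c ^ 3 - 3 * c ^ 2 + c) *\<^sub>R x = 0"
    using box_cubic[OF e, of x] x
    by (simp add: mem_peirce triple_linear algebra_simps power3_eq_cube power2_eq_square)
  moreover have "2 * c ^ 3 - 3 * c ^ 2 + c = 2 * c * (c - 1/2) * (c - 1)"
    by (simp add: algebra_simps power3_eq_cube power2_eq_square)
  ultimately show ?thesis using c by auto
qed

lemma peirce_triple_zero:
  assumes e: "tripotent e" and x: "x \<in> peirce e i" "y \<in> peirce e j" "z \<in> peirce e k"
    and c: "i - j + k \<notin> {0, 1/2, 1}"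
  shows "triple x y z = 0"
  using peirce_trivial[OF e peirce_rule[OF x] c] .

lemma peirce_Int:
  assumes "x \<in> peirce e c" "x \<in> peirce e d" "c \<noteq> d" shows "x = 0"
  using assms by (auto simp: mem_peirce)

text \<open>The three projections are the Lagrange polynomials for the nodes 1, 1/2 and 0, evaluated
  at L(e, e).\<close>

definition peirce2 :: "'a \<Rightarrow> 'a \<Rightarrow> 'a"
  where "peirce2 e x = 2 *\<^sub>R triple e e (triple e e x) - triple e e x"

definition peirce1 :: "'a \<Rightarrow> 'a \<Rightarrow> 'a"
  where "peirce1 e x = 4 *\<^sub>R (triple e e x - triple e e (triple e e x))"

definition peirce0 :: "'a \<Rightarrow> 'a \<Rightarrow> 'a"
  where "peirce0 e x = x - 3 *\<^sub>R triple e e x + 2 *\<^sub>R triple e e (triple e e x)"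

lemma peirce_decomp: "x = peirce2 e x + peirce1 e x + peirce0 e x"
  by (simp add: peirce2_def peirce1_def peirce0_def scaleR_2 scaleR_3 scaleR_4 algebra_simps)

lemma peirce_projections:
  assumes "tripotent e"
  shows "peirce2 e x \<in> peirce e 1" "peirce1 e x \<in> peirce e (1/2)" "peirce0 e x \<in> peirce e 0"
proof -
  define a b c where "a = triple e e x" and "b = triple e e a" and "c = triple e e b"
  have a: "a = b + b + b - c - c"
    using box_cubic[OF assms, of x] by (simp add: a_def b_def c_def scaleR_2 scaleR_3 algebra_simps)
  have "a - b = 2 *\<^sub>R (b - c)"
    unfolding a by (simp add: scaleR_2 algebra_simps)
  then have "peirce1 e x = 8 *\<^sub>R (b - c)"
    by (simp add: peirce1_def flip: a_def b_def)
  moreover have "triple e e (peirce1 e x) = 4 *\<^sub>R (b - c)"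
    by (simp add: peirce1_def triple_linear flip: a_def b_def c_def)
  ultimately show "peirce1 e x \<in> peirce e (1/2)"
    by (simp add: mem_peirce)
  show "peirce2 e x \<in> peirce e 1" "peirce0 e x \<in> peirce e 0"
    by (simp_all add: mem_peirce peirce2_def peirce0_def triple_linear flip: a_def b_def c_def)
      (simp_all add: a scaleR_2 scaleR_3 algebra_simps)
qed

lemma peirce2_of:
  assumes "x \<in> peirce e c" shows "peirce2 e x = (2 * c ^ 2 - c) *\<^sub>R x"
  using assms by (simp add: mem_peirce peirce2_def triple_linear algebra_simps power2_eq_square)

lemma peirce1_of:
  assumes "x \<in> peirce e c" shows "peirce1 e x = (4 * (c - c ^ 2)) *\<^sub>R x"
  using assms by (simp add: mem_peirce peirce1_def triple_linear algebra_simps power2_eq_square)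

lemma bounded_clinear_peirce:
  "bounded_clinear (peirce2 e)" "bounded_clinear (peirce1 e)" "bounded_clinear (peirce0 e)"
proof -
  have L: "bounded_linear (\<lambda>x. triple e e x)" "bounded_linear (\<lambda>x. triple e e (triple e e x))"
    by (intro bounded_linear_triple bounded_linear_compose[OF bounded_linear_triple(3)])+
  have "bounded_linear (peirce2 e)" "bounded_linear (peirce1 e)" "bounded_linear (peirce0 e)"
    unfolding peirce2_def[abs_def] peirce1_def[abs_def] peirce0_def[abs_def]
    by (intro bounded_linear_add bounded_linear_sub bounded_linear_ident
        bounded_linear_const_scaleR L)+
  then show "bounded_clinear (peirce2 e)" "bounded_clinear (peirce1 e)" "bounded_clinear (peirce0 e)"
    by (simp_all add: bounded_clinear_def peirce2_def peirce1_def peirce0_def triple_scaleC_right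
        scaleC_scaleR_commute scaleC_add_right scaleC_diff_right)
qed

text \<open>After splitting z into Peirce components, index arithmetic removes all but one case for
  each claim. For L(e, y) and z in E0, and for L(y, e) and z in E2, a further Jordan identity
  conflicts with the arithmetic or kills the product directly.\<close>

lemma box_peirce0:
  assumes e: "tripotent e" and y: "y \<in> peirce e 0"
  shows "triple e y z = 0" "triple y e z = 0"
proof -
  have e1: "e \<in> peirce e 1" by (rule tripotent_mem_peirce[OF e])
  have eye: "triple e y e = 0" by (rule peirce_triple_zero[OF e e1 y e1]) simp
  have yee: "triple y e e = 0" "triple e e y = 0"
    using y by (simp_all add: mem_peirce triple_commute[of y])
  have 1: "triple e y z = 0" if z: "z \<in> peirce e c" "c \<in> {0, 1/2, 1}" for z c
  proof (cases "c = 0")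
    case True
    then have "triple e e z = 0" using z by (simp add: mem_peirce)
    moreover have "triple e y z \<in> peirce e 1"
      using peirce_rule[OF e1 y, of z 0] z True by simp
    ultimately show ?thesis
      using jordan_identity[of e y e e z] by (simp add: eye yee mem_peirce)
  next
    case False
    then show ?thesis using z by (intro peirce_triple_zero[OF e e1 y z(1)]) auto
  qed
  show "triple e y z = 0"
    using 1[OF peirce_projections(1)[OF e, of z]] 1[OF peirce_projections(2)[OF e, of z]]
      1[OF peirce_projections(3)[OF e, of z]]
    by (subst peirce_decomp[of z e]) (simp add: triple_add_right)
  have 2: "triple y e z = 0" if z: "z \<in> peirce e c" "c \<in> {0, 1/2, 1}" for z c
  proof (cases "c = 1")
    case True
    then have "triple e e z = z" using z by (simp add: mem_peirce)
    then have "triple y e z \<in> peirce e 1"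
      using jordan_identity[of y e e e z] by (simp add: eye yee mem_peirce)
    moreover have "triple y e z \<in> peirce e 0"
      using peirce_rule[OF y e1, of z 1] z True by simp
    ultimately show ?thesis by (rule peirce_Int) simp
  next
    case False
    then show ?thesis using z by (intro peirce_triple_zero[OF e y e1 z(1)]) auto
  qed
  show "triple y e z = 0"
    using 2[OF peirce_projections(1)[OF e, of z]] 2[OF peirce_projections(2)[OF e, of z]]
      2[OF peirce_projections(3)[OF e, of z]]
    by (subst peirce_decomp[of z e]) (simp add: triple_add_right)
qed

lemma triple_triple_self_peirce1:
  assumes "tripotent e" "x \<in> peirce e 1" shows "triple e (triple e x e) e = x"
  using triple_triple_self[OF assms(1), of x] assms(2) by (simp add: mem_peirce scaleR_2)

text \<open>An element x of E2 is {e, x', e} with x' = {e, x, e}, and the Jordan identity reduces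
  its products with y to products of e with y, which vanish.\<close>

lemma peirce1_orth_peirce0:
  assumes e: "tripotent e" and x: "x \<in> peirce e 1" and y: "y \<in> peirce e 0"
  shows "triple x y z = 0" "triple y x z = 0"
proof -
  define x' where "x' = triple e x e"
  have x': "x = triple e x' e" by (simp add: x'_def triple_triple_self_peirce1[OF e x])
  note [simp] = box_peirce0[OF e y]
  have [simp]: "triple w e y = 0" for w by (simp add: triple_commute[of w])
  show "triple x y z = 0"
    using jordan_identity[of e x' e y z] by (simp add: x')
  show "triple y x z = 0"
    using jordan_identity_middle[of y e x' e z] by (simp add: x')
qed

end

section \<open>Orthogonality and weak convergence\<close>

text \<open>Roots of order 3 ^ n absorb any factor that is linear in 3 ^ n. The constant part serves
  the norms of orthogonal sums, the linear part the degree factor of the functional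
  calculus.\<close>

lemma power3_bound_imp_le:
  fixes u v C D :: real
  assumes nn: "u \<ge> 0" "v \<ge> 0" and le: "\<And>n. u ^ 3 ^ n \<le> (C * 3 ^ n + D) * v ^ 3 ^ n"
  shows "u \<le> v"
proof (rule ccontr)
  assume "\<not> u \<le> v"
  then have u: "u > 0" and vu: "v / u < 1" "v / u \<ge> 0" using nn by auto
  define g where "g = (\<lambda>N::nat. C * (real N * (v / u) ^ N) + D * (v / u) ^ N)"
  have "g \<longlonglongrightarrow> C * 0 + D * 0"
    unfolding g_def using vu powser_times_n_limit_0[of "v / u"]
    by (intro tendsto_intros LIMSEQ_realpow_zero) auto
  moreover have "strict_mono (\<lambda>n::nat. 3 ^ n :: nat)" by (simp add: strict_mono_Suc_iff)
  ultimately have "(\<lambda>n. g (3 ^ n)) \<longlonglongrightarrow> 0"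
    using LIMSEQ_subseq_LIMSEQ[of g 0 "\<lambda>n. 3 ^ n"] by (simp add: o_def)
  moreover have "1 \<le> g (3 ^ n)" for n
    using le[of n] u by (simp add: g_def power_divide field_simps)
  ultimately have "(1::real) \<le> 0" by (intro LIMSEQ_le_const) auto
  then show False by simp
qed

lemma weakly_tendsto_image:
  assumes "weakly_tendsto x l" "bounded_clinear P"
  shows "weakly_tendsto (\<lambda>n. P (x n)) (P l)"
  unfolding weakly_tendsto_def
proof (intro allI impI)
  fix f :: "'b \<Rightarrow> complex" assume "bounded_clinear f"
  then have "bounded_clinear (\<lambda>x. f (P x))"
    using assms(2) by (auto simp: bounded_clinear_def intro: bounded_linear_compose)
  then show "(\<lambda>n. f (P (x n))) \<longlonglongrightarrow> f (P l)" using assms(1)[unfolded weakly_tendsto_def, rule_format, of "\<lambda>x. f (P x)"] by simp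
qed

lemma exp_op_eigenvector_sums:
  fixes T :: "'a::complex_banach \<Rightarrow> 'a"
  assumes "\<And>c x. T (c *\<^sub>C x) = c *\<^sub>C T x" "T v = z *\<^sub>C v"
  shows "(\<lambda>n. (T ^^ n) v /\<^sub>R fact n) sums (exp z *\<^sub>C v)"
proof -
  have "(T ^^ n) v = z ^ n *\<^sub>C v" for n
    by (induction n) (simp_all add: assms scaleC_scaleC mult.commute)
  moreover have "bounded_linear (\<lambda>z. z *\<^sub>C v)"
    by (rule bounded_linear_intro[where K="norm v"])
      (simp_all add: scaleC_add_left scaleR_scaleC scaleC_scaleC scaleR_conv_of_real norm_scaleC scaleC_complex_def)
  from bounded_linear.sums[OF this exp_converges[of z]]
  have "(\<lambda>n. (z ^ n /\<^sub>R fact n) *\<^sub>C v) sums (exp z *\<^sub>C v)" .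
  moreover have "(z ^ n /\<^sub>R fact n) *\<^sub>C v = (z ^ n *\<^sub>C v) /\<^sub>R fact n" for n
    by (simp add: scaleR_scaleC scaleC_scaleC scaleC_complex_def)
  ultimately show ?thesis by simp
qed

context jb_star_triple
begin

section \<open>Orthogonal families and the maximum norm\<close>

definition cube :: "'a \<Rightarrow> 'a"
  where "cube x = triple x x x"

lemma norm_cube_funpow: "norm ((cube ^^ n) x) = norm x ^ 3 ^ n"
proof (induction n)
  case (Suc n)
  have "(norm x ^ 3 ^ n) ^ 3 = norm x ^ 3 ^ Suc n" by (simp only: power_Suc2 power_mult)
  with Suc show ?case by (simp add: cube_def norm_cube)
qed simp

text \<open>Closure under cubes keeps iterated cubes of members in their own subspaces, so that
  cubing acts on sums component by component.\<close>

definition orth_family :: "('i \<Rightarrow> 'a set) \<Rightarrow> bool"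
  where "orth_family D \<longleftrightarrow> (\<forall>i. subspace (D i) \<and> (\<forall>x\<in>D i. cube x \<in> D i)) \<and>
    (\<forall>i j k. \<forall>x\<in>D i. \<forall>y\<in>D j. \<forall>z\<in>D k. \<not> (i = j \<and> j = k) \<longrightarrow> triple x y z = 0)"

lemma orth_family_zero:
  "orth_family D \<Longrightarrow> x \<in> D i \<Longrightarrow> y \<in> D j \<Longrightarrow> z \<in> D k \<Longrightarrow> \<not> (i = j \<and> j = k) \<Longrightarrow> triple x y z = 0"
  and orth_family_cube: "orth_family D \<Longrightarrow> x \<in> D i \<Longrightarrow> cube x \<in> D i"
  and orth_family_scaleR: "orth_family D \<Longrightarrow> x \<in> D i \<Longrightarrow> r *\<^sub>R x \<in> D i"
  by (unfold orth_family_def subspace_def) blast+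

lemma cube_orth_sum:
  assumes D: "orth_family D" and I: "finite I" and x: "\<And>i. i \<in> I \<Longrightarrow> x i \<in> D i"
  shows "cube (\<Sum>i\<in>I. x i) = (\<Sum>i\<in>I. cube (x i))"
proof -
  have "cube (\<Sum>i\<in>I. x i) = (\<Sum>i\<in>I. \<Sum>j\<in>I. \<Sum>k\<in>I. triple (x i) (x j) (x k))"
    by (simp only: cube_def triple_sum(1), simp only: triple_sum(2), simp only: triple_sum(3))
  also have "\<dots> = (\<Sum>i\<in>I. \<Sum>j\<in>I. \<Sum>k\<in>I. if i = k then if i = j then cube (x i) else 0 else 0)"
    by (intro sum.cong refl) (auto simp: cube_def intro!: orth_family_zero[OF D] x)
  also have "\<dots> = (\<Sum>i\<in>I. cube (x i))"
    using I by (simp add: sum.delta cong: sum.cong)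
  finally show ?thesis .
qed

lemma cube_funpow_orth_sum:
  assumes D: "orth_family D" and I: "finite I" and x: "\<And>i. i \<in> I \<Longrightarrow> x i \<in> D i"
  shows "(cube ^^ n) (\<Sum>i\<in>I. x i) = (\<Sum>i\<in>I. (cube ^^ n) (x i))"
proof (induction n)
  case (Suc n)
  have "(cube ^^ n) (x i) \<in> D i" if "i \<in> I" for i
    by (induction n) (use x that in \<open>auto intro: orth_family_cube[OF D]\<close>)
  then show ?case by (simp add: Suc cube_orth_sum[OF D I])
qed simp

text \<open>The triangle inequality for the n-th iterated cube costs the factor
  \<open>card I\<close>, which disappears in the limit.\<close>

lemma norm_orth_sum_le:
  assumes D: "orth_family D" and I: "finite I" and x: "\<And>i. i \<in> I \<Longrightarrow> x i \<in> D i"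
    and m: "m \<ge> 0" "\<And>i. i \<in> I \<Longrightarrow> norm (x i) \<le> m"
  shows "norm (\<Sum>i\<in>I. x i) \<le> m"
proof (rule power3_bound_imp_le)
  fix n
  have "norm (\<Sum>i\<in>I. x i) ^ 3 ^ n = norm (\<Sum>i\<in>I. (cube ^^ n) (x i))"
    by (simp add: cube_funpow_orth_sum[OF D I x] flip: norm_cube_funpow)
  also have "\<dots> \<le> (\<Sum>i\<in>I. m ^ 3 ^ n)"
    by (intro sum_norm_le) (simp add: norm_cube_funpow m power_mono)
  finally show "norm (\<Sum>i\<in>I. x i) ^ 3 ^ n \<le> (0 * 3 ^ n + real (card I)) * m ^ 3 ^ n" by simp
qed (use m in auto)

text \<open>For a sum s of orthogonal terms, {s, s, y k} is the cube of y k, which gives the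
  inequality for squares up to the bound M of the triple product; iterated cubes remove M.\<close>

lemma norm_orth_sum_ge:
  assumes D: "orth_family D" and I: "finite I" and x: "\<And>i. i \<in> I \<Longrightarrow> x i \<in> D i" and k: "k \<in> I"
  shows "norm (x k) \<le> norm (\<Sum>i\<in>I. x i)"
proof (cases "x k = 0")
  case False
  obtain M where M: "M > 0" "\<And>x y z. norm (triple x y z) \<le> M * (norm x * norm y * norm z)"
    using triple_bound by blast
  let ?s = "\<Sum>i\<in>I. x i"
  have "norm (x k) ^ 2 \<le> norm ?s ^ 2"
  proof (rule power3_bound_imp_le)
    fix n
    define y where "y = (\<lambda>i. (cube ^^ n) (x i))"
    have yD: "y i \<in> D i" if "i \<in> I" for i
      unfolding y_def by (induction n) (use x that in \<open>auto intro: orth_family_cube[OF D]\<close>)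
    have "triple (\<Sum>i\<in>I. y i) (\<Sum>i\<in>I. y i) (y k) = (\<Sum>i\<in>I. \<Sum>j\<in>I. triple (y i) (y j) (y k))"
      by (simp only: triple_sum(1), simp only: triple_sum(2))
    also have "\<dots> = (\<Sum>i\<in>I. \<Sum>j\<in>I. if j = k then if i = k then cube (y k) else 0 else 0)"
      by (intro sum.cong refl) (auto simp: cube_def intro!: orth_family_zero[OF D] yD k)
    also have "\<dots> = cube (y k)"
      using I k by (simp add: sum.delta cong: sum.cong)
    finally have "norm (cube (y k)) \<le> M * (norm (\<Sum>i\<in>I. y i) * norm (\<Sum>i\<in>I. y i) * norm (y k))"
      using M(2) by metis
    then have "norm (y k) ^ 2 * norm (y k) \<le> M * norm (\<Sum>i\<in>I. y i) ^ 2 * norm (y k)"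
      by (simp add: cube_def norm_cube power2_eq_square power3_eq_cube mult_ac)
    moreover have "norm (y k) > 0" using False by (simp add: y_def norm_cube_funpow)
    ultimately have "norm (y k) ^ 2 \<le> M * norm (\<Sum>i\<in>I. y i) ^ 2" by simp
    moreover have "norm (y k) = norm (x k) ^ 3 ^ n" by (simp add: y_def norm_cube_funpow)
    moreover have "norm (\<Sum>i\<in>I. y i) = norm ?s ^ 3 ^ n"
      by (simp add: y_def cube_funpow_orth_sum[OF D I x] flip: norm_cube_funpow)
    ultimately show "(norm (x k) ^ 2) ^ 3 ^ n \<le> (0 * 3 ^ n + M) * (norm ?s ^ 2) ^ 3 ^ n"
      by (simp add: mult.commute flip: power_mult)
  qed auto
  then show ?thesis by (simp add: power2_le_iff_abs_le)
qed simp

text \<open>Finite sums of an orthonormal family with signs have norm at most one, hence the family is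
  weakly null; adding its members to a fixed one contradicts the Kadec-Klee property.\<close>

lemma kadec_klee_no_orth_sequence:
  assumes kk: "kadec_klee TYPE('a)" and D: "orth_family D"
    and b: "\<And>n::nat. b n \<in> D n" "\<And>n. b n \<noteq> 0"
  shows False
proof -
  define c where "c n = (1 / norm (b n)) *\<^sub>R b n" for n
  have cD: "c n \<in> D n" and c1: "norm (c n) = 1" for n
    using b by (simp_all add: c_def orth_family_scaleR[OF D])
  have null: "(\<lambda>n. g (c n)) \<longlonglongrightarrow> 0" if g: "bounded_linear g" for g :: "'a \<Rightarrow> real"
  proof -
    interpret g: bounded_linear g by fact
    have "summable (\<lambda>n. \<bar>g (c n)\<bar>)"
    proof (rule summableI_nonneg_bounded)
      fix N
      have "(\<Sum>n<N. \<bar>g (c n)\<bar>) = g (\<Sum>n<N. sgn (g (c n)) *\<^sub>R c n)"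
        by (simp add: g.sum g.scaleR abs_sgn mult.commute)
      also have "\<dots> \<le> onorm g * norm (\<Sum>n<N. sgn (g (c n)) *\<^sub>R c n)"
        using onorm[OF g] by (metis abs_le_D1 real_norm_def)
      also have "\<dots> \<le> onorm g * 1"
        by (intro mult_left_mono norm_orth_sum_le[OF D] orth_family_scaleR[OF D] cD)
          (auto simp: c1 abs_sgn_eq onorm_pos_le[OF g])
      finally show "(\<Sum>n<N. \<bar>g (c n)\<bar>) \<le> onorm g" by simp
    qed simp
    then show ?thesis using summable_LIMSEQ_zero tendsto_rabs_zero_iff by blast
  qed
  define s where "s n = c 0 + c (Suc n)" for n
  have s_sum: "s n = (\<Sum>i\<in>{0, Suc n}. c i)" for n by (simp add: s_def)
  have "norm (s n) \<le> 1" for n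
    unfolding s_sum by (rule norm_orth_sum_le[OF D]) (auto simp: c1 intro: cD)
  moreover have "norm (c 0) \<le> norm (s n)" for n
    unfolding s_sum by (rule norm_orth_sum_ge[OF D]) (auto intro: cD)
  ultimately have "norm (s n) = 1" for n by (auto simp: c1 intro: antisym)
  moreover have "weakly_tendsto s (c 0)"
    unfolding weakly_tendsto_def
  proof (intro allI impI)
    fix f :: "'a \<Rightarrow> complex" assume f: "bounded_clinear f"
    then interpret f: bounded_linear f by (simp add: bounded_clinear_def)
    have "(\<lambda>n. Complex (Re (f (c (Suc n)))) (Im (f (c (Suc n))))) \<longlonglongrightarrow> Complex 0 0"
      using null[OF bounded_linear_compose[OF bounded_linear_Re f.bounded_linear_axioms]]
        null[OF bounded_linear_compose[OF bounded_linear_Im f.bounded_linear_axioms]]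
      by (intro tendsto_Complex; subst filterlim_sequentially_Suc)
    then have "(\<lambda>n. f (c (Suc n))) \<longlonglongrightarrow> 0" by (simp add: zero_complex.code)
    then show "(\<lambda>n. f (s n)) \<longlonglongrightarrow> f (c 0)"
      using tendsto_add[OF tendsto_const, of "\<lambda>n. f (c (Suc n))" 0 sequentially "f (c 0)"]
      by (simp add: s_def f.add)
  qed
  ultimately have "s \<longlonglongrightarrow> c 0"
    using kk c1 by (simp add: kadec_klee_def)
  from tendsto_norm_zero[OF LIM_zero[OF this]] have "(\<lambda>n. norm (c (Suc n))) \<longlonglongrightarrow> 0"
    by (simp add: s_def)
  then show False by (simp add: c1 tendsto_const_iff)
qed

lemma orth_family_tripotents:
  assumes e: "\<And>i. tripotent (e i)" and o: "\<And>i j. i \<noteq> j \<Longrightarrow> e j \<in> peirce (e i) 0"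
  shows "orth_family (\<lambda>i. range (\<lambda>r. r *\<^sub>R e i))"
  unfolding orth_family_def
proof (intro conjI allI ballI impI)
  fix i
  show "subspace (range (\<lambda>r. r *\<^sub>R e i))"
    by (intro linear_subspace_image[of "\<lambda>r. r *\<^sub>R e i" UNIV, simplified] bounded_linear.linear
        bounded_linear_scaleR_left)
next
  fix i x assume "x \<in> range (\<lambda>r. r *\<^sub>R e i)"
  then show "cube x \<in> range (\<lambda>r. r *\<^sub>R e i)"
    using e[of i] by (auto simp: cube_def triple_linear tripotent_def)
next
  fix i j k x y z
  assume "x \<in> range (\<lambda>r. r *\<^sub>R e i)" "y \<in> range (\<lambda>r. r *\<^sub>R e j)" "z \<in> range (\<lambda>r. r *\<^sub>R e k)"
    and ijk: "\<not> (i = j \<and> j = k)"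
  moreover have "triple (e i) (e j) (e k) = 0"
  proof (cases "i = j")
    case True
    then have "k \<noteq> j" using ijk by auto
    then show ?thesis using box_peirce0(1)[OF e o, of k j] True o[of j k] by (simp add: mem_peirce)
  next
    case False
    then show ?thesis using box_peirce0(1)[OF e o] by simp
  qed
  ultimately show "triple x y z = 0" by (auto simp: triple_linear)
qed

lemma orth_family_peirce0:
  assumes e: "tripotent e"
  shows "orth_family (\<lambda>b. if b then range (\<lambda>r. r *\<^sub>R e) else peirce e 0)"
proof -
  have 1: "subspace (range (\<lambda>r. r *\<^sub>R e))"
    by (intro linear_subspace_image[of "\<lambda>r. r *\<^sub>R e" UNIV, simplified] bounded_linear.linear
        bounded_linear_scaleR_left)
  have 2: "cube x \<in> range (\<lambda>r. r *\<^sub>R e)" if "x \<in> range (\<lambda>r. r *\<^sub>R e)" for x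
    using that e by (auto simp: cube_def triple_linear tripotent_def)
  have 3: "cube x \<in> peirce e 0" if "x \<in> peirce e 0" for x
    using peirce_rule[OF that that that] by (simp add: cube_def)
  note z = box_peirce0[OF e]
  have z': "triple x y e = 0" if "y \<in> peirce e 0" for x y
    using z(1)[OF that, of x] by (simp add: triple_commute)
  have z'': "triple e e y = 0" "triple y e e = 0" if "y \<in> peirce e 0" for y
    using that by (simp_all add: mem_peirce triple_commute[of y])
  show ?thesis
    unfolding orth_family_def
    by (auto simp: 1 subspace_peirce 2 3 triple_linear z z' z'' split: if_splits)
qed

lemma norm_add_peirce0:
  assumes e: "tripotent e" "e \<noteq> 0" and z: "z \<in> peirce e 0" "norm z \<le> 1"
  shows "norm (e + z) = 1"
proof (rule antisym)
  let ?D = "\<lambda>b. if b then range (\<lambda>r. r *\<^sub>R e) else peirce e 0"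
  let ?x = "\<lambda>b. if b then e else z"
  have D: "orth_family ?D" by (rule orth_family_peirce0[OF e(1)])
  have x: "?x b \<in> ?D b" for b using z by (auto intro: range_eqI[of _ _ 1])
  have s: "e + z = (\<Sum>b\<in>UNIV. ?x b)" by (simp add: UNIV_bool add.commute)
  show "norm (e + z) \<le> 1"
    unfolding s by (rule norm_orth_sum_le[OF D]) (use x z norm_tripotent[OF e] in auto)
  show "1 \<le> norm (e + z)"
    unfolding s using norm_orth_sum_ge[OF D, of UNIV ?x True] x norm_tripotent[OF e] by simp
qed

lemma kadec_klee_peirce0:
  assumes kk: "kadec_klee TYPE('a)" and e: "tripotent e" "e \<noteq> 0"
    and z: "\<And>n. z n \<in> peirce e 0" and w: "weakly_tendsto z 0"
  shows "z \<longlonglongrightarrow> 0"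
proof (rule ccontr)
  assume "\<not> z \<longlonglongrightarrow> 0"
  then obtain d where d: "d > 0" "\<exists>\<^sub>F n in sequentially. \<not> norm (z n) < d"
    by (auto simp: tendsto_iff not_eventually)
  then have "infinite {n. \<not> norm (z n) < d}"
    by (simp add: frequently_cofinite flip: cofinite_eq_sequentially)
  from infinite_enumerate[OF this] obtain r :: "nat \<Rightarrow> nat"
    where r: "strict_mono r" "\<And>n. d \<le> norm (z (r n))" by (auto simp: not_less)
  \<comment> \<open>The norms stay above d along the subsequence, so normalising preserves weak
    convergence to zero.\<close>
  define y where "y n = (1 / norm (z (r n))) *\<^sub>R z (r n)" for n
  have r0: "norm (z (r n)) > 0" for n using r(2)[of n] d(1) by linarith
  have y0: "y n \<in> peirce e 0" and y1: "norm (y n) = 1" for n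
    using z r0[of n] by (simp_all add: y_def subspace_peirce subspace_scale)
  have "weakly_tendsto (\<lambda>n. e + y n) e"
    unfolding weakly_tendsto_def
  proof (intro allI impI)
    fix f :: "'a \<Rightarrow> complex" assume f: "bounded_clinear f"
    then interpret f: bounded_linear f by (simp add: bounded_clinear_def)
    have "(\<lambda>n. f (z (r n))) \<longlonglongrightarrow> 0"
      using weakly_tendsto_subseq[OF w r(1)] f f.zero by (auto simp: weakly_tendsto_def o_def)
    then have "(\<lambda>n. norm (f (z (r n))) / d) \<longlonglongrightarrow> 0 / d"
      using d(1) by (intro tendsto_intros tendsto_norm_zero) auto
    moreover have "norm (f (y n)) \<le> norm (f (z (r n))) / d" for n
      using r(2)[of n] d(1) by (simp add: y_def f.scaleR divide_left_mono frac_le)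
    ultimately have "(\<lambda>n. f (y n)) \<longlonglongrightarrow> 0"
      by (intro Lim_null_comparison[of "\<lambda>n. f (y n)" "\<lambda>n. norm (f (z (r n))) / d"]) auto
    then show "(\<lambda>n. f (e + y n)) \<longlonglongrightarrow> f e"
      using tendsto_add[OF tendsto_const, of "\<lambda>n. f (y n)" 0 sequentially "f e"] by (simp add: f.add)
  qed
  moreover have "norm (e + y n) = 1" for n using norm_add_peirce0[OF e y0] y1 by simp
  ultimately have "(\<lambda>n. e + y n) \<longlonglongrightarrow> e"
    using kk norm_tripotent[OF e] by (simp add: kadec_klee_def)
  from tendsto_norm_zero[OF LIM_zero[OF this]] have "(\<lambda>n. norm (y n)) \<longlonglongrightarrow> 0" by simp
  then show False by (simp add: y1 tendsto_const_iff)
qed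

section \<open>Norm estimates for the Peirce components\<close>

lemma norm_peirce_rotation:
  assumes e: "tripotent e"
  shows "norm (exp (\<i> * of_real t) *\<^sub>C peirce2 e x + exp (\<i> * of_real t / 2) *\<^sub>C peirce1 e x + peirce0 e x) = norm x"
proof -
  define T where "T = (\<lambda>y. (\<i> * complex_of_real t) *\<^sub>C triple e e y)"
  have T: "T (c *\<^sub>C x) = c *\<^sub>C T x" for c x
    by (simp add: T_def triple_scaleC_right scaleC_scaleC mult.commute)
  have eig: "T y = (\<i> * complex_of_real (t * c)) *\<^sub>C y" if "y \<in> peirce e c" for y c
    using that by (simp add: T_def mem_peirce scaleR_scaleC scaleC_scaleC mult.assoc)
  note P = peirce_projections[OF e, of x]
  have add: "(T ^^ n) (x + y) = (T ^^ n) x + (T ^^ n) y" for n x y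
    by (induction n) (simp_all add: T_def triple_linear scaleC_add_right)
  \<comment> \<open>The three Peirce components are eigenvectors of i t L(e, e), so the exponential
    series can be summed on each of them.\<close>
  have "(\<lambda>n. (T ^^ n) x /\<^sub>R fact n) sums
     (exp (\<i> * complex_of_real (t * 1)) *\<^sub>C peirce2 e x + exp (\<i> * complex_of_real (t * (1/2))) *\<^sub>C peirce1 e x
      + exp (\<i> * complex_of_real (t * 0)) *\<^sub>C peirce0 e x)"
    using sums_add[OF sums_add[OF exp_op_eigenvector_sums[OF T eig[OF P(1)]]
       exp_op_eigenvector_sums[OF T eig[OF P(2)]]] exp_op_eigenvector_sums[OF T eig[OF P(3)]]]
    by (subst peirce_decomp[of x e]) (simp add: add scaleR_add_right)
  then have "exp_op T x = exp (\<i> * of_real t) *\<^sub>C peirce2 e x + exp (\<i> * of_real t / 2) *\<^sub>C peirce1 e x + peirce0 e x"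
    by (simp add: exp_op_def sums_iff)
  moreover have "norm (exp_op T x) = norm x"
    using hermitian_box[of e] unfolding hermitian_op_def T_def by blast
  ultimately show ?thesis by simp
qed

text \<open>The combination is the mean of three rotations with weights given by a Fejer kernel.\<close>

lemma norm_peirce2_peirce1_le:
  assumes e: "tripotent e"
  shows "norm (peirce2 e x + (1/2) *\<^sub>R peirce1 e x) \<le> norm x"
proof -
  \<comment> \<open>Rotations of x by pi and -pi: E2 is multiplied by -1, E1 by \<i> or -\<i>, and
    E0 is fixed. With x itself the weights are 1/2, -1/4, -1/4.\<close>
  define u v where "u = - peirce2 e x + \<i> *\<^sub>C peirce1 e x + peirce0 e x"
    and "v = - peirce2 e x + (- \<i>) *\<^sub>C peirce1 e x + peirce0 e x"
  have "exp (\<i> * of_real pi / 2) = \<i>" using cis_pi_half by (simp add: cis_conv_exp)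
  moreover have "exp (\<i> * of_real (- pi) / 2) = inverse (exp (\<i> * of_real pi / 2))"
    by (simp flip: exp_minus)
  moreover have "exp (\<i> * of_real pi) = - 1" by simp
  moreover have "exp (\<i> * of_real (- pi)) = inverse (exp (\<i> * of_real pi))"
    by (simp only: of_real_minus mult_minus_right exp_minus)
  ultimately have "norm u = norm x" "norm v = norm x"
    using norm_peirce_rotation[OF e, of pi x] norm_peirce_rotation[OF e, of "- pi" x]
    by (simp_all add: u_def v_def scaleC_minus_left del: exp_pi_i exp_pi_i' of_real_minus)
  moreover have "4 *\<^sub>R (peirce2 e x + (1/2) *\<^sub>R peirce1 e x) = 2 *\<^sub>R x - u - v"
  proof -
    have "u + v = x + x - 4 *\<^sub>R peirce2 e x - 2 *\<^sub>R peirce1 e x"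
      unfolding u_def v_def scaleC_minus_left scaleR_2 scaleR_4
      by (subst (5 6) peirce_decomp[of x e]) (simp add: algebra_simps)
    then show ?thesis by (simp add: scaleR_add_right scaleR_2 algebra_simps)
  qed
  from arg_cong[OF this, of norm]
  have "4 * norm (peirce2 e x + (1/2) *\<^sub>R peirce1 e x) = norm (2 *\<^sub>R x - u - v)"
    unfolding norm_scaleR by simp
  moreover have "norm (2 *\<^sub>R x - u - v) \<le> norm (2 *\<^sub>R x) + norm u + norm v"
    using norm_triangle_ineq4[of "2 *\<^sub>R x - u" v] norm_triangle_ineq4[of "2 *\<^sub>R x" u] by linarith
  ultimately show ?thesis by simp
qed

text \<open>Once the E0-component has been removed by the preceding estimate, the rotation by 2 pi
  only changes the sign on E1, and averaging cancels that component.\<close>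

lemma norm_peirce2_le:
  assumes e: "tripotent e"
  shows "norm (peirce2 e x) \<le> norm x"
proof -
  define y where "y = peirce2 e x + (1/2) *\<^sub>R peirce1 e x"
  have y2: "peirce2 e y = peirce2 e x" and y1: "peirce1 e y = (1/2) *\<^sub>R peirce1 e x" and y0: "peirce0 e y = 0"
  proof -
    interpret p2: bounded_linear "peirce2 e" using bounded_clinear_peirce by (simp add: bounded_clinear_def)
    interpret p1: bounded_linear "peirce1 e" using bounded_clinear_peirce by (simp add: bounded_clinear_def)
    note P = peirce_projections[OF e, of x]
    show y2: "peirce2 e y = peirce2 e x" and y1: "peirce1 e y = (1/2) *\<^sub>R peirce1 e x"
      using peirce2_of[OF P(1)] peirce2_of[OF P(2)] peirce1_of[OF P(1)] peirce1_of[OF P(2)]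
      by (simp_all add: y_def p2.add p2.scaleR p1.add p1.scaleR power2_eq_square)
    show "peirce0 e y = 0" using peirce_decomp[of y e] y1 y2 by (simp add: y_def)
  qed
  have "exp (\<i> * of_real (2 * pi) / 2) = - 1" "exp (\<i> * of_real (2 * pi)) = 1"
    by (simp_all add: exp_pi_i' exp_two_pi_i' mult_ac)
  then have "norm (peirce2 e y + (- 1) *\<^sub>C peirce1 e y) = norm y"
    using norm_peirce_rotation[OF e, of "2 * pi" y] y0 by simp
  moreover have "2 *\<^sub>R peirce2 e x = y + (peirce2 e y + (- 1) *\<^sub>C peirce1 e y)"
    by (simp add: y1 y2 scaleC_minus_left scaleR_2) (simp add: y_def)
  then have "2 * norm (peirce2 e x) \<le> norm y + norm (peirce2 e y + (- 1) *\<^sub>C peirce1 e y)"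
    by (metis abs_numeral norm_scaleR norm_triangle_ineq)
  moreover have "norm y \<le> norm x" unfolding y_def by (rule norm_peirce2_peirce1_le[OF e])
  ultimately show ?thesis by simp
qed

text \<open>In the cube of l e + y the E2-component is exactly (l ^ 3 + 2 l q) e, by index
  arithmetic; it is estimated with the contractive projection onto E2.\<close>

lemma norm_add_peirce1_ge:
  assumes e: "tripotent e" "e \<noteq> 0" and y: "y \<in> peirce e (1/2)" and q: "triple y y e = q *\<^sub>R e"
    and l: "l \<ge> 0"
  shows "l ^ 3 + 2 * l * q \<le> norm (l *\<^sub>R e + y) ^ 3"
proof -
  interpret p2: bounded_linear "peirce2 e" using bounded_clinear_peirce by (simp add: bounded_clinear_def)
  let ?x = "l *\<^sub>R e + y"
  have e1: "e \<in> peirce e 1" by (rule tripotent_mem_peirce[OF e(1)])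
  have eee: "triple e e e = e" using e by (simp add: tripotent_def)
  have eye: "triple e y e = 0" by (rule peirce_triple_zero[OF e(1) e1 y e1]) simp
  have eey: "triple e e y = (1/2) *\<^sub>R y" "triple y e e = (1/2) *\<^sub>R y"
    using y by (simp_all add: mem_peirce triple_commute[of y])
  have yey: "peirce2 e (triple y e y) = 0"
    using peirce_rule[OF y e1 y] by (simp add: peirce2_of[where c=0])
  have yyy: "peirce2 e (triple y y y) = 0"
    using peirce2_of[OF peirce_rule[OF y y y]] by (simp add: power2_eq_square)
  have p2y: "peirce2 e y = 0" using peirce2_of[OF y] by (simp add: power2_eq_square)
  have p2e: "peirce2 e e = e" using peirce2_of[OF e1] by simp
  have "triple ?x ?x ?x = l ^ 3 *\<^sub>R e + (2 * l * q) *\<^sub>R e + l\<^sup>2 *\<^sub>R y + l *\<^sub>R triple y e y + triple y y y"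
    by (simp add: triple_linear eee eye eey q triple_commute[of e y y] power3_eq_cube power2_eq_square
       algebra_simps) (simp flip: scaleR_left_distrib)
  then have "peirce2 e (triple ?x ?x ?x) = (l ^ 3 + 2 * l * q) *\<^sub>R e"
    by (simp add: p2.add p2.scaleR yey yyy p2y p2e scaleR_left_distrib)
  then have "\<bar>l ^ 3 + 2 * l * q\<bar> \<le> norm (triple ?x ?x ?x)"
    using norm_peirce2_le[OF e(1), of "triple ?x ?x ?x"] norm_tripotent[OF e] by simp
  then show ?thesis by (simp add: norm_cube)
qed

end

section \<open>Polynomials in the sine of an operator\<close>

text \<open>Discrete Fourier inversion: with N = degree + 1, the coefficient is an average of values
  at the roots of unity of order N.\<close>

lemma norm_coeff_le_unit_circle:
  fixes q :: "complex poly"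
  assumes B: "\<And>t. cmod (poly q (cis t)) \<le> B"
  shows "cmod (coeff q k) \<le> B"
proof (cases "k \<le> degree q")
  case False
  then have "coeff q k = 0" by (simp add: coeff_eq_0)
  moreover have "0 \<le> B" using B[of 0] norm_ge_zero order_trans by blast
  ultimately show ?thesis by simp
next
  case k: True
  define N where "N = degree q + 1"
  have N: "1 \<le> N" "k < N" "N \<noteq> 0" using k by (auto simp: N_def)
  define w where "w = cis (2 * pi / real N)"
  have w_eq: "w ^ m = exp (2 * of_real pi * \<i> * of_nat m / of_nat N)" for m
  proof -
    have "w ^ m = cis (real m * (2 * pi / real N))" by (simp only: w_def Complex.DeMoivre)
    then show ?thesis by (simp add: cis_conv_exp mult_ac)
  qed
  have w1: "w ^ m = 1 \<longleftrightarrow> N dvd m" for m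
    unfolding w_eq by (rule complex_root_unity_eq_1[OF N(1)])
  have orth: "(\<Sum>j<N. (w ^ m) ^ j) = (if N dvd m then of_nat N else 0)" for m
  proof (cases "N dvd m")
    case True
    then have "w ^ m = 1" using w1 by blast
    then show ?thesis using True by simp
  next
    case False
    then have "w ^ m \<noteq> 1" using w1 by blast
    moreover have "(w ^ m) ^ N = 1" using w1[of "m * N"] by (simp flip: power_mult)
    ultimately show ?thesis using False geometric_sum[of "w ^ m" N] by simp
  qed
  \<comment> \<open>The exponent N - k stands for - k, since w ^ N = 1.\<close>
  have "(\<Sum>j<N. poly q (w ^ j) * w ^ (j * (N - k)))
      = (\<Sum>j<N. \<Sum>i\<le>degree q. coeff q i * (w ^ (i + (N - k))) ^ j)"
  proof -
    have "(w ^ j) ^ i * w ^ (j * (N - k)) = (w ^ (i + (N - k))) ^ j" for i j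
      by (simp add: algebra_simps flip: power_mult power_add)
    then show ?thesis by (simp only: poly_altdef sum_distrib_right mult.assoc)
  qed
  also have "\<dots> = (\<Sum>i\<le>degree q. coeff q i * (\<Sum>j<N. (w ^ (i + (N - k))) ^ j))"
    by (subst sum.swap) (simp add: sum_distrib_left)
  also have "\<dots> = (\<Sum>i\<le>degree q. if i = k then coeff q i * of_nat N else 0)"
  proof (intro sum.cong refl)
    fix i assume i: "i \<in> {..degree q}"
    \<comment> \<open>The number i + (N - k) lies strictly between 0 and 2 N, so divisibility leaves
      only N.\<close>
    have "N dvd i + (N - k) \<longleftrightarrow> i = k"
    proof
      assume "N dvd i + (N - k)"
      then obtain c where c: "i + (N - k) = N * c" by blast
      have "0 < N * c" "N * c < N * 2" using c[symmetric] i N by (auto simp: N_def)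
      then have "0 < c" "c < 2" by simp_all
      then have "c = 1" by simp
      then show "i = k" using c N by simp
    qed (use N in auto)
    then show "coeff q i * (\<Sum>j<N. (w ^ (i + (N - k))) ^ j) = (if i = k then coeff q i * of_nat N else 0)"
      by (simp add: orth)
  qed
  also have "\<dots> = coeff q k * of_nat N" using k by simp
  finally have "cmod (coeff q k) * real N = cmod (\<Sum>j<N. poly q (w ^ j) * w ^ (j * (N - k)))"
    by (simp add: norm_mult)
  also have "\<dots> \<le> (\<Sum>j<N. B)"
  proof (intro sum_norm_le)
    fix j
    have "w ^ j = cis (real j * (2 * pi / real N))" by (simp add: w_def Complex.DeMoivre)
    then show "cmod (poly q (w ^ j) * w ^ (j * (N - k))) \<le> B"
      using B by (simp add: norm_mult norm_power w_def)
  qed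
  finally show ?thesis using N by simp
qed

definition rpoly_op :: "real poly \<Rightarrow> ('a::real_vector \<Rightarrow> 'a) \<Rightarrow> 'a \<Rightarrow> 'a"
  where "rpoly_op p A x = (\<Sum>i\<le>degree p. coeff p i *\<^sub>R (A ^^ i) x)"

definition cpoly_op :: "complex poly \<Rightarrow> ('a::complex_vector \<Rightarrow> 'a) \<Rightarrow> 'a \<Rightarrow> 'a"
  where "cpoly_op p A x = (\<Sum>i\<le>degree p. coeff p i *\<^sub>C (A ^^ i) x)"

lemma linear_funpow: "linear A \<Longrightarrow> linear ((A ^^ n) :: 'a::real_vector \<Rightarrow> 'a)"
  by (induction n) (auto simp: linear_id[unfolded id_def] id_def intro: linear_compose[unfolded o_def] linear_compose)

lemma rpoly_op_eq:
  assumes "degree p \<le> n" shows "rpoly_op p A x = (\<Sum>i\<le>n. coeff p i *\<^sub>R (A ^^ i) x)"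
  unfolding rpoly_op_def using assms by (intro sum.mono_neutral_left) (auto simp: coeff_eq_0 not_le)

lemma cpoly_op_eq:
  assumes "degree p \<le> n" shows "cpoly_op p A x = (\<Sum>i\<le>n. coeff p i *\<^sub>C (A ^^ i) x)"
  unfolding cpoly_op_def using assms by (intro sum.mono_neutral_left) (auto simp: coeff_eq_0 not_le)

lemma rpoly_op_0 [simp]: "rpoly_op 0 A x = 0"
  by (simp add: rpoly_op_def)

lemma rpoly_op_add: "rpoly_op (p + q) A x = rpoly_op p A x + rpoly_op q A x"
  by (simp add: rpoly_op_eq[of _ "max (degree p) (degree q)"] degree_add_le
      scaleR_left_distrib sum.distrib)

lemma rpoly_op_diff: "rpoly_op (p - q) A x = rpoly_op p A x - rpoly_op q A x"
  by (simp add: rpoly_op_eq[of _ "max (degree p) (degree q)"] degree_diff_le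
      scaleR_left_diff_distrib sum_subtractf)

lemma rpoly_op_smult: "rpoly_op (smult c p) A x = c *\<^sub>R rpoly_op p A x"
  by (simp add: rpoly_op_eq[of _ "degree p"] scaleR_sum_right)

lemma rpoly_op_pCons:
  assumes "linear A"
  shows "rpoly_op (pCons c p) A x = c *\<^sub>R x + A (rpoly_op p A x)"
proof -
  interpret linear A by fact
  have "rpoly_op (pCons c p) A x = (\<Sum>i\<le>Suc (degree p). coeff (pCons c p) i *\<^sub>R (A ^^ i) x)"
    by (rule rpoly_op_eq) (rule degree_pCons_le)
  also have "\<dots> = c *\<^sub>R x + A (rpoly_op p A x)"
    by (subst sum.atMost_Suc_shift) (simp add: rpoly_op_def sum scale)
  finally show ?thesis .
qed

lemma rpoly_op_linear:
  assumes "linear A" shows "linear (rpoly_op p A)"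
proof -
  have "linear (\<lambda>x. rpoly_op p A x)"
    unfolding rpoly_op_def
    by (intro linear_compose_sum ballI linear_compose_scale_right linear_funpow assms)
  then show ?thesis by simp
qed

lemma rpoly_op_mult:
  assumes A: "linear A"
  shows "rpoly_op (p * q) A x = rpoly_op p A (rpoly_op q A x)"
proof (induction p)
  case (pCons c p)
  then show ?case
    by (simp add: rpoly_op_pCons[OF A] rpoly_op_add rpoly_op_smult)
qed simp

lemma cpoly_op_add: "cpoly_op (p + q) A x = cpoly_op p A x + cpoly_op q A x"
  by (simp add: cpoly_op_eq[of _ "max (degree p) (degree q)"] degree_add_le
      scaleC_add_left sum.distrib)

lemma cpoly_op_diff: "cpoly_op (p - q) A x = cpoly_op p A x - cpoly_op q A x"
  by (simp add: cpoly_op_eq[of _ "max (degree p) (degree q)"] degree_diff_le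
      scaleC_diff_left sum_subtractf)

lemma scaleC_sum_right: "c *\<^sub>C (\<Sum>i\<in>I. f i) = (\<Sum>i\<in>I. c *\<^sub>C f i :: 'a::complex_vector)"
  by (induction I rule: infinite_finite_induct) (auto simp: scaleC_add_right)

lemma scaleC_sum_left: "(\<Sum>i\<in>I. c i) *\<^sub>C x = (\<Sum>i\<in>I. c i *\<^sub>C x :: 'a::complex_vector)"
  by (induction I rule: infinite_finite_induct) (auto simp: scaleC_add_left)

lemma cpoly_op_smult: "cpoly_op (smult c p) A x = c *\<^sub>C cpoly_op p A x"
  by (simp add: cpoly_op_eq[of _ "degree p"] scaleC_sum_right scaleC_scaleC)

lemma cpoly_op_pCons_0:
  assumes A: "linear A" "\<And>c x. A (c *\<^sub>C x) = c *\<^sub>C A x"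
  shows "cpoly_op (pCons 0 p) A x = A (cpoly_op p A x)"
proof -
  interpret linear A by fact
  have "cpoly_op (pCons 0 p) A x = (\<Sum>i\<le>Suc (degree p). coeff (pCons 0 p) i *\<^sub>C (A ^^ i) x)"
    by (rule cpoly_op_eq) (rule degree_pCons_le)
  also have "\<dots> = A (cpoly_op p A x)"
    by (subst sum.atMost_Suc_shift) (simp add: cpoly_op_def sum A(2))
  finally show ?thesis .
qed

lemma cpoly_op_monom: "cpoly_op (monom c n) A x = c *\<^sub>C (A ^^ n) x"
proof -
  have "cpoly_op (monom c n) A x = (\<Sum>i\<le>n. if i = n then c *\<^sub>C (A ^^ i) x else 0)"
    by (subst cpoly_op_eq[OF degree_monom_le]) (rule sum.cong, auto)
  then show ?thesis by simp
qed

text \<open>With \<open>z = exp (i s)\<close> one has \<open>sin s = (z - 1/z) / 2i\<close>, so multiplying a polynomial of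
  degree at most \<open>d\<close> in \<open>sin s\<close> by \<open>z\<close> to the power \<open>d\<close> yields a polynomial in \<open>z\<close>; the same holds
  for operators.\<close>

lemma rpoly_op_sine:
  fixes V W S :: "'a::complex_vector \<Rightarrow> 'a"
  assumes V: "linear V" "\<And>c x. V (c *\<^sub>C x) = c *\<^sub>C V x" and VW: "\<And>x. V (W x) = x"
    and S: "linear S" "\<And>x. S x = (1 / (2 * \<i>)) *\<^sub>C (V x - W x)"
  shows "degree p \<le> d \<Longrightarrow> \<exists>q. degree q \<le> 2 * d \<and>
    (\<forall>t. poly q (cis t) = cis t ^ d * of_real (poly p (sin t))) \<and>
    (\<forall>x. cpoly_op q V x = (V ^^ d) (rpoly_op p S x))"
proof (induction p arbitrary: d)
  case 0
  have "linear (V ^^ d)" by (rule linear_funpow[OF V(1)])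
  then show ?case by (intro exI[of _ 0]) (simp add: cpoly_op_def linear_0)
next
  case (pCons c p)
  show ?case
  proof (cases "p = 0")
    case True
    have "cpoly_op (monom (of_real c) d) V x = (V ^^ d) (rpoly_op (pCons c p) S x)" for x
      using linear_scale[OF linear_funpow[OF V(1)], of d c x] True
      by (simp add: cpoly_op_monom rpoly_op_pCons[OF S(1)] linear_0[OF S(1)] scaleR_scaleC)
    moreover have "degree (monom (of_real c :: complex) d) \<le> 2 * d"
      using degree_monom_le[of "of_real c :: complex" d] by linarith
    ultimately show ?thesis
      using True by (intro exI[of _ "monom (of_real c) d"]) (simp add: poly_monom mult.commute)
  next
    case False
    then obtain d' where d: "d = Suc d'" "degree p \<le> d'"
      using pCons.prems by (cases d) auto
    obtain q where q: "degree q \<le> 2 * d'" "\<And>t. poly q (cis t) = cis t ^ d' * of_real (poly p (sin t))"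
      "\<And>x. cpoly_op q V x = (V ^^ d') (rpoly_op p S x)"
      using pCons.IH[OF d(2)] by blast
    \<comment> \<open>A Horner step: c + s p(s) with s = (z - 1/z) / 2i, multiplied by z ^ d. The
      two applications of \<open>pCons 0\<close> multiply by z squared.\<close>
    define r where "r = monom (of_real c) d + smult (1 / (2 * \<i>)) (pCons 0 (pCons 0 q) - q)"
    have "degree (pCons 0 (pCons 0 q)) \<le> 2 * d"
      using degree_pCons_le[of 0 "pCons 0 q"] degree_pCons_le[of 0 q] q(1) d(1) by linarith
    then have "degree (pCons 0 (pCons 0 q) - q) \<le> 2 * d"
      using q(1) d(1) by (intro degree_diff_le) auto
    then have "degree r \<le> 2 * d"
      unfolding r_def using degree_monom_le[of "of_real c :: complex" d]
      by (intro degree_add_le order_trans[OF degree_smult_le]) auto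
    moreover have "poly r (cis t) = cis t ^ d * of_real (poly (pCons c p) (sin t))" for t
    proof -
      have "cos t * cos t = 1 - sin t * sin t"
        using sin_cos_squared_add[of t] by (simp add: power2_eq_square)
      then have "cis t * cis t - 1 = cis t * of_real (sin t) * (2 * \<i>)"
        by (simp add: complex_eq_iff)
      then have "(cis t * cis t - 1) / (2 * \<i>) = cis t * of_real (sin t)"
        by (subst nonzero_divide_eq_eq) auto
      moreover have "poly r (cis t) = of_real c * cis t ^ d + (cis t * cis t - 1) / (2 * \<i>) * poly q (cis t)"
        by (simp add: r_def poly_monom left_diff_distrib right_diff_distrib diff_divide_distrib mult.assoc)
      ultimately have "poly r (cis t) = of_real c * cis t ^ d + cis t * of_real (sin t) * poly q (cis t)"
        by simp
      then show ?thesis by (simp add: q(2) d(1) algebra_simps)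
    qed
    moreover have "cpoly_op r V x = (V ^^ d) (rpoly_op (pCons c p) S x)" for x
    proof -
      let ?y = "rpoly_op p S x"
      interpret Vd: linear "V ^^ d'" by (rule linear_funpow[OF V(1)])
      interpret V: linear V by (rule V(1))
      have VdC: "(V ^^ n) (k *\<^sub>C y) = k *\<^sub>C (V ^^ n) y" for n k y
        by (induction n) (simp_all add: V(2))
      have "V (S ?y) = (1 / (2 * \<i>)) *\<^sub>C (V (V ?y) - ?y)"
        by (simp add: S(2) V(2) V.diff VW)
      then have "(V ^^ d) (S ?y) = (1 / (2 * \<i>)) *\<^sub>C (V (V ((V ^^ d') ?y)) - (V ^^ d') ?y)"
        by (simp add: d(1) funpow_swap1 VdC Vd.diff)
      moreover have "cpoly_op r V x = of_real c *\<^sub>C (V ^^ d) x + (1 / (2 * \<i>)) *\<^sub>C (V (V ((V ^^ d') ?y)) - (V ^^ d') ?y)"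
        by (simp only: r_def cpoly_op_add cpoly_op_diff cpoly_op_smult cpoly_op_monom
            cpoly_op_pCons_0[OF V] q(3))
      moreover have "(V ^^ d) (rpoly_op (pCons c p) S x) = of_real c *\<^sub>C (V ^^ d) x + (V ^^ d) (S ?y)"
        using linear_add[OF linear_funpow[OF V(1)], of d] linear_scale[OF linear_funpow[OF V(1)], of d]
        by (simp add: rpoly_op_pCons[OF S(1)] scaleR_scaleC VdC)
      ultimately show ?thesis by (simp only:)
    qed
    ultimately show ?thesis by blast
  qed
qed

text \<open>Applying the isometry V d times turns p(S) into a polynomial in V. It has at most 2 d +
  1 coefficients, each at most B because on the unit circle its modulus is that of p at the
  sine.\<close>

lemma norm_rpoly_op_sine_le:
  fixes V W S :: "'a::complex_normed_vector \<Rightarrow> 'a"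
  assumes V: "linear V" "\<And>c x. V (c *\<^sub>C x) = c *\<^sub>C V x" and VW: "\<And>x. V (W x) = x"
    and iso: "\<And>x. norm (V x) = norm x"
    and S: "linear S" "\<And>x. S x = (1 / (2 * \<i>)) *\<^sub>C (V x - W x)"
    and B: "\<And>s. \<bar>s\<bar> \<le> 1 \<Longrightarrow> \<bar>poly p s\<bar> \<le> B" and d: "degree p \<le> d"
  shows "norm (rpoly_op p S x) \<le> (2 * d + 1) * B * norm x"
proof -
  obtain q where q: "degree q \<le> 2 * d" "\<And>t. poly q (cis t) = cis t ^ d * of_real (poly p (sin t))"
      "\<And>x. cpoly_op q V x = (V ^^ d) (rpoly_op p S x)"
    using rpoly_op_sine[OF V VW S d] by blast
  have iso_pow: "norm ((V ^^ n) x) = norm x" for n x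
    by (induction n) (simp_all add: iso)
  have c: "cmod (coeff q k) \<le> B" for k
    by (rule norm_coeff_le_unit_circle) (simp add: q(2) norm_mult norm_power B)
  have "norm (rpoly_op p S x) = norm (cpoly_op q V x)"
    by (simp add: q(3) iso_pow)
  also have "\<dots> \<le> (\<Sum>i\<le>2 * d. B * norm x)"
    unfolding cpoly_op_eq[OF q(1)]
    by (intro sum_norm_le) (simp add: norm_scaleC iso_pow c mult_right_mono)
  finally show ?thesis by (simp add: algebra_simps)
qed

section \<open>Hermitian operators\<close>

lemma sin_coeff_eq:
  "complex_of_real (sin_coeff n * t ^ n)
    = 1 / (2 * \<i>) * ((\<i> * of_real t) ^ n / fact n - (- \<i> * of_real t) ^ n / fact n)"
proof (cases "even n")
  case True
  then have "(- \<i> * complex_of_real t) ^ n = (\<i> * of_real t) ^ n"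
    by (metis minus_mult_left power_minus_even)
  then show ?thesis using True by (simp add: sin_coeff_def)
next
  case False
  then obtain m where n: "n = Suc (2 * m)" by (auto elim!: oddE)
  have "(\<i> * complex_of_real t) ^ n = \<i> * of_real ((- 1) ^ m * t ^ n)"
    by (simp add: n power_mult_distrib power_mult power_minus[of "(complex_of_real t)\<^sup>2"])
  moreover have "(- \<i> * complex_of_real t) ^ n = - ((\<i> * of_real t) ^ n)"
    using False by (metis minus_mult_left power_minus_odd)
  moreover have "1 / (2 * \<i>) * (\<i> * R / f - - (\<i> * R) / f) = R / f" for R f :: complex
    by (cases "f = 0") (simp_all add: field_simps)
  ultimately have "1 / (2 * \<i>) * ((\<i> * of_real t) ^ n / fact n - (- \<i> * of_real t) ^ n / fact n)
      = of_real ((- 1) ^ m * t ^ n) / fact n"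
    by (simp only:)
  then show ?thesis by (simp add: n sin_coeff_def)
qed

locale hermitian_operator =
  fixes T :: "'a::complex_banach \<Rightarrow> 'a"
  assumes hermitian: "hermitian_op T"
begin

lemma bounded_linear: "bounded_linear T" and scaleC: "T (c *\<^sub>C x) = c *\<^sub>C T x"
  using hermitian by (auto simp: hermitian_op_def bounded_clinear_def)

sublocale bounded_linear T by (rule bounded_linear)

definition opnorm :: real
  where "opnorm = onorm T"

lemma opnorm_nonneg: "opnorm \<ge> 0"
  unfolding opnorm_def by (rule onorm_pos_le[OF bounded_linear])

lemma norm_le: "norm (T x) \<le> opnorm * norm x"
  unfolding opnorm_def by (rule onorm[OF bounded_linear])

lemma funpow_scaleC: "(T ^^ n) (c *\<^sub>C x) = c *\<^sub>C (T ^^ n) x"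
  by (induction n) (simp_all add: scaleC)

lemma linear_pow: "linear (T ^^ n)"
  by (rule linear_funpow[OF bounded_linear.linear[OF bounded_linear]])

lemma norm_funpow_le: "norm ((T ^^ n) x) \<le> opnorm ^ n * norm x"
proof (induction n)
  case (Suc n)
  have "norm ((T ^^ Suc n) x) \<le> opnorm * norm ((T ^^ n) x)" by (simp add: norm_le)
  also have "\<dots> \<le> opnorm * (opnorm ^ n * norm x)" using Suc opnorm_nonneg by (intro mult_left_mono)
  finally show ?case by simp
qed simp

lemma bounded_linear_funpow: "bounded_linear (T ^^ n)"
  using norm_funpow_le[of n] linear_pow[of n]
  by (intro bounded_linear_intro[where K="opnorm ^ n"]) (auto simp: linear_add linear_scale mult.commute)

section \<open>The isometry group of a hermitian operator and its sine\<close>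

definition expi :: "real \<Rightarrow> 'a \<Rightarrow> 'a"
  where "expi t = exp_op (\<lambda>y. (\<i> * complex_of_real t) *\<^sub>C T y)"

lemma norm_expi: "norm (expi t x) = norm x"
  using hermitian by (simp add: expi_def hermitian_op_def)

definition expi_coeff :: "real \<Rightarrow> nat \<Rightarrow> complex"
  where "expi_coeff t n = (\<i> * of_real t) ^ n / fact n"

lemma norm_expi_coeff: "cmod (expi_coeff t n) = \<bar>t\<bar> ^ n / fact n"
  by (simp add: expi_coeff_def norm_divide norm_power norm_mult)

lemma norm_expi_term: "norm (expi_coeff t n *\<^sub>C (T ^^ n) x) \<le> (\<bar>t\<bar> * opnorm) ^ n / fact n * norm x"
proof -
  have "norm (expi_coeff t n *\<^sub>C (T ^^ n) x) \<le> \<bar>t\<bar> ^ n / fact n * (opnorm ^ n * norm x)"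
    by (simp only: norm_scaleC norm_expi_coeff) (intro mult_left_mono norm_funpow_le, simp)
  then show ?thesis by (simp add: power_mult_distrib mult_ac)
qed

lemma summable_exp_bound: "summable (\<lambda>n. r ^ n / fact n * s :: real)"
  using summable_exp_generic[of r] by (intro summable_mult2) (simp add: divide_inverse mult.commute)

lemma abs_summable_expi: "summable (\<lambda>n. norm (expi_coeff t n *\<^sub>C (T ^^ n) x))"
  by (rule summable_comparison_test'[OF summable_exp_bound[of "\<bar>t\<bar> * opnorm" "norm x"]])
    (use norm_expi_term in auto)

lemma expi_sums: "(\<lambda>n. expi_coeff t n *\<^sub>C (T ^^ n) x) sums expi t x"
proof -
  have "((\<lambda>y. (\<i> * complex_of_real t) *\<^sub>C T y) ^^ n) x = (\<i> * of_real t) ^ n *\<^sub>C (T ^^ n) x" for n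
    by (induction n) (simp_all add: scaleC scaleC_scaleC)
  moreover have "inverse (fact n) *\<^sub>R c *\<^sub>C y = (c / fact n) *\<^sub>C y" for n c and y :: 'a
    by (simp add: scaleR_scaleC scaleC_scaleC divide_inverse mult.commute)
  ultimately have "expi t x = (\<Sum>n. expi_coeff t n *\<^sub>C (T ^^ n) x)"
    by (simp add: expi_def exp_op_def expi_coeff_def)
  then show ?thesis
    using abs_summable_expi[THEN summable_norm_cancel] by (simp add: summable_sums)
qed

lemma linear_expi: "linear (expi t)"
proof (rule linearI)
  fix x y r
  have "(\<lambda>n. expi_coeff t n *\<^sub>C (T ^^ n) (x + y)) sums (expi t x + expi t y)"
    using sums_add[OF expi_sums[of t x] expi_sums[of t y]]
    by (simp add: linear_add[OF linear_pow] scaleC_add_right)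
  then show "expi t (x + y) = expi t x + expi t y" by (rule sums_unique2[OF expi_sums])
  have "(\<lambda>n. expi_coeff t n *\<^sub>C (T ^^ n) (r *\<^sub>R x)) sums (r *\<^sub>R expi t x)"
    using sums_scaleR_right[OF expi_sums[of t x], of r]
    by (simp add: linear_scale[OF linear_pow] scaleC_scaleR_commute)
  then show "expi t (r *\<^sub>R x) = r *\<^sub>R expi t x" by (rule sums_unique2[OF expi_sums])
qed

lemma expi_scaleC: "expi t (c *\<^sub>C x) = c *\<^sub>C expi t x"
proof -
  have "c *\<^sub>C d *\<^sub>C y = d *\<^sub>C c *\<^sub>C y" for d and y :: 'a
    by (simp add: scaleC_scaleC mult.commute)
  then have "(\<lambda>n. expi_coeff t n *\<^sub>C (T ^^ n) (c *\<^sub>C x)) sums (c *\<^sub>C expi t x)"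
    using bounded_linear.sums[OF bounded_linear_scaleC expi_sums[of t x], of c]
    by (simp add: funpow_scaleC)
  then show ?thesis by (rule sums_unique2[OF expi_sums])
qed

text \<open>An absolutely convergent double series is summed by rows, giving the composition, and by
  diagonals, where the binomial formula for (i t - i t) ^ n leaves only n = 0. The sine estimate
  needs this inverse.\<close>

lemma expi_minus_cancel: "expi t (expi (- t) x) = x"
proof -
  define f where "f = (\<lambda>(i, j). (expi_coeff t i * expi_coeff (- t) j) *\<^sub>C (T ^^ (i + j)) x)"
  define b where "b = (\<lambda>r n. (\<bar>r\<bar> * opnorm) ^ n / fact n)"
  have b_nonneg: "b r n \<ge> 0" for r n by (simp add: b_def opnorm_nonneg)
  have b_sum: "b r summable_on UNIV" for r
  proof -
    have "summable (b r)" using summable_exp_bound[of "\<bar>r\<bar> * opnorm" 1] by (simp add: b_def[abs_def])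
    then show ?thesis using b_nonneg[of r] by (simp add: summable_on_UNIV_nonneg_real_iff)
  qed
  have b2_sum: "(\<lambda>(i, j). b t i * b (- t) j * norm x) summable_on UNIV \<times> UNIV"
  proof (rule summable_on_SigmaI)
    show "((\<lambda>j. case (i, j) of (i, j) \<Rightarrow> b t i * b (- t) j * norm x)
        has_sum b t i * (infsum (b (- t)) UNIV * norm x)) UNIV" for i
      using has_sum_cmult_right[OF has_sum_cmult_left[OF has_sum_infsum[OF b_sum[of "- t"]]], of "b t i" "norm x"]
      by (simp add: mult.assoc)
    show "(\<lambda>i. b t i * (infsum (b (- t)) UNIV * norm x)) summable_on UNIV"
      by (intro summable_on_cmult_left b_sum)
  qed (use b_nonneg in auto)
  have f_le: "norm (f p) \<le> (case p of (i, j) \<Rightarrow> b t i * b (- t) j * norm x)" for p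
  proof (cases p)
    case (Pair i j)
    have "norm (f p) \<le> \<bar>t\<bar> ^ i / fact i * (\<bar>t\<bar> ^ j / fact j) * (opnorm ^ (i + j) * norm x)"
      unfolding Pair f_def prod.case norm_scaleC norm_mult norm_expi_coeff abs_minus
      by (intro mult_left_mono norm_funpow_le) simp
    then show ?thesis
      by (simp add: Pair b_def power_mult_distrib power_add mult_ac)
  qed
  have f_sum: "f summable_on UNIV \<times> UNIV"
    by (rule abs_summable_summable) (rule Infinite_Sum.abs_summable_on_comparison_test'[OF b2_sum f_le])
  have rows: "((\<lambda>j. f (i, j)) has_sum expi_coeff t i *\<^sub>C (T ^^ i) (expi (- t) x)) UNIV" for i
  proof -
    let ?L = "\<lambda>y. expi_coeff t i *\<^sub>C (T ^^ i) y"
    have L: "bounded_linear ?L"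
      by (rule bounded_linear_compose[OF bounded_linear_scaleC bounded_linear_funpow])
    have "((\<lambda>j. ?L (expi_coeff (- t) j *\<^sub>C (T ^^ j) x)) has_sum ?L (expi (- t) x)) UNIV"
      using has_sum_bounded_linear[OF L norm_summable_imp_has_sum[OF abs_summable_expi expi_sums]]
      by (simp add: o_def)
    then show ?thesis by (simp add: f_def funpow_scaleC scaleC_scaleC funpow_add)
  qed
  have "((\<lambda>i. expi_coeff t i *\<^sub>C (T ^^ i) (expi (- t) x)) has_sum infsum f (UNIV \<times> UNIV)) UNIV"
    by (rule has_sum_SigmaD[OF has_sum_infsum[OF f_sum]]) (use rows in auto)
  then have 1: "expi t (expi (- t) x) = infsum f (UNIV \<times> UNIV)"
    by (rule sums_unique2[OF expi_sums has_sum_imp_sums])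
  have "bij_betw (\<lambda>(n, i). (i, n - i)) (SIGMA n:UNIV. {..n}) (UNIV \<times> (UNIV :: nat set))"
    by (rule bij_betwI[of _ _ _ "\<lambda>(i, j). (i + j, i)"]) auto
  note bij = this
  have g_has_sum: "((\<lambda>(n, i). f (i, n - i)) has_sum infsum f (UNIV \<times> UNIV)) (SIGMA n:UNIV. {..n})"
    using has_sum_reindex_bij_betw[OF bij, of f] has_sum_infsum[OF f_sum]
    by (simp add: case_prod_unfold)
  have diag: "(\<Sum>i\<le>n. f (i, n - i)) = (if n = 0 then x else 0)" for n
  proof -
    have "(\<Sum>i\<le>n. expi_coeff t i * expi_coeff (- t) (n - i)) = (\<i> * of_real t + \<i> * of_real (- t)) ^ n /\<^sub>R fact n"
      by (subst exp_series_add_commuting) (simp_all add: expi_coeff_def scaleR_conv_of_real divide_inverse mult_ac)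
    then have "(\<Sum>i\<le>n. expi_coeff t i * expi_coeff (- t) (n - i)) = (if n = 0 then 1 else 0)"
      by simp
    moreover have "(\<Sum>i\<le>n. f (i, n - i)) = (\<Sum>i\<le>n. expi_coeff t i * expi_coeff (- t) (n - i)) *\<^sub>C (T ^^ n) x"
      by (simp add: f_def scaleC_sum_left)
    ultimately show ?thesis by simp
  qed
  have "((\<lambda>n. \<Sum>i\<le>n. f (i, n - i)) has_sum infsum f (UNIV \<times> UNIV)) UNIV"
    by (rule has_sum_SigmaD[OF g_has_sum]) (simp add: has_sum_finite)
  then have "(\<lambda>n. if n = 0 then x else 0) sums infsum f (UNIV \<times> UNIV)"
    unfolding diag by (rule has_sum_imp_sums)
  moreover have "(\<lambda>n. if n = 0 then x else 0) sums x"
    using sums_single[of 0 "\<lambda>_. x"] by simp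
  ultimately show ?thesis using 1 sums_unique2 by metis
qed

definition sine :: "real \<Rightarrow> 'a \<Rightarrow> 'a"
  where "sine t x = (1 / (2 * \<i>)) *\<^sub>C (expi t x - expi (- t) x)"

lemma sine_sums: "(\<lambda>n. (sin_coeff n * t ^ n) *\<^sub>R (T ^^ n) x) sums sine t x"
proof -
  have "(\<lambda>n. (1 / (2 * \<i>)) *\<^sub>C (expi_coeff t n *\<^sub>C (T ^^ n) x - expi_coeff (- t) n *\<^sub>C (T ^^ n) x)) sums sine t x"
    unfolding sine_def
    by (intro bounded_linear.sums[OF bounded_linear_scaleC] sums_diff expi_sums)
  moreover have "(1 / (2 * \<i>)) *\<^sub>C (expi_coeff t n *\<^sub>C (T ^^ n) x - expi_coeff (- t) n *\<^sub>C (T ^^ n) x)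
      = (sin_coeff n * t ^ n) *\<^sub>R (T ^^ n) x" for n
    by (simp only: scaleR_scaleC sin_coeff_eq expi_coeff_def scaleC_scaleC of_real_minus
        mult_minus_right mult_minus_left flip: scaleC_diff_left)
  ultimately show ?thesis by simp
qed

lemma linear_sine: "linear (sine t)"
  using linear_expi[of t] linear_expi[of "- t"]
  by (intro linearI) (simp_all add: sine_def linear_add linear_scale scaleC_add_right scaleC_diff_right
      scaleC_scaleR_commute scaleR_diff_right)

lemma norm_rpoly_op_sine_bound:
  assumes "\<And>s. \<bar>s\<bar> \<le> 1 \<Longrightarrow> \<bar>poly p s\<bar> \<le> B" and "degree p \<le> d"
  shows "norm (rpoly_op p (sine t) x) \<le> (2 * d + 1) * B * norm x"
  by (rule norm_rpoly_op_sine_le[OF linear_expi expi_scaleC expi_minus_cancel norm_expi linear_sine sine_def assms])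

text \<open>On an eigenvector of \<open>sin (t T)\<close>, \<open>sin (t T) - sin b\<close> differs from \<open>t T - b\<close> by an operator
  whose norm relative to \<open>t T - b\<close> is at most \<open>exp (1/2) - 1 < 1\<close>, so \<open>sin\<close> is injective near \<open>0\<close>.\<close>

lemma sine_eigenvector:
  assumes v: "sine t v = s *\<^sub>R v" and t: "t > 0" "t * opnorm \<le> 1/4"
  obtains c where "T v = c *\<^sub>R v"
proof (cases "v = 0")
  case True
  then show thesis using that[of 0] zero by simp
next
  case False
  have T_pow: "norm (t ^ n *\<^sub>R (T ^^ n) x) \<le> (1/4) ^ n * norm x" for n x
  proof -
    have "norm (t ^ n *\<^sub>R (T ^^ n) x) \<le> t ^ n * (opnorm ^ n * norm x)"
      using t(1) norm_funpow_le[of n x] by (simp add: power_abs mult_left_mono)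
    also have "\<dots> = (t * opnorm) ^ n * norm x" by (simp add: power_mult_distrib mult_ac)
    also have "\<dots> \<le> (1/4) ^ n * norm x"
      using t opnorm_nonneg by (intro mult_right_mono power_mono) auto
    finally show ?thesis .
  qed
  have sin_coeff_le: "\<bar>sin_coeff n\<bar> \<le> 1 / fact n" for n
    by (simp add: sin_coeff_def power_abs)
  have exp_sums: "(\<lambda>n. r ^ Suc n / fact (Suc n) * c) sums ((exp r - 1) * c)" for r c :: real
  proof -
    have "(\<lambda>n. r ^ Suc n /\<^sub>R fact (Suc n)) sums (exp r - 1)"
      using sums_split_initial_segment[OF exp_converges[of r], of 1] by simp
    then show ?thesis
      by (intro sums_mult2) (simp add: divide_inverse mult.commute)
  qed
  have "norm (sine t v) \<le> (exp (1/4) - 1) * norm v"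
  proof -
    have "(\<lambda>n. (sin_coeff (Suc n) * t ^ Suc n) *\<^sub>R (T ^^ Suc n) v) sums sine t v"
      using sums_split_initial_segment[OF sine_sums[of t v], of 1] by simp
    moreover have "norm ((sin_coeff (Suc n) * t ^ Suc n) *\<^sub>R (T ^^ Suc n) v)
        \<le> (1/4) ^ Suc n / fact (Suc n) * norm v" for n
    proof -
      have "norm ((sin_coeff (Suc n) * t ^ Suc n) *\<^sub>R (T ^^ Suc n) v)
          = \<bar>sin_coeff (Suc n)\<bar> * norm (t ^ Suc n *\<^sub>R (T ^^ Suc n) v)"
        by (simp only: norm_scaleR abs_mult mult.assoc)
      also have "\<dots> \<le> 1 / fact (Suc n) * ((1/4) ^ Suc n * norm v)"
        by (intro mult_mono sin_coeff_le T_pow) auto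
      also have "\<dots> = (1/4) ^ Suc n / fact (Suc n) * norm v"
        by (simp add: field_simps del: fact_Suc power_Suc)
      finally show ?thesis .
    qed
    ultimately show ?thesis by (rule norm_sums_le[OF _ exp_sums])
  qed
  also have "\<dots> \<le> 7/16 * norm v"
    using exp_bound[of "1/4"] by (intro mult_right_mono) (auto simp: power2_eq_square)
  finally have s: "\<bar>s\<bar> \<le> 7/16" using False by (simp add: v)
  \<comment> \<open>Since sin (1/2) \<ge> 1/2 - 1/48 > 7/16, the eigenvalue s has an arcsine b in
    [-1/2, 1/2].\<close>
  have "\<bar>sin (1/2) - 1/2\<bar> \<le> inverse (fact 3) * \<bar>1/2 :: real\<bar> ^ 3"
    using Maclaurin_sin_bound[of "1/2" 3] by (simp add: eval_nat_numeral sin_coeff_def)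
  then have "1/2 - sin (1/2 :: real) \<le> 1/48"
    using abs_ge_minus_self[of "sin (1/2) - 1/2 :: real"] by (simp add: eval_nat_numeral)
  then have "7/16 \<le> sin (1/2 :: real)"
    by (simp add: eval_nat_numeral)
  then have "sin (- (1/2)) \<le> s" "s \<le> sin (1/2)" using s by (auto simp: abs_le_iff)
  moreover have "continuous_on {- (1/2)..1/2} (sin :: real \<Rightarrow> real)"
    by (intro continuous_intros)
  ultimately obtain b where b: "- (1/2) \<le> b" "b \<le> 1/2" "sin b = s"
    using IVT'[of sin "- (1/2)" s "1/2"] by auto
  define w where "w = t *\<^sub>R T v - b *\<^sub>R v"
  \<comment> \<open>The defect of (t T) ^ n v against b ^ n v; the recursion expresses it through w
    alone, with factor at most n (1/2) ^ (n - 1) for positive n.\<close>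
  define D where "D n = t ^ n *\<^sub>R (T ^^ n) v - b ^ n *\<^sub>R v" for n
  have D_Suc: "D (Suc n) = t *\<^sub>R T (D n) + b ^ n *\<^sub>R w" for n
    by (simp add: D_def w_def diff scaleR algebra_simps)
  have D_le: "norm (D (Suc n)) \<le> real (Suc n) * (1/2) ^ n * norm w" for n
  proof (induction n)
    case 0
    show ?case by (simp add: D_def w_def)
  next
    case (Suc n)
    have "norm (D (Suc (Suc n))) \<le> norm (t *\<^sub>R T (D (Suc n))) + norm (b ^ Suc n *\<^sub>R w)"
      by (subst D_Suc) (rule norm_triangle_ineq)
    also have "\<dots> \<le> 1/2 * norm (D (Suc n)) + (1/2) ^ Suc n * norm w"
    proof (intro add_mono)
      show "norm (t *\<^sub>R T (D (Suc n))) \<le> 1/2 * norm (D (Suc n))"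
      proof -
        have "norm (t *\<^sub>R T (D (Suc n))) \<le> 1/4 * norm (D (Suc n))"
          using T_pow[of 1 "D (Suc n)"] by simp
        then show ?thesis using norm_ge_zero[of "D (Suc n)"] by linarith
      qed
      have "\<bar>b\<bar> ^ Suc n \<le> (1/2) ^ Suc n" using b by (intro power_mono) auto
      then show "norm (b ^ Suc n *\<^sub>R w) \<le> (1/2) ^ Suc n * norm w"
        by (simp only: norm_scaleR power_abs) (rule mult_right_mono, auto)
    qed
    also have "\<dots> \<le> 1/2 * (real (Suc n) * (1/2) ^ n * norm w) + (1/2) ^ Suc n * norm w"
      using Suc by simp
    also have "\<dots> = real (Suc (Suc n)) * (1/2) ^ Suc n * norm w"
      by (simp add: algebra_simps)
    finally show ?case .
  qed
  have "(\<lambda>n. (sin_coeff n * t ^ n) *\<^sub>R (T ^^ n) v - (sin_coeff n *\<^sub>R b ^ n) *\<^sub>R v)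
      sums (sine t v - sin b *\<^sub>R v)"
    by (intro sums_diff sine_sums sums_scaleR_left sin_converges)
  then have "(\<lambda>n. sin_coeff n *\<^sub>R D n) sums 0"
    by (simp add: v b(3) D_def scaleR_diff_right)
  \<comment> \<open>The term for 1 is w itself, so the tail from 2 on sums to - w. In the tail the
    factor n of the defect cancels against n!, which leaves exp (1/2) - 1 \<le> 3/4.\<close>
  from sums_split_initial_segment[OF this, of 2]
  have "(\<lambda>n. sin_coeff (Suc (Suc n)) *\<^sub>R D (Suc (Suc n))) sums (- w)"
    by (simp add: eval_nat_numeral sin_coeff_def D_def w_def)
  moreover have "norm (sin_coeff (Suc (Suc n)) *\<^sub>R D (Suc (Suc n)))
      \<le> (1/2) ^ Suc n / fact (Suc n) * norm w" for n
  proof -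
    have "norm (sin_coeff (Suc (Suc n)) *\<^sub>R D (Suc (Suc n)))
        \<le> 1 / fact (Suc (Suc n)) * (real (Suc (Suc n)) * (1/2) ^ Suc n * norm w)"
      unfolding norm_scaleR by (intro mult_mono sin_coeff_le D_le) auto
    also have "\<dots> = (1/2) ^ Suc n / fact (Suc n) * norm w"
      by (simp add: fact_Suc[of "Suc n"] del: fact_Suc power_Suc)
    finally show ?thesis .
  qed
  ultimately have "norm (- w) \<le> (exp (1/2) - 1) * norm w"
    by (rule norm_sums_le[OF _ exp_sums])
  also have "\<dots> \<le> 3/4 * norm w"
    using exp_bound[of "1/2"] by (intro mult_right_mono) (auto simp: power2_eq_square)
  finally have "w = 0" by simp
  then have "t *\<^sub>R T v = b *\<^sub>R v" by (simp add: w_def)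
  then have "T v = (b / t) *\<^sub>R v"
    using t(1) by (metis divide_inverse_commute less_irrefl scaleR_scaleR scaleR_one left_inverse)
  then show thesis by (rule that)
qed

end

section \<open>The triple generated by one element\<close>

text \<open>The combinatorial core of power associativity: \<open>D i j\<close> is the defect of the product of the
  powers with exponents \<open>i\<close>, \<open>j\<close> and \<open>N + 1 - i - j\<close>.\<close>

lemma triangle_zero:
  fixes D :: "nat \<Rightarrow> nat \<Rightarrow> 'a::real_vector"
  assumes R1: "\<And>i j. i + j \<le> N \<Longrightarrow> D i (Suc j) = D (Suc i) j + D i j"
    and R2: "\<And>i. i \<le> N \<Longrightarrow> D i 0 = D (Suc i) 0 - D 0 (Suc i)"
    and bd: "D 0 0 = 0" "D (Suc N) 0 = 0"
    and ij: "i + j \<le> Suc N"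
  shows "D i j = 0"
proof -
  have s0: "D i 0 = 0" if "i \<le> N" for i
    using that
  proof (induction i rule: less_induct)
    case (less i)
    show ?case
    proof (cases "i = 0")
      case False
      \<comment> \<open>By the first recursion, a vanishing triangle below diagonal i makes D
        constant on that diagonal and affine in j on the next one.\<close>
      have inner: "(k + j < i \<longrightarrow> D k j = 0) \<and> (k + j = i \<longrightarrow> D k j = D i 0) \<and>
          (k + j = Suc i \<longrightarrow> D k j = D (Suc i) 0 + real j *\<^sub>R D i 0)" for k j
      proof (induction j arbitrary: k)
        case 0
        then show ?case using less by auto
      next
        case (Suc j)
        show ?case
        proof (intro conjI impI)
          assume "k + Suc j < i"
          then show "D k (Suc j) = 0" using R1[of k j] less.prems Suc[of k] Suc[of "Suc k"] by simp
        next
          assume "k + Suc j = i"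
          then show "D k (Suc j) = D i 0" using R1[of k j] less.prems Suc[of k] Suc[of "Suc k"] by simp
        next
          assume "k + Suc j = Suc i"
          then show "D k (Suc j) = D (Suc i) 0 + real (Suc j) *\<^sub>R D i 0"
            using R1[of k j] less.prems Suc[of k] Suc[of "Suc k"] by (simp add: scaleR_add_left)
        qed
      qed
      \<comment> \<open>The far end of the affine diagonal, inserted into the second recursion,
        shows that D i 0 is a negative multiple of itself.\<close>
      have e: "D 0 (Suc i) = D (Suc i) 0 + real (Suc i) *\<^sub>R D i 0" using inner[of 0 "Suc i"] by simp
      have "D i 0 = - (real (Suc i) *\<^sub>R D i 0)" by (subst R2[OF less.prems]) (simp only: e, simp)
      then have "(1 + real (Suc i)) *\<^sub>R D i 0 = 0"
        by (simp only: scaleR_add_left scaleR_one eq_neg_iff_add_eq_0)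
      then show ?thesis by simp
    qed (simp add: bd)
  qed
  have "\<forall>i. i + j \<le> Suc N \<longrightarrow> D i j = 0" for j
  proof (induction j)
    case 0
    then show ?case using s0 bd(2) by (auto simp: le_Suc_eq)
  next
    case (Suc j)
    then show ?case using R1 by simp
  qed
  then show ?thesis using ij by blast
qed

locale jb_star_element = jb_star_triple triple for triple :: "'a::complex_banach \<Rightarrow> 'a \<Rightarrow> 'a \<Rightarrow> 'a" +
  fixes a :: 'a
begin

sublocale box: hermitian_operator "triple a a"
  by unfold_locales (rule hermitian_box)

text \<open>These are the odd powers: \<open>pow n\<close> plays the role of a ^ (2 n + 1), whence
  the + 1 in \<open>triple_pow\<close>.\<close>

definition pow :: "nat \<Rightarrow> 'a"
  where "pow n = (triple a a ^^ n) a"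

lemma pow_0 [simp]: "pow 0 = a" and pow_Suc: "pow (Suc n) = triple a a (pow n)"
  by (simp_all add: pow_def)

lemma triple_pow: "triple (pow i) (pow j) (pow k) = pow (i + j + k + 1)"
proof -
  have "\<forall>i j k. i + j + k = N \<longrightarrow> triple (pow i) (pow j) (pow k) = pow (Suc N)" for N
  proof (induction N rule: less_induct)
    case (less N)
    show ?case
    proof (cases N)
      case 0
      then show ?thesis by (simp add: pow_Suc)
    next
      case (Suc M)
      have IH: "triple (pow i) (pow j) (pow k) = pow (Suc (i + j + k))" if "i + j + k \<le> M" for i j k
        using less[of "i + j + k"] that Suc by simp
      define D where "D i j = triple (pow i) (pow j) (pow (Suc M - (i + j))) - pow (Suc (Suc M))" for i j
      have D0: "D i j = 0" if "i + j \<le> Suc M" for i j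
      proof (rule triangle_zero[OF _ _ _ _ that])
        \<comment> \<open>The first recursion comes from L(a, a) applied to a product whose
          exponents add up to M, where the induction hypothesis holds.\<close>
        fix i j assume ij: "i + j \<le> M"
        define k where "k = M - (i + j)"
        have e: "Suc M - (i + Suc j) = k" "Suc M - (Suc i + j) = k" "Suc M - (i + j) = Suc k"
          using ij by (auto simp: k_def)
        have "triple a a (triple (pow i) (pow j) (pow k)) = pow (Suc (Suc M))"
          using IH[of i j k] ij by (simp add: k_def pow_Suc)
        then show "D i (Suc j) = D (Suc i) j + D i j"
          using jordan_identity[of a a "pow i" "pow j" "pow k"]
          unfolding D_def e by (simp add: pow_Suc algebra_simps)
      next
        \<comment> \<open>The second recursion comes from L(\<open>pow i\<close>, a) applied to {a,
          a, \<open>pow k\<close>}.\<close>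
        fix i assume i: "i \<le> M"
        define k where "k = M - i"
        have e: "Suc M - (i + 0) = Suc k" "Suc M - (Suc i + 0) = k" "Suc M - (0 + Suc i) = k"
          using i by (auto simp: k_def)
        have "triple (pow i) a (triple a a (pow k))
            = triple (triple (pow i) a a) a (pow k) - triple a (triple a (pow i) a) (pow k)
              + triple a a (triple (pow i) a (pow k))"
          by (rule jordan_identity)
        moreover have "triple (pow i) a a = pow (Suc i)" by (simp add: pow_Suc triple_commute[of _ a a])
        moreover have "triple a (pow i) a = pow (Suc i)" using IH[of 0 i 0] i by simp
        moreover have "triple a a (triple (pow i) a (pow k)) = pow (Suc (Suc M))"
          using IH[of i 0 k] i by (simp add: k_def pow_Suc)
        ultimately show "D i 0 = D (Suc i) 0 - D 0 (Suc i)"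
          unfolding D_def e by (simp add: pow_Suc algebra_simps)
      next
        show "D 0 0 = 0" by (simp add: D_def pow_Suc)
        show "D (Suc M) 0 = 0"
          using triple_commute[of "pow (Suc M)" a a] by (simp add: D_def pow_Suc)
      qed
      show ?thesis
      proof (intro allI impI)
        fix i j k assume "i + j + k = N"
        then have "i + j \<le> Suc M" "k = Suc M - (i + j)" using Suc by auto
        then show "triple (pow i) (pow j) (pow k) = pow (Suc N)"
          using D0[of i j] Suc by (simp add: D_def)
      qed
    qed
  qed
  then show ?thesis by simp
qed

text \<open>The closed span is real, so that it also fits into real subspaces such as
  \<open>selfadj e\<close> below.\<close>

definition gen :: "'a set"
  where "gen = \<Inter> {X. closed X \<and> subspace X \<and> range pow \<subseteq> X}"

lemma closed_gen: "closed gen"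
  unfolding gen_def by (rule closed_Inter) auto

lemma subspace_gen: "subspace gen"
  unfolding gen_def by (rule subspace_Inter) auto

lemma pow_mem_gen: "pow n \<in> gen"
  by (auto simp: gen_def)

lemma a_mem_gen: "a \<in> gen"
  using pow_mem_gen[of 0] by simp

lemma gen_subset: "closed X \<Longrightarrow> subspace X \<Longrightarrow> range pow \<subseteq> X \<Longrightarrow> gen \<subseteq> X"
  by (auto simp: gen_def)

lemma gen_mem_induct:
  assumes f: "bounded_linear f" and p: "\<And>n. f (pow n) \<in> gen" and x: "x \<in> gen"
  shows "f x \<in> gen"
proof -
  interpret f: bounded_linear f by fact
  have "gen \<subseteq> f -` gen"
  proof (rule gen_subset)
    show "closed (f -` gen)"
      by (rule closed_vimage[OF closed_gen]) (rule linear_continuous_on[OF f])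
    show "subspace (f -` gen)"
      using subspace_gen by (auto simp: subspace_def f.zero f.add f.scaleR)
  qed (use p in auto)
  then show ?thesis using x by auto
qed

lemma gen_eq_induct:
  assumes fg: "bounded_linear f" "bounded_linear g" and p: "\<And>n. f (pow n) = g (pow n)" and x: "x \<in> gen"
  shows "f x = g x"
proof -
  interpret f: bounded_linear f by fact
  interpret g: bounded_linear g by fact
  have "gen \<subseteq> {x. f x = g x}"
  proof (rule gen_subset)
    show "closed {x. f x = g x}"
      by (intro closed_Collect_eq linear_continuous_on fg)
    show "subspace {x. f x = g x}"
      by (auto simp: subspace_def f.zero f.add f.scaleR g.zero g.add g.scaleR)
  qed (use p in auto)
  then show ?thesis using x by auto
qed

lemma triple_mem_gen:
  assumes "x \<in> gen" "y \<in> gen" "z \<in> gen" shows "triple x y z \<in> gen"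
proof -
  have "triple (pow i) (pow j) z \<in> gen" for i j
    using assms(3) by (rule gen_mem_induct[OF bounded_linear_triple(3), rotated]) (simp only: triple_pow pow_mem_gen)
  then have "triple (pow i) y z \<in> gen" for i
    using assms(2) by (rule gen_mem_induct[OF bounded_linear_triple(2)])
  then show ?thesis using assms(1) by (rule gen_mem_induct[OF bounded_linear_triple(1)])
qed

text \<open>Central maps can be moved freely between the slots of the triple product; they are the
  multiplication operators on the commutative triple \<open>gen\<close>.\<close>

definition central :: "('a \<Rightarrow> 'a) \<Rightarrow> bool"
  where "central A \<longleftrightarrow> (\<forall>x\<in>gen. A x \<in> gen \<and> (\<forall>y\<in>gen. \<forall>z\<in>gen.
    triple (A x) y z = A (triple x y z) \<and> triple y (A x) z = A (triple y x z)))"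

lemma centralD:
  assumes "central A" "x \<in> gen"
  shows "A x \<in> gen" "y \<in> gen \<Longrightarrow> z \<in> gen \<Longrightarrow> triple (A x) y z = A (triple x y z)"
    "y \<in> gen \<Longrightarrow> z \<in> gen \<Longrightarrow> triple y (A x) z = A (triple y x z)"
    "y \<in> gen \<Longrightarrow> z \<in> gen \<Longrightarrow> triple y z (A x) = A (triple y z x)"
  using assms by (auto simp: central_def triple_commute[of y z "A x"] triple_commute[of y z x])

text \<open>On powers this is \<open>triple_pow\<close>; linearity and continuity extend it to
  \<open>gen\<close> one slot at a time.\<close>

lemma central_box: "central (triple a a)"
proof -
  have L: "bounded_linear (\<lambda>x. triple a a x)" by (rule bounded_linear_triple)
  have B1: "bounded_linear (\<lambda>x. triple (triple a a x) y z)"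
    "bounded_linear (\<lambda>x. triple a a (triple x y z))" for y z
    using bounded_linear_compose[OF bounded_linear_triple(1) L]
      bounded_linear_compose[OF L bounded_linear_triple(1)] by auto
  have B2: "bounded_linear (\<lambda>y. triple x (triple a a y) z)"
    "bounded_linear (\<lambda>y. triple a a (triple x y z))" for x z
    using bounded_linear_compose[OF bounded_linear_triple(2) L]
      bounded_linear_compose[OF L bounded_linear_triple(2)] by auto
  have B3: "bounded_linear (\<lambda>z. triple a a (triple x y z))" for x y
    using bounded_linear_compose[OF L bounded_linear_triple(3)] by auto
  have "triple (triple a a x) y z = triple a a (triple x y z) \<and>
      triple x (triple a a y) z = triple a a (triple x y z)"
    if xyz: "x \<in> gen" "y \<in> gen" "z \<in> gen" for x y z
  proof
    have "triple (pow (Suc i)) (pow j) z = triple a a (triple (pow i) (pow j) z)" for i j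
      using xyz(3) by (rule gen_eq_induct[OF bounded_linear_triple(3) B3, rotated])
        (simp only: triple_pow, simp add: pow_Suc)
    then have "triple (pow (Suc i)) y z = triple a a (triple (pow i) y z)" for i
      using xyz(2) by (rule gen_eq_induct[OF bounded_linear_triple(2) B2(2)])
    then show "triple (triple a a x) y z = triple a a (triple x y z)"
      by (intro gen_eq_induct[OF B1[of y z] _ xyz(1)]) (simp only: pow_Suc)
    have "triple (pow i) (pow (Suc j)) z = triple a a (triple (pow i) (pow j) z)" for i j
      using xyz(3) by (rule gen_eq_induct[OF bounded_linear_triple(3) B3, rotated])
        (simp only: triple_pow, simp add: pow_Suc)
    then have "triple (pow i) (triple a a y) z = triple a a (triple (pow i) y z)" for i
      by (intro gen_eq_induct[OF B2[of _ z] _ xyz(2)]) (simp only: pow_Suc)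
    then show "triple x (triple a a y) z = triple a a (triple x y z)"
      using xyz(1) by (rule gen_eq_induct[OF bounded_linear_triple(1) B1(2)])
  qed
  then show ?thesis by (simp add: central_def triple_mem_gen a_mem_gen)
qed

lemma central_compose: "central A \<Longrightarrow> central B \<Longrightarrow> central (\<lambda>x. A (B x))"
  unfolding central_def by (simp add: triple_mem_gen)

lemma central_funpow: "central A \<Longrightarrow> central (A ^^ n)"
  by (induction n) (auto simp: central_def o_def intro: central_compose[unfolded central_def, rule_format])

lemma central_add: "central A \<Longrightarrow> central B \<Longrightarrow> central (\<lambda>x. A x + B x)"
  unfolding central_def by (simp add: triple_linear subspace_add[OF subspace_gen])

lemma central_scaleR: "central A \<Longrightarrow> central (\<lambda>x. r *\<^sub>R A x)"
  unfolding central_def by (simp add: triple_linear subspace_scale[OF subspace_gen])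

lemma central_0: "central (\<lambda>x. 0)"
  unfolding central_def by (simp add: subspace_0[OF subspace_gen])

lemma central_sum: "(\<And>i. i \<in> I \<Longrightarrow> central (A i)) \<Longrightarrow> central (\<lambda>x. \<Sum>i\<in>I. A i x)"
  by (induction I rule: infinite_finite_induct) (simp_all add: central_0 central_add)

lemma central_LIMSEQ:
  assumes A: "\<And>n. central (A n)" and lim: "\<And>x. x \<in> gen \<Longrightarrow> (\<lambda>n. A n x) \<longlonglongrightarrow> B x"
  shows "central B"
  unfolding central_def
proof (intro ballI conjI)
  fix x assume x: "x \<in> gen"
  show "B x \<in> gen"
    using closed_sequentially[OF closed_gen _ lim[OF x]] centralD(1)[OF A x] by blast
  fix y z assume yz: "y \<in> gen" "z \<in> gen"
  have "(\<lambda>n. triple (A n x) y z) \<longlonglongrightarrow> triple (B x) y z"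
    by (intro tendsto_intros lim x)
  moreover have "(\<lambda>n. triple (A n x) y z) \<longlonglongrightarrow> B (triple x y z)"
    using lim[OF triple_mem_gen[OF x yz]] by (simp add: centralD(2)[OF A x yz])
  ultimately show "triple (B x) y z = B (triple x y z)" by (rule LIMSEQ_unique)
  have "(\<lambda>n. triple y (A n x) z) \<longlonglongrightarrow> triple y (B x) z"
    by (intro tendsto_intros lim x)
  moreover have "(\<lambda>n. triple y (A n x) z) \<longlonglongrightarrow> B (triple y x z)"
    using lim[OF triple_mem_gen[OF yz(1) x yz(2)]] by (simp add: centralD(3)[OF A x yz])
  ultimately show "triple y (B x) z = B (triple y x z)" by (rule LIMSEQ_unique)
qed

text \<open>Small enough for \<open>sine_eigenvector\<close>; the summand 1 keeps the denominator
  positive when the operator is zero.\<close>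

definition tau :: real
  where "tau = 1 / (4 * (box.opnorm + 1))"

lemma tau: "tau > 0" "tau * box.opnorm \<le> 1/4"
  using box.opnorm_nonneg by (auto simp: tau_def field_simps)

abbreviation S :: "'a \<Rightarrow> 'a"
  where "S \<equiv> box.sine tau"

lemma central_S: "central S"
proof (rule central_LIMSEQ)
  show "central (\<lambda>x. \<Sum>i<n. (sin_coeff i * tau ^ i) *\<^sub>R (triple a a ^^ i) x)" for n
    by (intro central_sum central_scaleR central_funpow central_box)
  show "(\<lambda>n. \<Sum>i<n. (sin_coeff i * tau ^ i) *\<^sub>R (triple a a ^^ i) x) \<longlonglongrightarrow> S x" for x
    using box.sine_sums[of tau x] by (simp add: sums_def)
qed

lemma central_rpoly: "central (rpoly_op p S)"
proof -
  have "central (\<lambda>x. \<Sum>i\<le>degree p. coeff p i *\<^sub>R (S ^^ i) x)"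
    by (intro central_sum central_scaleR central_funpow central_S)
  then show ?thesis by (simp add: rpoly_op_def[abs_def])
qed

lemma cube_funpow_mem_gen: "x \<in> gen \<Longrightarrow> (cube ^^ n) x \<in> gen"
  by (induction n) (auto simp: cube_def triple_mem_gen)

text \<open>Centrality extracts p(S) from each of the three slots, so cubing an element cubes the
  polynomial.\<close>

lemma cube_funpow_rpoly:
  assumes x: "x \<in> gen"
  shows "(cube ^^ n) (rpoly_op p S x) = rpoly_op (p ^ 3 ^ n) S ((cube ^^ n) x)"
proof (induction n)
  case (Suc n)
  let ?q = "p ^ 3 ^ n" and ?y = "(cube ^^ n) x"
  note c = centralD[OF central_rpoly[of ?q]]
  have y: "?y \<in> gen" "triple ?y ?y ?y \<in> gen"
    using cube_funpow_mem_gen[OF x] triple_mem_gen by auto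
  have "?q ^ 3 = p ^ 3 ^ Suc n" by (simp only: power_Suc2 power_mult)
  then have eq: "p ^ 3 ^ Suc n = ?q * (?q * ?q)" by (simp add: power3_eq_cube mult.assoc)
  have "cube (rpoly_op ?q S ?y) = rpoly_op ?q S (rpoly_op ?q S (rpoly_op ?q S (cube ?y)))"
    using y by (simp add: cube_def c)
  also have "\<dots> = rpoly_op (p ^ 3 ^ Suc n) S (cube ?y)"
    by (simp only: eq rpoly_op_mult[OF box.linear_sine])
  finally show ?case using Suc by simp
qed simp

text \<open>The bound for \<open>p(S)\<close> obtained from Fourier coefficients grows only linearly in the degree.
  Applying it to iterated cubes and taking roots of order \<open>3 ^ n\<close> removes the constant.\<close>

lemma norm_rpoly_le:
  assumes x: "x \<in> gen" and B: "\<And>s. \<bar>s\<bar> \<le> 1 \<Longrightarrow> \<bar>poly p s\<bar> \<le> B"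
  shows "norm (rpoly_op p S x) \<le> B * norm x"
proof (rule power3_bound_imp_le)
  have B0: "B \<ge> 0" using B[of 0] by simp
  then show "B * norm x \<ge> 0" by simp
  fix n :: nat
  have deg: "degree (p ^ 3 ^ n) \<le> degree p * 3 ^ n" by (rule degree_power_le)
  have "\<bar>poly (p ^ 3 ^ n) s\<bar> \<le> B ^ 3 ^ n" if "\<bar>s\<bar> \<le> 1" for s
    using B[OF that] by (simp add: poly_power power_abs power_mono)
  from box.norm_rpoly_op_sine_bound[OF this deg, of tau "(cube ^^ n) x"]
  have "norm (rpoly_op (p ^ 3 ^ n) S ((cube ^^ n) x))
      \<le> (2 * (degree p * 3 ^ n) + 1) * B ^ 3 ^ n * norm ((cube ^^ n) x)"
    by (simp add: algebra_simps)
  then show "norm (rpoly_op p S x) ^ 3 ^ n \<le> (real (2 * degree p) * 3 ^ n + 1) * (B * norm x) ^ 3 ^ n"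
    by (simp add: norm_cube_funpow power_mult_distrib mult.assoc add.commute[of 1] flip: cube_funpow_rpoly[OF x])
qed simp

end

section \<open>Functional calculus and spectral decomposition\<close>

lemma polynomial_approx:
  fixes f :: "real \<Rightarrow> real"
  assumes f: "continuous_on UNIV f" and e: "e > 0"
  obtains p where "\<And>s. \<bar>s\<bar> \<le> 1 \<Longrightarrow> \<bar>f s - poly p s\<bar> \<le> e"
proof -
  obtain g where g: "real_polynomial_function g" "\<And>x. x \<in> {-1..1} \<Longrightarrow> \<bar>f x - g x\<bar> < e"
    using Stone_Weierstrass_real_polynomial_function[of "{-1..1::real}" f e] e
      continuous_on_subset[OF f] by auto
  then obtain c n where "g = (\<lambda>x. \<Sum>i\<le>n. c i * x ^ i)"
    using real_polynomial_function_iff_sum by auto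
  then have "g x = poly (\<Sum>i\<le>n. monom (c i) i) x" for x
    by (simp add: poly_sum poly_monom)
  then show thesis
    using g(2) by (intro that[of "\<Sum>i\<le>n. monom (c i) i"]) (force simp: abs_le_iff)
qed

context jb_star_element
begin

definition approx :: "(real \<Rightarrow> real) \<Rightarrow> nat \<Rightarrow> real poly"
  where "approx f n = (SOME p. \<forall>s. \<bar>s\<bar> \<le> 1 \<longrightarrow> \<bar>f s - poly p s\<bar> \<le> inverse (real (Suc n)))"

text \<open>\<open>fop f\<close> is the operator \<open>f(S)\<close> of the continuous functional calculus; only its values on
  \<open>gen\<close> are meaningful.\<close>

definition fop :: "(real \<Rightarrow> real) \<Rightarrow> 'a \<Rightarrow> 'a"
  where "fop f x = lim (\<lambda>n. rpoly_op (approx f n) S x)"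

abbreviation cont :: "(real \<Rightarrow> real) \<Rightarrow> bool"
  where "cont f \<equiv> continuous_on UNIV f"

lemma approx:
  assumes "cont f" "\<bar>s\<bar> \<le> 1"
  shows "\<bar>f s - poly (approx f n) s\<bar> \<le> inverse (real (Suc n))"
proof -
  obtain p where "\<And>s. \<bar>s\<bar> \<le> 1 \<Longrightarrow> \<bar>f s - poly p s\<bar> \<le> inverse (real (Suc n))"
    using polynomial_approx[OF assms(1), of "inverse (real (Suc n))"] by auto
  then have "\<exists>p. \<forall>s. \<bar>s\<bar> \<le> 1 \<longrightarrow> \<bar>f s - poly p s\<bar> \<le> inverse (real (Suc n))" by blast
  from someI_ex[OF this] show ?thesis using assms(2) by (simp add: approx_def)
qed

lemma norm_rpoly_diff_le:
  assumes "x \<in> gen" "\<And>s. \<bar>s\<bar> \<le> 1 \<Longrightarrow> \<bar>f s - poly p s\<bar> \<le> d" "\<And>s. \<bar>s\<bar> \<le> 1 \<Longrightarrow> \<bar>f s - poly q s\<bar> \<le> e"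
  shows "norm (rpoly_op p S x - rpoly_op q S x) \<le> (d + e) * norm x"
  unfolding rpoly_op_diff[symmetric]
proof (rule norm_rpoly_le[OF assms(1)])
  fix s :: real assume "\<bar>s\<bar> \<le> 1"
  then show "\<bar>poly (p - q) s\<bar> \<le> d + e" using assms(2,3)[of s] by simp
qed

lemma approx_LIMSEQ:
  assumes f: "cont f" and x: "x \<in> gen"
  shows "(\<lambda>n. rpoly_op (approx f n) S x) \<longlonglongrightarrow> fop f x"
proof -
  have "Cauchy (\<lambda>n. rpoly_op (approx f n) S x)"
  proof (rule metric_CauchyI)
    fix e :: real assume e: "e > 0"
    then have "e / (2 * (norm x + 1)) > 0" by (simp add: add_nonneg_pos)
    then obtain N where N: "inverse (real (Suc N)) < e / (2 * (norm x + 1))"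
      using reals_Archimedean by blast
    then have N': "2 * inverse (real (Suc N)) * (norm x + 1) < e"
      using norm_ge_zero[of x] by (simp add: field_simps add_nonneg_pos)
    have "dist (rpoly_op (approx f m) S x) (rpoly_op (approx f n) S x) < e" if "m \<ge> N" "n \<ge> N" for m n
    proof -
      have le: "inverse (real (Suc k)) \<le> inverse (real (Suc N))" if "k \<ge> N" for k
        using that by (intro le_imp_inverse_le) auto
      have "norm (rpoly_op (approx f m) S x - rpoly_op (approx f n) S x)
          \<le> (inverse (real (Suc m)) + inverse (real (Suc n))) * norm x"
        by (rule norm_rpoly_diff_le[OF x approx[OF f] approx[OF f]])
      also have "\<dots> \<le> (inverse (real (Suc N)) + inverse (real (Suc N))) * (norm x + 1)"
        by (intro mult_mono add_mono le that) auto
      finally show ?thesis using N' by (simp add: dist_norm)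
    qed
    then show "\<exists>M. \<forall>m\<ge>M. \<forall>n\<ge>M. dist (rpoly_op (approx f m) S x) (rpoly_op (approx f n) S x) < e"
      by blast
  qed
  then show ?thesis unfolding fop_def by (simp add: Cauchy_convergent_iff convergent_LIMSEQ_iff)
qed

text \<open>The limit does not depend on the approximating polynomials; sums and products of the
  chosen ones may therefore be used for sums and products of functions.\<close>

lemma fop_LIMSEQ:
  assumes f: "cont f" and x: "x \<in> gen" and e: "e \<longlonglongrightarrow> 0"
    and p: "\<And>n s. \<bar>s\<bar> \<le> 1 \<Longrightarrow> \<bar>f s - poly (p n) s\<bar> \<le> e n"
  shows "(\<lambda>n. rpoly_op (p n) S x) \<longlonglongrightarrow> fop f x"
proof -
  have "(\<lambda>n. (e n + inverse (real (Suc n))) * norm x) \<longlonglongrightarrow> (0 + 0) * norm x"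
    by (intro tendsto_intros e LIMSEQ_inverse_real_of_nat)
  then have lim: "(\<lambda>n. (e n + inverse (real (Suc n))) * norm x) \<longlonglongrightarrow> 0" by simp
  have "norm (rpoly_op (p n) S x - rpoly_op (approx f n) S x) \<le> (e n + inverse (real (Suc n))) * norm x" for n
    by (rule norm_rpoly_diff_le[OF x p approx[OF f]])
  then have "(\<lambda>n. rpoly_op (p n) S x - rpoly_op (approx f n) S x) \<longlonglongrightarrow> 0"
    by (intro Lim_null_comparison[OF _ lim] always_eventually allI)
  from tendsto_add[OF this approx_LIMSEQ[OF f x]] show ?thesis by simp
qed

lemma fop_poly: "x \<in> gen \<Longrightarrow> fop (poly p) x = rpoly_op p S x"
  by (rule LIMSEQ_unique[OF fop_LIMSEQ[of "poly p" x "\<lambda>_. 0" "\<lambda>_. p"] tendsto_const])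
    (auto intro: continuous_intros)

lemma fop_const: "x \<in> gen \<Longrightarrow> fop (\<lambda>_. c) x = c *\<^sub>R x"
proof -
  assume "x \<in> gen"
  moreover have "poly [:c:] = (\<lambda>_. c)" by (simp add: fun_eq_iff)
  ultimately show ?thesis using fop_poly[of x "[:c:]"] by (simp add: rpoly_op_def)
qed

lemma fop_ident: "x \<in> gen \<Longrightarrow> fop (\<lambda>s. s) x = S x"
proof -
  assume "x \<in> gen"
  moreover have "poly [:0, 1:] = (\<lambda>s :: real. s)" by (simp add: fun_eq_iff)
  ultimately show ?thesis
    using fop_poly[of x "[:0, 1:]"] by (simp add: rpoly_op_pCons[OF box.linear_sine] linear_0[OF box.linear_sine])
qed

lemma central_fop: "cont f \<Longrightarrow> central (fop f)"
  by (rule central_LIMSEQ[OF central_rpoly approx_LIMSEQ])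

lemma fop_mem_gen: "cont f \<Longrightarrow> x \<in> gen \<Longrightarrow> fop f x \<in> gen"
  using central_fop centralD(1) by blast

lemma norm_fop_le:
  assumes f: "cont f" and x: "x \<in> gen" and B: "\<And>s. \<bar>s\<bar> \<le> 1 \<Longrightarrow> \<bar>f s\<bar> \<le> B"
  shows "norm (fop f x) \<le> B * norm x"
proof (rule LIMSEQ_le[OF tendsto_norm[OF approx_LIMSEQ[OF f x]]])
  have "(\<lambda>n. (B + inverse (real (Suc n))) * norm x) \<longlonglongrightarrow> (B + 0) * norm x"
    by (intro tendsto_intros LIMSEQ_inverse_real_of_nat)
  then show "(\<lambda>n. (B + inverse (real (Suc n))) * norm x) \<longlonglongrightarrow> B * norm x" by simp
  have "norm (rpoly_op (approx f n) S x) \<le> (B + inverse (real (Suc n))) * norm x" for n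
  proof (rule norm_rpoly_le[OF x])
    fix s :: real assume "\<bar>s\<bar> \<le> 1"
    then show "\<bar>poly (approx f n) s\<bar> \<le> B + inverse (real (Suc n))"
      using B[of s] approx[OF f, of s n] by linarith
  qed
  then show "\<exists>N. \<forall>n\<ge>N. norm (rpoly_op (approx f n) S x) \<le> (B + inverse (real (Suc n))) * norm x"
    by blast
qed

lemma fop_add:
  assumes f: "cont f" and g: "cont g" and x: "x \<in> gen"
  shows "fop (\<lambda>s. f s + g s) x = fop f x + fop g x"
proof (rule LIMSEQ_unique)
  show "(\<lambda>n. rpoly_op (approx f n + approx g n) S x) \<longlonglongrightarrow> fop f x + fop g x"
    unfolding rpoly_op_add by (intro tendsto_intros approx_LIMSEQ assms)
  have "(\<lambda>n. inverse (real (Suc n)) + inverse (real (Suc n))) \<longlonglongrightarrow> 0 + 0"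
    by (intro tendsto_intros LIMSEQ_inverse_real_of_nat)
  then have e: "(\<lambda>n. inverse (real (Suc n)) + inverse (real (Suc n))) \<longlonglongrightarrow> 0" by simp
  show "(\<lambda>n. rpoly_op (approx f n + approx g n) S x) \<longlonglongrightarrow> fop (\<lambda>s. f s + g s) x"
  proof (rule fop_LIMSEQ[OF _ x e])
    show "cont (\<lambda>s. f s + g s)" using f g by (rule continuous_on_add)
    fix n and s :: real assume "\<bar>s\<bar> \<le> 1"
    then show "\<bar>f s + g s - poly (approx f n + approx g n) s\<bar> \<le> inverse (real (Suc n)) + inverse (real (Suc n))"
      using approx[OF f, of s n] approx[OF g, of s n] unfolding poly_add by linarith
  qed
qed

lemma fop_add_right:
  assumes f: "cont f" and x: "x \<in> gen" "y \<in> gen"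
  shows "fop f (x + y) = fop f x + fop f y"
proof (rule LIMSEQ_unique[OF approx_LIMSEQ[OF f subspace_add[OF subspace_gen x]]])
  show "(\<lambda>n. rpoly_op (approx f n) S (x + y)) \<longlonglongrightarrow> fop f x + fop f y"
    unfolding linear_add[OF rpoly_op_linear[OF box.linear_sine]]
    by (intro tendsto_intros approx_LIMSEQ assms)
qed

lemma fop_scaleR_right:
  assumes f: "cont f" and x: "x \<in> gen"
  shows "fop f (r *\<^sub>R x) = r *\<^sub>R fop f x"
proof (rule LIMSEQ_unique[OF approx_LIMSEQ[OF f subspace_scale[OF subspace_gen x]]])
  show "(\<lambda>n. rpoly_op (approx f n) S (r *\<^sub>R x)) \<longlonglongrightarrow> r *\<^sub>R fop f x"
    unfolding linear_scale[OF rpoly_op_linear[OF box.linear_sine]]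
    by (intro tendsto_intros approx_LIMSEQ assms)
qed

lemma fop_0_right: "cont f \<Longrightarrow> fop f 0 = 0"
  using fop_scaleR_right[OF _ a_mem_gen, of f 0] by simp

lemma fop_mult:
  assumes f: "cont f" and g: "cont g" and x: "x \<in> gen"
  shows "fop (\<lambda>s. f s * g s) x = fop f (fop g x)"
proof (rule LIMSEQ_unique)
  have comp: "compact {-1..1::real}" by simp
  have bdd: "\<exists>B\<ge>0. \<forall>s. \<bar>s\<bar> \<le> 1 \<longrightarrow> \<bar>h s\<bar> \<le> B" if "cont h" for h
  proof -
    have "bounded (h ` {-1..1})"
      by (intro compact_imp_bounded compact_continuous_image continuous_on_subset[OF that] comp) auto
    then obtain B where B': "\<forall>s\<in>{-1..1}. \<bar>h s\<bar> \<le> B" by (auto simp: bounded_iff)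
    then have B: "\<And>s. s \<in> {-1..1} \<Longrightarrow> \<bar>h s\<bar> \<le> B" by blast
    have "\<bar>h 0\<bar> \<le> B" by (rule B) simp
    then have "B \<ge> 0" by linarith
    then show ?thesis using B by (auto simp: abs_le_iff)
  qed
  obtain F where F: "F \<ge> 0" "\<And>s. \<bar>s\<bar> \<le> 1 \<Longrightarrow> \<bar>f s\<bar> \<le> F" using bdd[OF f] by blast
  obtain G where G: "G \<ge> 0" "\<And>s. \<bar>s\<bar> \<le> 1 \<Longrightarrow> \<bar>g s\<bar> \<le> G" using bdd[OF g] by blast
  let ?e = "\<lambda>n. inverse (real (Suc n))"
  have "(\<lambda>n. F * ?e n + (G + ?e n) * ?e n) \<longlonglongrightarrow> F * 0 + (G + 0) * 0"
    by (intro tendsto_intros LIMSEQ_inverse_real_of_nat)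
  then have e: "(\<lambda>n. F * ?e n + (G + ?e n) * ?e n) \<longlonglongrightarrow> 0" by simp
  show "(\<lambda>n. rpoly_op (approx f n * approx g n) S x) \<longlonglongrightarrow> fop (\<lambda>s. f s * g s) x"
  proof (rule fop_LIMSEQ[OF _ x e])
    show "cont (\<lambda>s. f s * g s)" using f g by (rule continuous_on_mult)
    fix n and s :: real assume s: "\<bar>s\<bar> \<le> 1"
    let ?p = "poly (approx f n) s" and ?q = "poly (approx g n) s"
    have q: "\<bar>?q\<bar> \<le> G + ?e n" using G(2)[OF s] approx[OF g s, of n] by linarith
    have "f s * g s - poly (approx f n * approx g n) s = f s * (g s - ?q) + ?q * (f s - ?p)"
      by (simp add: algebra_simps)
    also have "\<bar>\<dots>\<bar> \<le> \<bar>f s\<bar> * \<bar>g s - ?q\<bar> + \<bar>?q\<bar> * \<bar>f s - ?p\<bar>"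
      by (metis abs_mult abs_triangle_ineq)
    also have "\<dots> \<le> F * ?e n + (G + ?e n) * ?e n"
      using F(1) G(1) by (intro add_mono mult_mono approx f g s q F(2)[OF s]) auto
    finally show "\<bar>f s * g s - poly (approx f n * approx g n) s\<bar> \<le> F * ?e n + (G + ?e n) * ?e n" .
  qed
  let ?y = "fop g x" and ?y' = "\<lambda>n. rpoly_op (approx g n) S x"
  have y: "?y \<in> gen" by (rule fop_mem_gen[OF g x])
  have "(\<lambda>n. (F + 1) * norm (?y' n - ?y)) \<longlonglongrightarrow> (F + 1) * 0"
    by (intro tendsto_intros tendsto_norm_zero LIM_zero approx_LIMSEQ g x)
  then have lim: "(\<lambda>n. (F + 1) * norm (?y' n - ?y)) \<longlonglongrightarrow> 0" by simp
  \<comment> \<open>The approximants of f are bounded uniformly by F + 1, so the inner argument may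
    be replaced by its limit.\<close>
  have "norm (rpoly_op (approx f n) S (?y' n - ?y)) \<le> (F + 1) * norm (?y' n - ?y)" for n
  proof (rule norm_rpoly_le)
    show "?y' n - ?y \<in> gen"
      by (intro subspace_diff[OF subspace_gen] centralD(1)[OF central_rpoly] x y)
    fix s :: real assume s: "\<bar>s\<bar> \<le> 1"
    have "inverse (real (Suc n)) \<le> 1" by (simp add: field_simps)
    then show "\<bar>poly (approx f n) s\<bar> \<le> F + 1" using F(2)[OF s] approx[OF f s, of n] by linarith
  qed
  then have "(\<lambda>n. rpoly_op (approx f n) S (?y' n - ?y)) \<longlonglongrightarrow> 0"
    by (intro Lim_null_comparison[OF _ lim] always_eventually allI)
  from tendsto_add[OF this approx_LIMSEQ[OF f y]]
  show "(\<lambda>n. rpoly_op (approx f n * approx g n) S x) \<longlonglongrightarrow> fop f (fop g x)"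
    by (simp add: rpoly_op_mult[OF box.linear_sine] linear_diff[OF rpoly_op_linear[OF box.linear_sine]])
qed

lemma fop_cmult: "cont f \<Longrightarrow> x \<in> gen \<Longrightarrow> fop (\<lambda>s. c * f s) x = c *\<^sub>R fop f x"
  using fop_mult[of "\<lambda>_. c" f x] by (simp add: fop_const fop_mem_gen)

lemma fop_diff:
  assumes "cont f" "cont g" "x \<in> gen"
  shows "fop (\<lambda>s. f s - g s) x = fop f x - fop g x"
  using fop_add[of f "\<lambda>s. (- 1) * g s" x] fop_cmult[of g x "- 1"] assms
  by (simp add: continuous_on_minus)

lemma fop_sum:
  assumes "finite I" "\<And>i. i \<in> I \<Longrightarrow> cont (f i)" "x \<in> gen"
  shows "fop (\<lambda>s. \<Sum>i\<in>I. f i s) x = (\<Sum>i\<in>I. fop (f i) x)"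
  using assms
proof (induction I rule: finite_induct)
  case empty
  then show ?case by (simp add: fop_const)
next
  case (insert i I)
  then show ?case by (simp add: fop_add continuous_on_sum)
qed

lemma fop_box: "cont f \<Longrightarrow> x \<in> gen \<Longrightarrow> fop f (triple a a x) = triple a a (fop f x)"
  by (simp add: centralD(4)[OF central_fop] a_mem_gen)

lemma fop_eq_0: "x \<in> gen \<Longrightarrow> (\<And>s. f s = 0) \<Longrightarrow> fop f x = 0"
  using fop_const[of x 0] by (metis (no_types, lifting) ext scaleR_zero_left)

lemma triple_fop:
  assumes "cont f" "cont g" "cont h" "x \<in> gen" "y \<in> gen" "z \<in> gen"
  shows "triple (fop f x) (fop g y) (fop h z) = fop (\<lambda>s. f s * (g s * h s)) (triple x y z)"
proof -
  have "triple (fop f x) (fop g y) (fop h z) = fop f (triple x (fop g y) (fop h z))"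
    by (intro centralD(2) central_fop fop_mem_gen assms)
  also have "triple x (fop g y) (fop h z) = fop g (triple x y (fop h z))"
    by (intro centralD(3) central_fop fop_mem_gen assms)
  also have "triple x y (fop h z) = fop h (triple x y z)"
    by (intro centralD(4) central_fop assms)
  finally have "triple (fop f x) (fop g y) (fop h z) = fop f (fop g (fop h (triple x y z)))" .
  also have "\<dots> = fop (\<lambda>s. f s * (g s * h s)) (triple x y z)"
    using assms by (simp add: fop_mult fop_mem_gen triple_mem_gen continuous_on_mult)
  finally show ?thesis .
qed

text \<open>The spectrum of S as seen from the vector a: the common zeros in [-1, 1] of all
  functions whose operator annihilates a.\<close>

definition spec :: "real set"
  where "spec = {s. \<bar>s\<bar> \<le> 1 \<and> (\<forall>f. cont f \<longrightarrow> fop f a = 0 \<longrightarrow> f s = 0)}"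

text \<open>Where \<bar>f\<bar> \<ge> e, compactness provides finitely many annihilators of a
  without a common zero; the sum H of their squares annihilates a and is positive there. Subtracting
  a multiple of H from f does not change the value at a and leaves a function bounded by e.\<close>

lemma fop_zero_on_spec:
  assumes f: "cont f" and 0: "\<And>s. s \<in> spec \<Longrightarrow> f s = 0"
  shows "fop f a = 0"
proof -
  have le: "norm (fop f a) \<le> e * norm a" if e: "e > 0" for e
  proof -
    define C where "C = {-1..1} \<inter> {s. e \<le> \<bar>f s\<bar>}"
    have C: "compact C"
      unfolding C_def by (intro compact_Int_closed closed_Collect_le continuous_intros f) auto
    have "\<exists>h. cont h \<and> fop h a = 0 \<and> h s \<noteq> 0" if "s \<in> C" for s
    proof -
      have "s \<notin> spec" using 0[of s] that e by (auto simp: C_def)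
      then show ?thesis using that by (auto simp: C_def spec_def abs_le_iff)
    qed
    then obtain h where h: "\<And>s. s \<in> C \<Longrightarrow> cont (h s) \<and> fop (h s) a = 0 \<and> h s s \<noteq> 0" by metis
    have "C \<subseteq> (\<Union>s\<in>C. {t. h s t \<noteq> 0})" using h by auto
    moreover have "open {t. h s t \<noteq> 0}" if "s \<in> C" for s
      using h[OF that] by (intro open_Collect_neq) auto
    ultimately obtain C' where C': "C' \<subseteq> C" "finite C'" "C \<subseteq> (\<Union>s\<in>C'. {t. h s t \<noteq> 0})"
      using compactE_image[OF C, of C "\<lambda>s. {t. h s t \<noteq> 0}"] by blast
    define H where "H t = (\<Sum>s\<in>C'. h s t * h s t)" for t
    have contH: "cont H" unfolding H_def using C' h by (intro continuous_on_sum continuous_on_mult) auto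
    have H0: "H t \<ge> 0" for t unfolding H_def by (intro sum_nonneg) auto
    have Hpos: "H t > 0" if t: "t \<in> C" for t
    proof -
      obtain s where s: "s \<in> C'" "h s t \<noteq> 0" using C'(3) t by blast
      have "0 < h s t * h s t" using s by (simp add: zero_less_mult_iff) linarith
      also have "\<dots> \<le> H t" unfolding H_def using C'(2) s(1) by (intro member_le_sum) auto
      finally show ?thesis .
    qed
    obtain m where m: "m > 0" "\<And>t. t \<in> C \<Longrightarrow> m \<le> H t"
    proof (cases "C = {}")
      case True
      then show thesis using that[of 1] by simp
    next
      case False
      then obtain t where "t \<in> C" "\<And>u. u \<in> C \<Longrightarrow> H t \<le> H u"
        using continuous_attains_inf[OF C, of H] continuous_on_subset[OF contH] by auto
      then show thesis using that[of "H t"] Hpos by blast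
    qed
    have Ha: "fop H a = 0"
    proof -
      have "fop H a = (\<Sum>s\<in>C'. fop (\<lambda>t. h s t * h s t) a)"
        unfolding H_def[abs_def] using C' h
        by (intro fop_sum a_mem_gen) (auto intro: continuous_on_mult)
      also have "\<dots> = 0"
        using C' h by (intro sum.neutral) (auto simp: fop_mult a_mem_gen fop_0_right subset_iff)
      finally show ?thesis .
    qed
    \<comment> \<open>The maximum with m makes g continuous everywhere. On C it equals H, so g H = f
      there; elsewhere g H is f times a factor in [0, 1].\<close>
    define g where "g = (\<lambda>t. f t / max m (H t))"
    have contg: "cont g"
      unfolding g_def using m by (intro continuous_intros f contH) (auto simp: max_def)
    have "fop (\<lambda>t. f t - g t * H t) a = fop f a"
      using fop_mult[OF contg contH a_mem_gen] fop_diff[OF f continuous_on_mult[OF contg contH] a_mem_gen]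
      by (simp add: Ha fop_0_right contg)
    moreover have "norm (fop (\<lambda>t. f t - g t * H t) a) \<le> e * norm a"
    proof (rule norm_fop_le[OF _ a_mem_gen])
      show "cont (\<lambda>t. f t - g t * H t)" by (intro continuous_intros f contg contH)
      fix s :: real assume s: "\<bar>s\<bar> \<le> 1"
      show "\<bar>f s - g s * H s\<bar> \<le> e"
      proof (cases "s \<in> C")
        case True
        then have "max m (H s) = H s" "H s \<noteq> 0" using m(2)[OF True] m(1) by auto
        then show ?thesis using e by (simp add: g_def)
      next
        case False
        define q where "q = H s / max m (H s)"
        have q: "0 \<le> q" "q \<le> 1" using H0[of s] m(1) by (auto simp: q_def divide_le_eq max_def)
        have "f s - g s * H s = f s * (1 - q)" by (simp add: g_def q_def algebra_simps)
        then have "\<bar>f s - g s * H s\<bar> \<le> \<bar>f s\<bar> * 1" using q by (simp add: abs_mult mult_left_le)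
        also have "\<dots> \<le> e" using False s by (auto simp: C_def abs_le_iff)
        finally show ?thesis .
      qed
    qed
    ultimately show ?thesis by simp
  qed
  show ?thesis
  proof (rule ccontr)
    assume "fop f a \<noteq> 0"
    then have n: "norm (fop f a) > 0" by simp
    define c where "c = norm a + 1"
    have c: "c > 0" by (simp add: c_def add_nonneg_pos)
    define e where "e = norm (fop f a) / (2 * c)"
    have "e > 0" using n c by (simp add: e_def)
    from le[OF this] have "norm (fop f a) \<le> e * norm a" .
    also have "\<dots> \<le> e * c" using \<open>e > 0\<close> by (simp add: c_def)
    also have "\<dots> = norm (fop f a) / 2" using c by (simp add: e_def)
    finally show False using n by simp
  qed
qed

lemma fop_cong_spec:
  assumes "cont f" "cont g" "\<And>s. s \<in> spec \<Longrightarrow> f s = g s"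
  shows "fop f a = fop g a"
  using fop_zero_on_spec[of "\<lambda>s. f s - g s"] assms
  by (simp add: fop_diff a_mem_gen continuous_on_diff)

text \<open>An infinite spectrum has a limit point p. Bumps at geometrically shrinking distances
  from p have disjoint supports, and applying them to a produces an infinite orthogonal sequence of
  nonzero elements.\<close>

lemma finite_spec:
  assumes kk: "kadec_klee TYPE('a)"
  shows "finite spec"
proof (rule ccontr)
  assume inf: "infinite spec"
  have "spec \<subseteq> {-1..1}" by (auto simp: spec_def abs_le_iff)
  then obtain p where p: "p islimpt spec"
    using inf compact_eq_Bolzano_Weierstrass[of "{-1..1::real}"] by auto
  define P where "P = (\<lambda>_::nat. \<lambda>s. s \<in> spec \<and> s \<noteq> p)"
  \<comment> \<open>The factor 4 keeps the bumps apart, since the one for d n lives where \<bar>t -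
    p\<bar> is between d n / 2 and 2 d n.\<close>
  have "\<exists>s. \<forall>n. P n (s n) \<and> \<bar>s (Suc n) - p\<bar> < \<bar>s n - p\<bar> / 4"
  proof (rule dependent_nat_choice)
    show "\<exists>x. P 0 x" using p[unfolded islimpt_approachable, rule_format, of 1] by (auto simp: P_def)
    show "\<exists>y. P (Suc n) y \<and> \<bar>y - p\<bar> < \<bar>x - p\<bar> / 4" if "P n x" for x n
      using p[unfolded islimpt_approachable, rule_format, of "\<bar>x - p\<bar> / 4"] that
      by (auto simp: P_def dist_real_def)
  qed
  then obtain s where s: "\<And>n. s n \<in> spec" "\<And>n. s n \<noteq> p" "\<And>n. \<bar>s (Suc n) - p\<bar> < \<bar>s n - p\<bar> / 4"
    by (auto simp: P_def)
  define d where "d n = \<bar>s n - p\<bar>" for n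
  have d: "d n > 0" for n using s(2) by (simp add: d_def)
  have dlt: "d n < d m / 4" if "m < n" for m n
    using that
  proof (induction n)
    case (Suc n)
    have 1: "d (Suc n) < d n / 4" using s(3)[of n] by (simp add: d_def)
    show ?case
    proof (cases "m = n")
      case False
      then have "d n < d m / 4" using Suc by simp
      then show ?thesis using 1 d[of m] by linarith
    qed (use 1 in simp)
  qed simp
  define f where "f n = (\<lambda>t. max 0 (1 - 2 * \<bar>\<bar>t - p\<bar> - d n\<bar> / d n))" for n
  have contf: "cont (f n)" for n
    unfolding f_def using d[of n] by (intro continuous_intros) auto
  have supp: "d n / 2 < \<bar>t - p\<bar> \<and> \<bar>t - p\<bar> < 2 * d n" if "f n t \<noteq> 0" for n t
  proof -
    have "2 * \<bar>\<bar>t - p\<bar> - d n\<bar> / d n < 1"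
    proof (rule ccontr)
      assume "\<not> ?thesis"
      then have "f n t = 0" by (simp add: f_def)
      then show False using that by contradiction
    qed
    then have "\<bar>\<bar>t - p\<bar> - d n\<bar> < d n / 2" using d[of n] by (simp add: field_simps)
    then show ?thesis using d[of n] unfolding abs_less_iff[of "\<bar>t - p\<bar> - d n"] by linarith
  qed
  have disj': "f m t * f n t = 0" if "m < n" for m n t
  proof (rule ccontr)
    assume "f m t * f n t \<noteq> 0"
    then show False using supp[of m t] supp[of n t] dlt[OF that] by auto
  qed
  have disj: "f m t * f n t = 0" if "m \<noteq> n" for m n t
    using that disj'[of m n t] disj'[of n m t] by (cases m n rule: linorder_cases) (auto simp: mult.commute)
  define b where "b n = fop (f n) a" for n
  have b0: "b n \<noteq> 0" for n
  proof
    assume "b n = 0"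
    then have "f n (s n) = 0" using s(1)[of n] contf by (auto simp: b_def spec_def)
    then show False by (simp add: f_def d_def)
  qed
  define D where "D n = fop (f n) ` gen" for n
  have "orth_family D"
    unfolding orth_family_def
  proof (intro conjI allI ballI impI)
    fix i
    show "subspace (D i)"
      unfolding subspace_def
    proof (intro conjI ballI allI)
      show "0 \<in> D i" unfolding D_def
        using subspace_0[OF subspace_gen] fop_0_right[OF contf] by (metis imageI)
      show "x + y \<in> D i" if "x \<in> D i" "y \<in> D i" for x y
        using that subspace_add[OF subspace_gen] unfolding D_def
        by (auto simp flip: fop_add_right[OF contf])
      show "r *\<^sub>R x \<in> D i" if "x \<in> D i" for r x
        using that subspace_scale[OF subspace_gen] unfolding D_def
        by (auto simp flip: fop_scaleR_right[OF contf])
    qed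
    show "cube x \<in> D i" if "x \<in> D i" for x
    proof -
      obtain y where y: "y \<in> gen" "x = fop (f i) y" using \<open>x \<in> D i\<close> by (auto simp: D_def)
      have "cube x = fop (f i) (fop (\<lambda>s. f i s * f i s) (triple y y y))"
        using y contf[of i] by (simp add: cube_def triple_fop fop_mult triple_mem_gen continuous_on_mult)
      then show ?thesis
        using y contf[of i] by (auto simp: D_def fop_mem_gen triple_mem_gen continuous_on_mult)
    qed
  next
    fix i j k x y z
    assume "x \<in> D i" "y \<in> D j" "z \<in> D k" and ijk: "\<not> (i = j \<and> j = k)"
    then obtain x' y' z' where "x' \<in> gen" "x = fop (f i) x'" "y' \<in> gen" "y = fop (f j) y'"
      "z' \<in> gen" "z = fop (f k) z'" by (auto simp: D_def)
    moreover have "f i t * (f j t * f k t) = 0" for t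
      using ijk disj[of i j t] disj[of j k t] by auto
    ultimately show "triple x y z = 0"
      by (simp only: triple_fop[OF contf contf contf]) (intro fop_eq_0 triple_mem_gen; simp)
  qed
  moreover have "b n \<in> D n" for n by (simp add: b_def D_def a_mem_gen)
  ultimately show False using b0 by (rule kadec_klee_no_orth_sequence[OF kk])
qed

text \<open>The Lagrange polynomials of the finite spectrum act on a like orthogonal idempotents.
  Each nonzero part b satisfies S b = s b, hence L(a, a) b = c b by injectivity of the sine, and {b,
  b, b} = c b; dividing by sqrt c makes it a tripotent.\<close>

lemma spectral_decomposition_spec:
  assumes kk: "kadec_klee TYPE('a)"
  obtains e :: "real \<Rightarrow> 'a" and l :: "real \<Rightarrow> real"
  where "\<And>s. tripotent (e s)" "\<And>s t. s \<noteq> t \<Longrightarrow> e t \<in> peirce (e s) 0"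
    "\<And>s. s \<in> spec \<Longrightarrow> e s \<noteq> 0 \<and> l s > 0 \<and> triple a a (e s) = (l s)\<^sup>2 *\<^sub>R e s"
    "\<And>s. e s \<in> gen" "a = (\<Sum>s\<in>spec. l s *\<^sub>R e s)"
proof -
  have fin: "finite spec" by (rule finite_spec[OF kk])
  define \<phi> where "\<phi> s = (\<lambda>u. \<Prod>r\<in>spec - {s}. (u - r) / (s - r))" for s :: real
  have cont: "cont (\<phi> s)" for s
    unfolding \<phi>_def by (intro continuous_intros) auto
  have \<phi>: "\<phi> s u = (if u = s then 1 else 0)" if "s \<in> spec" "u \<in> spec" for s u
    using that fin by (auto simp: \<phi>_def)
  define b where "b s = fop (\<phi> s) a" for s
  have b_gen: "b s \<in> gen" for s by (simp add: b_def fop_mem_gen cont a_mem_gen)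
  have b0: "b s \<noteq> 0" if "s \<in> spec" for s
    using that cont[of s] \<phi>[OF that that] by (auto simp: b_def spec_def)
  have "a = fop (\<lambda>_. 1) a" by (simp add: fop_const a_mem_gen)
  also have "\<dots> = fop (\<lambda>u. \<Sum>s\<in>spec. \<phi> s u) a"
    using fin by (intro fop_cong_spec continuous_on_sum cont) (auto simp: \<phi>)
  also have "\<dots> = (\<Sum>s\<in>spec. b s)"
    unfolding b_def by (intro fop_sum fin cont a_mem_gen)
  finally have a: "a = (\<Sum>s\<in>spec. b s)" .
  have tr: "triple (b s) (b r) (b t) = triple a a (fop (\<lambda>u. \<phi> s u * (\<phi> r u * \<phi> t u)) a)" for s r t
    using triple_fop[OF cont cont cont a_mem_gen a_mem_gen a_mem_gen]
    by (simp add: b_def fop_box a_mem_gen cont continuous_on_mult)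
  have tr0: "triple (b s) (b s) (b t) = 0" if "s \<in> spec" "t \<in> spec" "s \<noteq> t" for s t
  proof -
    have "fop (\<lambda>u. \<phi> s u * (\<phi> s u * \<phi> t u)) a = 0"
      by (intro fop_zero_on_spec continuous_on_mult cont) (use that \<phi> in auto)
    then show ?thesis by (simp add: tr)
  qed
  have cube_b: "triple (b s) (b s) (b s) = triple a a (b s)" if "s \<in> spec" for s
  proof -
    have "fop (\<lambda>u. \<phi> s u * (\<phi> s u * \<phi> s u)) a = b s"
      unfolding b_def by (intro fop_cong_spec continuous_on_mult cont) (use that \<phi> in auto)
    then show ?thesis by (simp add: tr)
  qed
  have "\<exists>c>0. triple a a (b s) = c *\<^sub>R b s" if s: "s \<in> spec" for s
  proof -
    have "S (b s) = fop (\<lambda>u. u * \<phi> s u) a"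
      by (simp add: b_def fop_mult cont a_mem_gen fop_ident fop_mem_gen continuous_on_id)
    also have "\<dots> = fop (\<lambda>u. s * \<phi> s u) a"
      by (intro fop_cong_spec continuous_on_mult cont continuous_on_id continuous_on_const)
        (use s \<phi> in auto)
    also have "\<dots> = s *\<^sub>R b s" by (simp add: b_def fop_cmult cont a_mem_gen)
    finally obtain c where c: "triple a a (b s) = c *\<^sub>R b s"
      using box.sine_eigenvector[OF _ tau] by blast
    then have cb: "triple (b s) (b s) (b s) = of_real c *\<^sub>C b s"
      using cube_b[OF s] by (simp add: scaleR_scaleC)
    \<comment> \<open>Since {b, b, b} = c b, the number c is an eigenvalue of L(b, b), and the axiom
      on the spectrum makes it nonnegative.\<close>
    have "complex_of_real c \<in> op_spectrum (triple (b s) (b s))"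
      unfolding op_spectrum_def
    proof (intro CollectI notI, elim exE conjE)
      fix R assume "bounded_clinear R" and R: "\<forall>x. R (of_real c *\<^sub>C x - triple (b s) (b s) x) = x"
      then have "R 0 = 0" by (simp add: bounded_clinear_def linear_simps)
      then show False using R[rule_format, of "b s"] b0[OF s] cb by simp
    qed
    then have "c \<ge> 0" using nonneg_spectrum_box[of "b s"] by auto
    moreover have "c \<noteq> 0"
    proof
      assume "c = 0"
      then have "norm (b s) ^ 3 = 0" using cb norm_cube[of "b s"] by simp
      then show False using b0[OF s] by simp
    qed
    ultimately show ?thesis using c by (intro exI[of _ c]) simp
  qed
  then obtain c where c: "\<And>s. s \<in> spec \<Longrightarrow> c s > 0 \<and> triple a a (b s) = c s *\<^sub>R b s" by metis
  define l where "l s = sqrt (c s)" for s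
  have l: "l s > 0" "(l s)\<^sup>2 = c s" if "s \<in> spec" for s using c[OF that] by (auto simp: l_def)
  \<comment> \<open>The value 0 is a tripotent orthogonal to everything, so the family may be
    indexed by all reals.\<close>
  define e where "e s = (if s \<in> spec then inverse (l s) *\<^sub>R b s else 0)" for s
  show thesis
  proof (rule that[of e l])
    show "tripotent (e s)" for s
    proof (cases "s \<in> spec")
      case True
      have "triple (e s) (e s) (e s) = (inverse (l s) * (inverse (l s) * (inverse (l s) * (l s)\<^sup>2))) *\<^sub>R b s"
        using True c[OF True] l[OF True] by (simp add: e_def triple_linear cube_b)
      also have "\<dots> = e s" using True l(1)[OF True] by (simp add: e_def power2_eq_square field_simps)
      finally show ?thesis by (simp add: tripotent_def)
    qed (simp add: e_def tripotent_def)
    show "e t \<in> peirce (e s) 0" if "s \<noteq> t" for s t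
      using tr0[of s t] that by (auto simp: e_def mem_peirce triple_linear)
    show "e s \<noteq> 0 \<and> l s > 0 \<and> triple a a (e s) = (l s)\<^sup>2 *\<^sub>R e s" if "s \<in> spec" for s
      using that b0[OF that] l[OF that] c[OF that] by (simp add: e_def triple_linear)
    show "e s \<in> gen" for s
      using b_gen subspace_scale[OF subspace_gen] subspace_0[OF subspace_gen] by (auto simp: e_def)
    show "a = (\<Sum>s\<in>spec. l s *\<^sub>R e s)"
    proof -
      have "b s = l s *\<^sub>R e s" if "s \<in> spec" for s
        using l(1)[OF that] that by (simp add: e_def)
      then show ?thesis using a by (simp cong: sum.cong)
    qed
  qed
qed

end

context jb_star_triple
begin

text \<open>The subspace \<open>G\<close> controls where the tripotents lie: it contains the odd
  powers of a and hence their closed real span. It is used with the whole space,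
  \<open>selfadj e\<close> and \<open>peirce e (1/2)\<close>.\<close>

lemma spectral_decomposition:
  assumes kk: "kadec_klee TYPE('a)"
    and G: "closed G" "subspace G" "a \<in> G" "\<And>x. x \<in> G \<Longrightarrow> triple a a x \<in> G"
  obtains I :: "real set" and e :: "real \<Rightarrow> 'a" and l :: "real \<Rightarrow> real"
  where "finite I" "\<And>s. tripotent (e s)" "\<And>s t. s \<noteq> t \<Longrightarrow> e t \<in> peirce (e s) 0"
    "\<And>s. s \<in> I \<Longrightarrow> e s \<noteq> 0 \<and> l s > 0 \<and> triple a a (e s) = (l s)\<^sup>2 *\<^sub>R e s"
    "\<And>s. e s \<in> G" "a = (\<Sum>s\<in>I. l s *\<^sub>R e s)"
proof -
  interpret A: jb_star_element triple a by unfold_locales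
  have "A.pow n \<in> G" for n
    by (induction n) (simp_all add: A.pow_Suc G)
  then have "A.gen \<subseteq> G" by (intro A.gen_subset G) auto
  then show thesis
    by (rule_tac A.spectral_decomposition_spec[OF kk], rule_tac that[OF A.finite_spec[OF kk]]) auto
qed

lemma orth_sum_le:
  assumes e: "\<And>s. tripotent (e s)" "\<And>s t. s \<noteq> t \<Longrightarrow> e t \<in> peirce (e s) 0"
    and I: "finite I" and m: "m \<ge> 0" "\<And>s. s \<in> I \<Longrightarrow> \<bar>l s\<bar> \<le> m"
  shows "norm (\<Sum>s\<in>I. l s *\<^sub>R e s) \<le> m"
proof (rule norm_orth_sum_le[OF orth_family_tripotents[OF e] I _ m(1)])
  fix s assume "s \<in> I"
  moreover have "norm (e s) \<le> 1" using norm_tripotent[OF e(1)[of s]] by (cases "e s = 0") auto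
  ultimately show "norm (l s *\<^sub>R e s) \<le> m"
    using m(2)[of s] mult_mono[of "\<bar>l s\<bar>" m "norm (e s)" 1] by (simp add: m(1))
qed auto

lemma orth_sum_ge:
  assumes e: "\<And>s. tripotent (e s)" "\<And>s t. s \<noteq> t \<Longrightarrow> e t \<in> peirce (e s) 0"
    and I: "finite I" "s \<in> I" "e s \<noteq> 0"
  shows "\<bar>l s\<bar> \<le> norm (\<Sum>s\<in>I. l s *\<^sub>R e s)"
proof -
  have "norm (l s *\<^sub>R e s) \<le> norm (\<Sum>s\<in>I. l s *\<^sub>R e s)"
    by (rule norm_orth_sum_ge[OF orth_family_tripotents[OF e] I(1) _ I(2)]) auto
  then show ?thesis using norm_tripotent[OF e(1) I(3)] by simp
qed

section \<open>Minimal tripotents\<close>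

text \<open>The self-adjoint part of E2(e) for the involution x \<mapsto> {e, x, e}.\<close>

definition selfadj :: "'a \<Rightarrow> 'a set"
  where "selfadj e = {x. triple e e x = x \<and> triple e x e = x}"

lemma selfadj_peirce: "x \<in> selfadj e \<Longrightarrow> x \<in> peirce e 1"
  by (simp add: selfadj_def mem_peirce)

lemma closed_selfadj: "closed (selfadj e)"
  unfolding selfadj_def
  by (intro closed_Collect_conj closed_Collect_eq linear_continuous_on bounded_linear_triple
      bounded_linear_ident)

lemma subspace_selfadj: "subspace (selfadj e)"
  by (auto simp: subspace_def selfadj_def triple_linear)

lemma tripotent_mem_selfadj: "tripotent e \<Longrightarrow> e \<in> selfadj e"
  by (simp add: selfadj_def tripotent_def)

lemma selfadj_swap:
  assumes e: "tripotent e" and b: "b \<in> selfadj e" and z: "z \<in> peirce e 1"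
  shows "triple e b z = triple b e z"
proof -
  have "triple e b z \<in> peirce e 1"
    using peirce_rule[OF tripotent_mem_peirce[OF e] selfadj_peirce[OF b] z] by simp
  then show ?thesis
    using jordan_identity[of e b e e z] b z
    by (simp add: selfadj_def mem_peirce triple_commute[of b e e])
qed

text \<open>The square c = {x, x, e} of x is self-adjoint, and on self-adjoint elements L(x, x) is
  the Jordan multiplication by c. This invariance allows spectral decompositions inside
  \<open>selfadj e\<close>.\<close>

lemma selfadj_box:
  assumes e: "tripotent e" and x: "x \<in> selfadj e" and y: "y \<in> selfadj e"
  shows "triple x x y \<in> selfadj e"
proof -
  have e1: "e \<in> peirce e 1" and x1: "x \<in> peirce e 1" and y1: "y \<in> peirce e 1"
    using tripotent_mem_peirce[OF e] selfadj_peirce x y by auto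
  have xee: "triple x e e = x" using x by (simp add: selfadj_def triple_commute[of x e e])
  have exe: "triple e x e = x" and eye: "triple e y e = y" using x y by (auto simp: selfadj_def)
  define c where "c = triple x x e"
  have exx: "triple e x x = c" by (simp add: c_def triple_commute[of e x x])
  have c1: "c \<in> peirce e 1" using peirce_rule[OF x1 x1 e1] by (simp add: c_def)
  have c: "triple x e x = c" using selfadj_swap[OF e x x1] exx by simp
  have "triple e c e = c"
    using jordan_identity[of x e e x e] by (simp add: xee exe exx c flip: c_def)
  then have cs: "c \<in> selfadj e" using c1 by (simp add: selfadj_def mem_peirce)
  have w1: "triple x e y \<in> peirce e 1" using peirce_rule[OF x1 e1 y1] by simp
  have "triple x e (triple e x y) = triple e x (triple x e y)"
    by (simp add: selfadj_swap[OF e x y1] selfadj_swap[OF e x w1])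
  then have xxy: "triple x x y = triple e c y"
    using jordan_identity[of x e e x y] by (simp add: xee exx)
  have "triple c y e = triple y e c"
    using selfadj_swap[OF e y c1] by (simp add: triple_commute[of c y e])
  also have "\<dots> = triple e c y"
    using selfadj_swap[OF e cs y1] by (simp add: triple_commute[of y e c])
  finally have "triple c y e = triple x x y" by (simp add: xxy)
  then have "triple e (triple x x y) e = triple x x y"
    using jordan_identity_middle[of e x x y e] triple_commute[of e y c]
    by (simp add: eye flip: c_def)
  moreover have "triple e e (triple x x y) = triple x x y"
    using peirce_rule[OF x1 x1 y1] by (simp add: mem_peirce)
  ultimately show ?thesis by (simp add: selfadj_def)
qed

text \<open>With \<open>w = e - u\<close>, expanding \<open>{u, u, u} = u\<close> shows that \<open>2 w\<close> equals a sum of terms which are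
  at least quadratic in \<open>w\<close>.\<close>

lemma selfadj_rigid:
  assumes e: "tripotent e" and u: "tripotent u" "u \<in> selfadj e"
    and M: "M > 0" "\<And>x y z. norm (triple x y z) \<le> M * (norm x * norm y * norm z)"
    and w: "norm (e - u) \<le> 1" "4 * M * norm (e - u) < 2"
  shows "u = e"
proof (rule ccontr)
  assume "u \<noteq> e"
  define w where "w = e - u"
  have w0: "norm w > 0" using \<open>u \<noteq> e\<close> by (simp add: w_def)
  have ws: "w \<in> selfadj e"
    unfolding w_def by (intro subspace_diff[OF subspace_selfadj] tripotent_mem_selfadj e u)
  have eee: "triple e e e = e" using e by (simp add: tripotent_def)
  have eew: "triple e e w = w" "triple w e e = w" "triple e w e = w"
    using ws by (auto simp: selfadj_def triple_commute[of w e e])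
  have "triple (e - w) (e - w) (e - w) = e - w"
    using u(1) by (simp add: w_def tripotent_def)
  then have "2 *\<^sub>R w = triple e w w + triple w w e + triple w e w - triple w w w"
    by (simp add: triple_linear eee eew scaleR_2 algebra_simps)
  moreover have "2 * norm w = norm (2 *\<^sub>R w)" by simp
  ultimately have "2 * norm w = norm (triple e w w + triple w w e + triple w e w - triple w w w)"
    by (simp only:)
  also have "\<dots> \<le> norm (triple e w w) + norm (triple w w e) + norm (triple w e w) + norm (triple w w w)"
    by (intro norm_triangle_le_diff norm_triangle_le add_mono order_refl)
  also have "\<dots> \<le> M * (norm w * norm w) + M * (norm w * norm w) + M * (norm w * norm w) + M * (norm w * norm w)"
  proof (intro add_mono)
    have e1: "norm e \<le> 1" using norm_tripotent[OF e] by (cases "e = 0") auto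
    have *: "M * (norm e * (norm w * norm w)) \<le> M * (1 * (norm w * norm w))"
      "M * (norm w * (norm w * norm w)) \<le> M * (1 * (norm w * norm w))"
      using e1 w(1) M(1) by (intro mult_left_mono mult_right_mono; simp add: w_def)+
    show "norm (triple e w w) \<le> M * (norm w * norm w)" using * M(2)[of e w w] by (simp add: mult_ac)
    show "norm (triple w w e) \<le> M * (norm w * norm w)" using * M(2)[of w w e] by (simp add: mult_ac)
    show "norm (triple w e w) \<le> M * (norm w * norm w)" using * M(2)[of w e w] by (simp add: mult_ac)
    show "norm (triple w w w) \<le> M * (norm w * norm w)" using * M(2)[of w w w] by (simp add: mult_ac)
  qed
  also have "\<dots> = (4 * M * norm w) * norm w" by simp
  also have "\<dots> < 2 * norm w" using w(2) w0 unfolding w_def by (rule mult_strict_right_mono)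
  finally show False by simp
qed

lemma peirce0_sym: "tripotent f \<Longrightarrow> g \<in> peirce f 0 \<Longrightarrow> f \<in> peirce g 0"
  using box_peirce0(1)[of f g g] by (simp add: mem_peirce triple_commute[of g g f])

lemma tripotent_orth_sum:
  assumes e: "\<And>s. tripotent (e s)" "\<And>s t. s \<noteq> t \<Longrightarrow> e t \<in> peirce (e s) 0" and I: "finite I"
  shows "tripotent (\<Sum>s\<in>I. e s)"
proof -
  have "cube (\<Sum>s\<in>I. e s) = (\<Sum>s\<in>I. cube (e s))"
    by (rule cube_orth_sum[OF orth_family_tripotents[OF e] I]) (auto intro: range_eqI[of _ _ 1])
  then show ?thesis using e(1) by (simp add: cube_def tripotent_def)
qed

definition minimal :: "'a \<Rightarrow> bool"
  where "minimal e \<longleftrightarrow> tripotent e \<and> e \<noteq> 0 \<and> (\<forall>x\<in>peirce e 1. \<exists>c. x = c *\<^sub>C e)"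

text \<open>A self-adjoint \<open>h\<close> outside the real multiples of \<open>e\<close> is used to perturb \<open>e\<close>; the
  tripotents in the decomposition of \<open>e + d h\<close> add up to a self-adjoint tripotent close to \<open>e\<close>,
  hence to \<open>e\<close>.\<close>

lemma tripotent_split:
  assumes kk: "kadec_klee TYPE('a)" and e: "tripotent e" "e \<noteq> 0" and nmin: "\<not> minimal e"
  obtains f g where "tripotent f" "f \<noteq> 0" "tripotent g" "g \<noteq> 0" "g \<in> peirce f 0" "e = f + g"
proof -
  obtain h where h: "h \<in> selfadj e" "\<And>r. h \<noteq> r *\<^sub>R e"
  proof -
    obtain z where z: "z \<in> peirce e 1" "\<And>c. z \<noteq> c *\<^sub>C e"
      using nmin e by (auto simp: minimal_def)
    define z' where "z' = triple e z e"
    have z': "triple e z' e = z" unfolding z'_def by (rule triple_triple_self_peirce1[OF e(1) z(1)])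
    have e1: "e \<in> peirce e 1" by (rule tripotent_mem_peirce[OF e(1)])
    have zz: "triple e e z = z" "triple e e z' = z'"
      using z(1) peirce_rule[OF e1 z(1) e1] by (simp_all add: mem_peirce z'_def)
    \<comment> \<open>Up to the factor 2 and a sign, the self-adjoint real and imaginary parts of z:
      as z = (p - i q) / 2, they cannot both be real multiples of e.\<close>
    define p q where "p = z + z'" and "q = \<i> *\<^sub>C (z - z')"
    have ps: "p \<in> selfadj e" and qs: "q \<in> selfadj e"
      by (simp_all add: selfadj_def p_def q_def triple_linear triple_scaleC_middle triple_scaleC_right
          zz z' scaleC_minus_left scaleC_diff_right flip: z'_def)
    have "p \<noteq> r *\<^sub>R e \<or> q \<noteq> t *\<^sub>R e" for r t
    proof (rule ccontr)
      assume "\<not> ?thesis"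
      then have pq: "p = of_real r *\<^sub>C e" "q = of_real t *\<^sub>C e" by (simp_all add: scaleR_scaleC)
      have "z = (1/2) *\<^sub>C (p + (- \<i>) *\<^sub>C q)"
        by (simp add: p_def q_def scaleC_scaleC scaleC_add_right scaleC_diff_right
            scaleC_minus_left flip: scaleC_add_left)
      also have "\<dots> = ((1/2) * (of_real r + (- \<i>) * of_real t)) *\<^sub>C e"
        by (simp only: pq scaleC_scaleC flip: scaleC_add_left)
      finally show False using z(2) by blast
    qed
    then show thesis using that[of p] that[of q] ps qs by blast
  qed
  obtain M where M: "M > 0" "\<And>x y z. norm (triple x y z) \<le> M * (norm x * norm y * norm z)"
    using triple_bound by blast
  have N: "norm h > 0" using h(2)[of 0] by simp
  have e1: "norm e = 1" by (rule norm_tripotent[OF e])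
  \<comment> \<open>Chosen so that r (1 + 3 M) = 1 / (1 + 4 M), which meets both smallness
    conditions of \<open>selfadj_rigid\<close>.\<close>
  define r where "r = 1 / ((1 + 3 * M) * (1 + 4 * M))"
  have r: "r > 0" "r \<le> 1" "r * (1 + 3 * M) \<le> 1" "4 * M * (r * (1 + 3 * M)) < 2"
  proof -
    have *: "r * (1 + 3 * M) = 1 / (1 + 4 * M)" using M(1) by (simp add: r_def)
    show r0: "r > 0" using M(1) by (simp add: r_def)
    show 1: "r * (1 + 3 * M) \<le> 1" unfolding * using M(1) by simp
    show "4 * M * (r * (1 + 3 * M)) < 2" unfolding * using M(1) by (simp add: field_simps)
    have "r * 1 \<le> r * (1 + 3 * M)" using r0 M(1) by (intro mult_left_mono) auto
    then show "r \<le> 1" using 1 by simp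
  qed
  define d where "d = r / norm h"
  define x where "x = e + d *\<^sub>R h"
  have dh: "norm (d *\<^sub>R h) = r" using N r(1) by (simp add: d_def)
  have d0: "d \<noteq> 0" using N r(1) by (simp add: d_def)
  have xs: "x \<in> selfadj e"
    unfolding x_def by (intro subspace_add[OF subspace_selfadj] subspace_scale[OF subspace_selfadj]
        tripotent_mem_selfadj e h)
  \<comment> \<open>L(x, x) is close to L(e, e), which fixes the tripotents of x; hence the
    coefficients of x are close to 1.\<close>
  have box: "norm (triple x x y - triple e e y) \<le> 3 * M * r * norm y" for y
  proof -
    let ?k = "d *\<^sub>R h"
    have "triple x x y - triple e e y = triple e ?k y + triple ?k e y + triple ?k ?k y"
      by (simp add: x_def triple_add_left triple_add_middle)
    also have "norm \<dots> \<le> norm (triple e ?k y) + norm (triple ?k e y) + norm (triple ?k ?k y)"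
      by (intro norm_triangle_le add_mono order_refl)
    also have "\<dots> \<le> M * (1 * r * norm y) + M * (r * 1 * norm y) + M * (r * r * norm y)"
      using M(2)[of e ?k y] M(2)[of ?k e y] M(2)[of ?k ?k y] unfolding dh e1 by linarith
    also have "\<dots> \<le> M * (1 * r * norm y) + M * (r * 1 * norm y) + M * (r * 1 * norm y)"
      using r M(1) by (intro add_mono mult_left_mono mult_right_mono) auto
    finally show ?thesis by (simp add: algebra_simps)
  qed
  have inv: "triple x x y \<in> selfadj e" if "y \<in> selfadj e" for y
    using selfadj_box[OF e(1) xs that] .
  obtain I :: "real set" and u :: "real \<Rightarrow> 'a" and l :: "real \<Rightarrow> real" where I: "finite I"
    and u: "\<And>s. tripotent (u s)" "\<And>s t. s \<noteq> t \<Longrightarrow> u t \<in> peirce (u s) 0"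
    and l: "\<And>s. s \<in> I \<Longrightarrow> u s \<noteq> 0 \<and> l s > 0 \<and> triple x x (u s) = (l s)\<^sup>2 *\<^sub>R u s"
    and us: "\<And>s. u s \<in> selfadj e" and x: "x = (\<Sum>s\<in>I. l s *\<^sub>R u s)"
    using spectral_decomposition[OF kk closed_selfadj subspace_selfadj xs inv] by blast
  have l1: "\<bar>1 - l s\<bar> \<le> 3 * M * r" if s: "s \<in> I" for s
  proof -
    have u1: "norm (u s) = 1" using norm_tripotent[OF u(1)] l[OF s] by blast
    have "triple e e (u s) = u s" using us[of s] by (simp add: selfadj_def)
    then have "triple x x (u s) - triple e e (u s) = ((l s)\<^sup>2 - 1) *\<^sub>R u s"
      using l[OF s] by (simp add: scaleR_left_diff_distrib)
    then have "\<bar>(l s)\<^sup>2 - 1\<bar> \<le> 3 * M * r" using box[of "u s"] u1 by simp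
    moreover have "(l s)\<^sup>2 - 1 = - ((1 - l s) * (1 + l s))"
      by (simp add: power2_eq_square algebra_simps)
    then have "\<bar>(l s)\<^sup>2 - 1\<bar> = \<bar>1 - l s\<bar> * (1 + l s)"
      using l[OF s] by (simp add: abs_mult)
    moreover have "\<bar>1 - l s\<bar> * 1 \<le> \<bar>1 - l s\<bar> * (1 + l s)"
      using l[OF s] by (intro mult_left_mono) auto
    ultimately show ?thesis by simp
  qed
  \<comment> \<open>The distance to e is at most r, from e to x, plus 3 M r, from x to the sum of
    its tripotents.\<close>
  have sum_u: "(\<Sum>s\<in>I. u s) = e"
  proof (rule selfadj_rigid[OF e(1) tripotent_orth_sum[OF u I] _ M])
    show "(\<Sum>s\<in>I. u s) \<in> selfadj e" by (intro subspace_sum[OF subspace_selfadj] us)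
    have "x - (\<Sum>s\<in>I. u s) = (\<Sum>s\<in>I. (l s - 1) *\<^sub>R u s)"
      by (simp add: x sum_subtractf scaleR_left_diff_distrib)
    also have "norm \<dots> \<le> 3 * M * r"
      using l1 M(1) r(1) by (intro orth_sum_le[OF u I]) (auto simp: abs_minus_commute)
    finally have "norm (x - (\<Sum>s\<in>I. u s)) \<le> 3 * M * r" .
    moreover have "norm (e - (\<Sum>s\<in>I. u s)) \<le> norm (x - (\<Sum>s\<in>I. u s)) + norm (d *\<^sub>R h)"
    proof -
      have "e - (\<Sum>s\<in>I. u s) = (x - (\<Sum>s\<in>I. u s)) - d *\<^sub>R h" by (simp add: x_def)
      then show ?thesis by (simp only: norm_triangle_ineq4)
    qed
    ultimately have le: "norm (e - (\<Sum>s\<in>I. u s)) \<le> r * (1 + 3 * M)"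
      unfolding dh by (simp add: algebra_simps)
    then show "norm (e - (\<Sum>s\<in>I. u s)) \<le> 1" using r(3) by linarith
    have "4 * M * norm (e - (\<Sum>s\<in>I. u s)) \<le> 4 * M * (r * (1 + 3 * M))"
      using le M(1) by (intro mult_left_mono) auto
    then show "4 * M * norm (e - (\<Sum>s\<in>I. u s)) < 2" using r(4) by linarith
  qed
  have "I \<noteq> {}" using sum_u e(2) by auto
  then obtain s where s: "s \<in> I" by blast
  \<comment> \<open>With a single tripotent, x and therefore h would be real multiples of e.\<close>
  have "I \<noteq> {s}"
  proof
    assume "I = {s}"
    then have "x = l s *\<^sub>R e" using x sum_u by simp
    then have "d *\<^sub>R h = (l s - 1) *\<^sub>R e" by (simp add: x_def scaleR_left_diff_distrib eq_diff_eq add.commute)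
    then have "h = (inverse d * (l s - 1)) *\<^sub>R e"
      using d0 by (metis left_inverse scaleR_one scaleR_scaleR)
    then show False using h(2) by blast
  qed
  then obtain t where t: "t \<in> I - {s}" using s by auto
  define g where "g = (\<Sum>t\<in>I - {s}. u t)"
  show thesis
  proof (rule that[of "u s" g])
    show "tripotent (u s)" "u s \<noteq> 0" using u l[OF s] by auto
    show "tripotent g" unfolding g_def by (rule tripotent_orth_sum[OF u]) (use I in auto)
    have "\<bar>1\<bar> \<le> norm (\<Sum>t\<in>I - {s}. 1 *\<^sub>R u t)"
      by (rule orth_sum_ge[OF u, where l="\<lambda>_. 1" and s=t]) (use I t l in auto)
    then show "g \<noteq> 0" by (auto simp: g_def)
    show "g \<in> peirce (u s) 0" unfolding g_def by (intro subspace_sum[OF subspace_peirce] u) auto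
    show "e = u s + g" using sum_u sum.remove[OF I s, of u] by (simp add: g_def)
  qed
qed

section \<open>The order of tripotents and the existence of minimal ones\<close>

definition below :: "'a \<Rightarrow> 'a \<Rightarrow> bool"
  where "below f e \<longleftrightarrow> tripotent f \<and> e - f \<in> peirce f 0"

lemma below_peirce1:
  assumes "below f e" shows "f \<in> peirce e 1"
proof -
  define g where "g = e - f"
  have f: "tripotent f" and g: "g \<in> peirce f 0" and e: "e = f + g"
    using assms by (auto simp: below_def g_def)
  have "triple g g f = 0" using peirce0_sym[OF f g] by (simp add: mem_peirce)
  then show ?thesis
    using f box_peirce0[OF f g] by (simp add: e mem_peirce triple_linear tripotent_def)
qed

text \<open>The difference e - g is orthogonal to all of E2(g), which contains f.\<close>

lemma below_trans:
  assumes fg: "below f g" and ge: "below g e" shows "below f e"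
proof -
  have g: "tripotent g" and g0: "e - g \<in> peirce g 0" using ge by (auto simp: below_def)
  have "triple f f (e - g) = 0"
    using peirce1_orth_peirce0(1)[OF g below_peirce1[OF fg] g0, of f]
    by (simp add: triple_commute[of f f "e - g"]) (metis peirce1_orth_peirce0(2) g below_peirce1[OF fg] g0)
  then have "e - g \<in> peirce f 0" by (simp add: mem_peirce)
  then have "(e - g) + (g - f) \<in> peirce f 0"
    using fg by (intro subspace_add[OF subspace_peirce]) (auto simp: below_def)
  then show ?thesis using fg by (simp add: below_def)
qed

text \<open>Otherwise e can be split forever: a piece f n is set aside and its complement g n is
  split again. All later pieces lie below g n and are thus orthogonal to f n, which gives an
  infinite orthogonal sequence.\<close>

lemma minimal_below:
  assumes kk: "kadec_klee TYPE('a)" and e: "tripotent e" "e \<noteq> 0"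
  shows "\<exists>f. minimal f \<and> below f e"
proof (rule ccontr)
  assume none: "\<not> ?thesis"
  have nmin: "\<not> minimal f" if "below f e" for f using none that by blast
  define P where "P = (\<lambda>(n::nat) (f, g). below g e \<and> g \<noteq> 0 \<and> tripotent f \<and> f \<noteq> 0 \<and> g \<in> peirce f 0)"
  define Q where "Q = (\<lambda>(n::nat) (f :: 'a, g) (f', g'). below f' g \<and> below g' g)"
  have below_refl: "below e e" using e by (simp add: below_def mem_peirce)
  have step: "\<exists>f' g'. below f' g \<and> below g' g \<and> P n (f', g')" if g: "below g e" "g \<noteq> 0" for g n
  proof -
    have "tripotent g" using g by (simp add: below_def)
    then obtain f' g' where f': "tripotent f'" "f' \<noteq> 0" "tripotent g'" "g' \<noteq> 0" "g' \<in> peirce f' 0" "g = f' + g'"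
      using tripotent_split[OF kk _ g(2) nmin[OF g(1)]] by blast
    then have b: "below f' g" "below g' g" using peirce0_sym[OF f'(1,5)] by (auto simp: below_def)
    then show ?thesis using f' below_trans[OF b(2) g(1)] by (auto simp: P_def)
  qed
  have "\<exists>F. \<forall>n. P n (F n) \<and> Q n (F n) (F (Suc n))"
  proof (rule dependent_nat_choice)
    show "\<exists>p. P 0 p" using step[OF below_refl e(2)] by blast
    show "\<exists>q. P (Suc n) q \<and> Q n p q" if "P n p" for p n
      using that step[of "snd p" "Suc n"] by (auto simp: P_def Q_def split: prod.splits)
  qed
  then obtain F where F: "\<And>n. P n (F n)" "\<And>n. Q n (F n) (F (Suc n))" by blast
  define f g where "f n = fst (F n)" and "g n = snd (F n)" for n
  have f: "tripotent (f n)" "f n \<noteq> 0" "g n \<in> peirce (f n) 0" and g: "tripotent (g n)" for n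
    using F(1)[of n] by (auto simp: P_def f_def g_def below_def split: prod.splits)
  have fg: "below (f (Suc n)) (g n)" "below (g (Suc n)) (g n)" for n
    using F(2)[of n] by (auto simp: Q_def f_def g_def split: prod.splits)
  have f_below: "below (f m) (g n)" if "n < m" for n m
  proof -
    have "below (g k) (g n) \<and> below (f (Suc k)) (g n)" if "n \<le> k" for k
      using that
    proof (induction k rule: dec_induct)
      case base
      then show ?case using g fg by (simp add: below_def mem_peirce)
    next
      case (step k)
      then show ?case using fg below_trans by blast
    qed
    from this[of "m - 1"] show ?thesis using that by (cases m) auto
  qed
  have orth: "f m \<in> peirce (f n) 0" if "n < m" for n m
  proof -
    have 1: "f m \<in> peirce (g n) 1" by (rule below_peirce1[OF f_below[OF that]])
    have 0: "f n \<in> peirce (g n) 0" by (rule peirce0_sym[OF f(1,3)])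
    have "triple (f m) (f n) (f n) = 0" by (rule peirce1_orth_peirce0(1)[OF g 1 0])
    then show ?thesis by (simp add: mem_peirce triple_commute[of "f n" "f n"])
  qed
  have orth': "f m \<in> peirce (f n) 0" if "n \<noteq> m" for n m
    using that orth[of n m] peirce0_sym[OF f(1) orth[of m n]] by (cases n m rule: linorder_cases) auto
  show False
    by (rule kadec_klee_no_orth_sequence[OF kk orth_family_tripotents[of f], of f])
      (use f orth' in \<open>auto intro: range_eqI[of _ _ 1]\<close>)
qed

text \<open>The largest coefficient in the decomposition of x equals \<open>norm x\<close>. A
  minimal f below its tripotent is orthogonal both to the rest of that tripotent and to the other
  summands.\<close>

lemma minimal_norm_part:
  assumes kk: "kadec_klee TYPE('a)" and x: "x \<noteq> 0"
  obtains f x0 where "minimal f" "x0 \<in> peirce f 0" "x = norm x *\<^sub>R f + x0"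
proof -
  have inv: "triple x x y \<in> UNIV" for y by simp
  obtain I :: "real set" and e :: "real \<Rightarrow> 'a" and l :: "real \<Rightarrow> real" where I: "finite I"
    and e: "\<And>s. tripotent (e s)" "\<And>s t. s \<noteq> t \<Longrightarrow> e t \<in> peirce (e s) 0"
    and l: "\<And>s. s \<in> I \<Longrightarrow> e s \<noteq> 0 \<and> l s > 0 \<and> triple x x (e s) = (l s)\<^sup>2 *\<^sub>R e s"
    and "\<And>s. e s \<in> UNIV" and x_eq: "x = (\<Sum>s\<in>I. l s *\<^sub>R e s)"
    using spectral_decomposition[OF kk closed_UNIV subspace_UNIV UNIV_I inv] by blast
  have "I \<noteq> {}" using x x_eq by auto
  then have "Max (l ` I) \<in> l ` I" using I by simp
  then obtain s where s: "s \<in> I" "l s = Max (l ` I)" by auto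
  have max: "l t \<le> l s" if "t \<in> I" for t using s(2) I that by simp
  have "norm x \<le> l s"
    unfolding x_eq using l max s(1) by (intro orth_sum_le[OF e I]) (force simp: abs_of_pos less_imp_le)+
  moreover have "\<bar>l s\<bar> \<le> norm x"
    unfolding x_eq using l[OF s(1)] by (intro orth_sum_ge[OF e I s(1)]) auto
  ultimately have nx: "norm x = l s" by simp
  obtain f where f: "minimal f" "below f (e s)" using minimal_below[OF kk e(1)] l[OF s(1)] by blast
  have e0: "e t \<in> peirce f 0" if "t \<noteq> s" for t
  proof -
    have "triple (e t) f f = 0"
      using that by (intro peirce1_orth_peirce0(2)[OF e(1) below_peirce1[OF f(2)]] e(2)) auto
    then show ?thesis by (simp add: mem_peirce triple_commute[of f f])
  qed
  show thesis
  proof (rule that[OF f(1)])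
    show "l s *\<^sub>R (e s - f) + (\<Sum>t\<in>I - {s}. l t *\<^sub>R e t) \<in> peirce f 0"
      using f(2) e0 by (intro subspace_add[OF subspace_peirce] subspace_scale[OF subspace_peirce]
          subspace_sum[OF subspace_peirce]) (auto simp: below_def)
    have "x = l s *\<^sub>R e s + (\<Sum>t\<in>I - {s}. l t *\<^sub>R e t)"
      unfolding x_eq by (rule sum.remove[OF I s(1)])
    then show "x = norm x *\<^sub>R f + (l s *\<^sub>R (e s - f) + (\<Sum>t\<in>I - {s}. l t *\<^sub>R e t))"
      unfolding nx by (simp add: scaleR_diff_right)
  qed
qed

section \<open>The uniform Kadec-Klee property\<close>

text \<open>For a tripotent u in E1(e), {u, u, e} lies in E2(e), the complex line through e. Thus e
  is an eigenvector of L(u, u), with eigenvalue 1/2 or 1; q is the sum of these eigenvalues weighted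
  by the squared coefficients of y, the largest of which is (norm y)^2.\<close>

lemma minimal_peirce1_form:
  assumes kk: "kadec_klee TYPE('a)" and e: "minimal e" and y: "y \<in> peirce e (1/2)"
  obtains q where "triple y y e = q *\<^sub>R e" "(norm y)\<^sup>2 / 2 \<le> q"
proof -
  have te: "tripotent e" and e0: "e \<noteq> 0" using e by (auto simp: minimal_def)
  have inv: "triple y y z \<in> peirce e (1/2)" if "z \<in> peirce e (1/2)" for z
    using peirce_rule[OF y y that] by simp
  obtain I :: "real set" and u :: "real \<Rightarrow> 'a" and l :: "real \<Rightarrow> real" where I: "finite I"
    and u: "\<And>s. tripotent (u s)" "\<And>s t. s \<noteq> t \<Longrightarrow> u t \<in> peirce (u s) 0"
    and l: "\<And>s. s \<in> I \<Longrightarrow> u s \<noteq> 0 \<and> l s > 0 \<and> triple y y (u s) = (l s)\<^sup>2 *\<^sub>R u s"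
    and ue: "\<And>s. u s \<in> peirce e (1/2)" and y_eq: "y = (\<Sum>s\<in>I. l s *\<^sub>R u s)"
    using spectral_decomposition[OF kk closed_peirce subspace_peirce y inv] by blast
  have "\<exists>c\<ge>1/2. triple (u s) (u s) e = c *\<^sub>R e" if s: "s \<in> I" for s
  proof -
    have "triple (u s) (u s) e \<in> peirce e 1"
      using peirce_rule[OF ue ue tripotent_mem_peirce[OF te]] by simp
    then obtain c where c: "triple (u s) (u s) e = c *\<^sub>C e" using e by (auto simp: minimal_def)
    have "(2 * c ^ 3 - 3 * c ^ 2 + c) *\<^sub>C e = 0"
      using box_cubic[OF u(1), of s e]
      by (simp add: c triple_scaleC_right scaleC_scaleC scaleR_scaleC scaleC_add_left scaleC_diff_left
          power2_eq_square power3_eq_cube mult.assoc)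
    then have "2 * c ^ 3 - 3 * c ^ 2 + c = 0"
      using e0 norm_scaleC[of "2 * c ^ 3 - 3 * c ^ 2 + c" e] by simp
    moreover have "2 * c ^ 3 - 3 * c ^ 2 + c = c * (2 * c - 1) * (c - 1)"
      by (simp add: algebra_simps power3_eq_cube power2_eq_square)
    \<comment> \<open>Eigenvalue 0 would make u s orthogonal to e, while it is a nonzero element of
      E1(e).\<close>
    moreover have "c \<noteq> 0"
    proof
      assume "c = 0"
      then have "e \<in> peirce (u s) 0" using c by (simp add: mem_peirce)
      from peirce0_sym[OF u(1) this] have "u s \<in> peirce e 0" .
      then show False using peirce_Int[OF _ ue[of s]] l[OF s] by fastforce
    qed
    ultimately have "2 * c = 1 \<or> c = 1" by auto
    then have "c = of_real (1/2) \<or> c = of_real 1" by (auto simp: field_simps)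
    then obtain r :: real where "r \<ge> 1/2" "c = of_real r"
    proof
      assume "c = of_real (1/2)"
      then show thesis by (rule that[rotated]) simp
    next
      assume "c = of_real 1"
      then show thesis by (rule that[rotated]) simp
    qed
    then show ?thesis using c by (intro exI[of _ r]) (simp add: scaleR_scaleC)
  qed
  then obtain c where c: "\<And>s. s \<in> I \<Longrightarrow> c s \<ge> 1/2 \<and> triple (u s) (u s) e = c s *\<^sub>R e" by metis
  define q where "q = (\<Sum>s\<in>I. (l s)\<^sup>2 * c s)"
  have "triple y y e = (\<Sum>s\<in>I. \<Sum>t\<in>I. triple (l s *\<^sub>R u s) (l t *\<^sub>R u t) e)"
    unfolding y_eq by (simp only: triple_sum(1), simp only: triple_sum(2))
  also have "\<dots> = (\<Sum>s\<in>I. \<Sum>t\<in>I. if s = t then ((l s)\<^sup>2 * c s) *\<^sub>R e else 0)"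
    by (intro sum.cong refl)
      (use c box_peirce0(1)[OF u(1) u(2)] in \<open>auto simp: triple_linear power2_eq_square mult_ac\<close>)
  also have "\<dots> = q *\<^sub>R e" using I by (simp add: q_def scaleR_sum_left)
  finally have qe: "triple y y e = q *\<^sub>R e" .
  have term_nonneg: "0 \<le> (l s)\<^sup>2 * c s" if "s \<in> I" for s using c[OF that] by simp
  have q0: "q \<ge> 0" unfolding q_def by (intro sum_nonneg term_nonneg)
  have "norm y \<le> sqrt (2 * q)"
    unfolding y_eq
  proof (rule orth_sum_le[OF u I])
    show "sqrt (2 * q) \<ge> 0" using q0 by simp
    fix s assume s: "s \<in> I"
    have "(l s)\<^sup>2 * (1/2) \<le> (l s)\<^sup>2 * c s" using c[OF s] by (intro mult_left_mono) auto
    also have "\<dots> \<le> q" unfolding q_def using I s term_nonneg by (intro member_le_sum) auto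
    finally show "\<bar>l s\<bar> \<le> sqrt (2 * q)" by (intro real_le_rsqrt) simp
  qed
  then have "(norm y)\<^sup>2 \<le> 2 * q" using q0 by (metis norm_ge_zero power_mono real_sqrt_pow2 mult_nonneg_nonneg zero_le_numeral)
  then show thesis using qe by (intro that[of q]) auto
qed

text \<open>On the complex line through e the projection is a bounded functional times e, so weak
  convergence becomes norm convergence.\<close>

lemma minimal_weak_peirce2:
  assumes e: "minimal e" and y: "weakly_tendsto y 0"
  shows "(\<lambda>n. peirce2 e (y n)) \<longlonglongrightarrow> 0"
proof -
  have te: "tripotent e" and e0: "e \<noteq> 0" using e by (auto simp: minimal_def)
  interpret p2: bounded_linear "peirce2 e" using bounded_clinear_peirce by (simp add: bounded_clinear_def)
  have "\<forall>x. \<exists>c. peirce2 e x = c *\<^sub>C e"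
    using e peirce_projections(1)[OF te] by (simp add: minimal_def)
  then obtain \<psi> where \<psi>: "\<And>x. peirce2 e x = \<psi> x *\<^sub>C e" by metis
  have uniq: "c = d" if "c *\<^sub>C e = d *\<^sub>C e" for c d
  proof -
    have "(c - d) *\<^sub>C e = 0" using that by (simp add: scaleC_diff_left)
    then show ?thesis using e0 norm_scaleC[of "c - d" e] by simp
  qed
  have norm_\<psi>: "cmod (\<psi> x) = norm (peirce2 e x)" for x
    using norm_tripotent[OF te e0] by (simp add: \<psi> norm_scaleC)
  have "bounded_clinear \<psi>"
    unfolding bounded_clinear_def
  proof (intro conjI allI bounded_linear_intro[where K=1])
    show "\<psi> (x + z) = \<psi> x + \<psi> z" for x z
      by (rule uniq) (simp add: scaleC_add_left p2.add flip: \<psi>)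
    show "\<psi> (r *\<^sub>R x) = r *\<^sub>R \<psi> x" for r x
    proof (rule uniq)
      have "\<psi> (r *\<^sub>R x) *\<^sub>C e = r *\<^sub>R \<psi> x *\<^sub>C e" by (simp add: p2.scaleR flip: \<psi>)
      then show "\<psi> (r *\<^sub>R x) *\<^sub>C e = (r *\<^sub>R \<psi> x) *\<^sub>C e"
        by (simp add: scaleR_scaleC[of r "_ *\<^sub>C e"] scaleC_scaleC scaleR_conv_of_real)
    qed
    show "norm (\<psi> x) \<le> norm x * 1" for x using norm_peirce2_le[OF te, of x] by (simp add: norm_\<psi>)
    show "\<psi> (c *\<^sub>C x) = c *\<^sub>C \<psi> x" for c x
    proof (rule uniq)
      have "\<psi> (c *\<^sub>C x) *\<^sub>C e = c *\<^sub>C \<psi> x *\<^sub>C e"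
        using bounded_clinear_peirce(1)[of e] by (simp add: bounded_clinear_def flip: \<psi>)
      then show "\<psi> (c *\<^sub>C x) *\<^sub>C e = (c *\<^sub>C \<psi> x) *\<^sub>C e"
        by (simp add: scaleC_scaleC scaleC_complex_def)
    qed
  qed
  then have "(\<lambda>n. \<psi> (y n)) \<longlonglongrightarrow> \<psi> 0" using y by (simp add: weakly_tendsto_def)
  moreover have "\<psi> 0 = 0" using norm_\<psi>[of 0] by (simp add: p2.zero)
  ultimately have "(\<lambda>n. norm (peirce2 e (y n))) \<longlonglongrightarrow> 0"
    by (simp add: tendsto_norm_zero flip: norm_\<psi>)
  then show ?thesis by (rule tendsto_norm_zero_cancel)
qed

lemma kadec_klee_imp_uniform:
  assumes kk: "kadec_klee TYPE('a)"
  shows "uniform_kadec_klee TYPE('a)"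
  unfolding uniform_kadec_klee_def
proof (intro allI impI)
  fix \<epsilon> :: real assume \<epsilon>: "\<epsilon> > 0"
  \<comment> \<open>The squared E1-component is eventually at most 32 \<delta>, and 32/800 = 1/25 is
    below 1/16. The cap 1/2 ensures \<rho> \<ge> 1/2, so that 2 \<rho> q \<ge> q.\<close>
  define \<delta> where "\<delta> = min (1/2) (\<epsilon>\<^sup>2 / 800)"
  have \<delta>: "\<delta> > 0" "\<delta> \<le> 1/2" "32 * \<delta> < (\<epsilon> / 4)\<^sup>2"
  proof -
    have "\<epsilon>\<^sup>2 > 0" using \<epsilon> by simp
    then show "\<delta> > 0" "\<delta> \<le> 1/2" "32 * \<delta> < (\<epsilon> / 4)\<^sup>2"
      by (auto simp: \<delta>_def power_divide min_def)
  qed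
  have main: False
    if x: "\<forall>n. x n \<in> cball 0 1" and s: "sep x \<ge> \<epsilon>" and w: "weakly_tendsto x l"
      and l: "norm l \<ge> 1 - \<delta>" for x :: "nat \<Rightarrow> 'a" and l
  proof -
    define \<rho> where "\<rho> = norm l"
    have \<rho>: "\<rho> \<ge> 1/2" "\<rho> \<ge> 1 - \<delta>" using l \<delta>(2) by (auto simp: \<rho>_def)
    then have "l \<noteq> 0" by (auto simp: \<rho>_def)
    then obtain f l0 where f: "minimal f" and l0: "l0 \<in> peirce f 0" and l_eq: "l = \<rho> *\<^sub>R f + l0"
      unfolding \<rho>_def by (rule minimal_norm_part[OF kk])
    have tf: "tripotent f" and f0: "f \<noteq> 0" using f by (auto simp: minimal_def)
    interpret p2: bounded_linear "peirce2 f" using bounded_clinear_peirce by (simp add: bounded_clinear_def)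
    interpret p1: bounded_linear "peirce1 f" using bounded_clinear_peirce by (simp add: bounded_clinear_def)
    have p2l: "peirce2 f l = \<rho> *\<^sub>R f" and p1l: "peirce1 f l = 0"
      using peirce2_of[OF tripotent_mem_peirce[OF tf]] peirce2_of[OF l0]
        peirce1_of[OF tripotent_mem_peirce[OF tf]] peirce1_of[OF l0]
      by (simp_all add: l_eq p2.add p2.scaleR p1.add p1.scaleR)
    define y where "y n = x n - l" for n
    have wy: "weakly_tendsto y 0"
      unfolding weakly_tendsto_def
    proof (intro allI impI)
      fix g :: "'a \<Rightarrow> complex" assume g: "bounded_clinear g"
      then interpret g: bounded_linear g by (simp add: bounded_clinear_def)
      have "(\<lambda>n. g (x n)) \<longlonglongrightarrow> g l" using w g by (simp add: weakly_tendsto_def)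
      then show "(\<lambda>n. g (y n)) \<longlonglongrightarrow> g 0" by (simp add: y_def g.diff LIM_zero g.zero)
    qed
    have lim2: "(\<lambda>n. norm (peirce2 f (y n))) \<longlonglongrightarrow> 0"
      by (rule tendsto_norm_zero[OF minimal_weak_peirce2[OF f wy]])
    have "weakly_tendsto (\<lambda>n. peirce0 f (y n)) 0"
      using weakly_tendsto_image[OF wy bounded_clinear_peirce(3), of f] by (simp add: peirce0_def)
    then have lim0: "(\<lambda>n. norm (peirce0 f (y n))) \<longlonglongrightarrow> 0"
      by (intro tendsto_norm_zero kadec_klee_peirce0[OF kk tf f0] peirce_projections(3)[OF tf])
    have bound1: "(norm (peirce1 f (y n)))\<^sup>2 \<le> 8 * ((1 + norm (peirce2 f (y n))) ^ 3 - 1 + 3 * \<delta>)" for n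
    proof -
      \<comment> \<open>Half of the E1-component, because the contraction available is
        \<open>peirce2\<close> plus half of \<open>peirce1\<close>. It maps x n to \<rho> f + v, up
        to the vanishing E2-part of y n.\<close>
      define v where "v = (1/2) *\<^sub>R peirce1 f (y n)"
      have v: "v \<in> peirce f (1/2)"
        unfolding v_def by (intro subspace_scale[OF subspace_peirce] peirce_projections(2)[OF tf])
      obtain q where q: "triple v v f = q *\<^sub>R f" "(norm v)\<^sup>2 / 2 \<le> q"
        using minimal_peirce1_form[OF kk f v] by blast
      have xn: "x n = l + y n" by (simp add: y_def)
      have "\<rho> *\<^sub>R f + v = (peirce2 f (x n) + (1/2) *\<^sub>R peirce1 f (x n)) - peirce2 f (y n)"
        by (simp add: xn p2.add p1.add p2l p1l v_def)
      also have "norm \<dots> \<le> norm (x n) + norm (peirce2 f (y n))"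
        using norm_triangle_ineq4 norm_peirce2_peirce1_le[OF tf, of "x n"] add_right_mono order_trans by blast
      also have "\<dots> \<le> 1 + norm (peirce2 f (y n))" using x by simp
      finally have "norm (\<rho> *\<^sub>R f + v) ^ 3 \<le> (1 + norm (peirce2 f (y n))) ^ 3"
        by (intro power_mono) auto
      moreover have "\<rho> ^ 3 + 2 * \<rho> * q \<le> norm (\<rho> *\<^sub>R f + v) ^ 3"
        using \<rho>(1) by (intro norm_add_peirce1_ge[OF tf f0 v q(1)]) simp
      moreover have "1 - 3 * \<delta> \<le> \<rho> ^ 3"
      proof -
        have "1 - 3 * \<delta> \<le> (1 - \<delta>) ^ 3"
          using Bernoulli_inequality[of "- \<delta>" 3] \<delta>(2) by simp
        also have "\<dots> \<le> \<rho> ^ 3" using \<rho>(2) \<delta>(2) by (intro power_mono) auto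
        finally show ?thesis .
      qed
      moreover have "1 * q \<le> 2 * \<rho> * q"
        using \<rho>(1) q(2) zero_le_power2[of "norm v"] by (intro mult_right_mono) linarith+
      moreover have "(norm v)\<^sup>2 = (norm (peirce1 f (y n)))\<^sup>2 / 4"
        by (simp add: v_def power_divide)
      \<comment> \<open>The preceding estimates combined: q is at most P - 1 + 3 \<delta>, and p = 4
        V \<le> 8 q.\<close>
      moreover have "p \<le> 8 * (P - 1 + 3 * \<delta>)"
        if "N \<le> P" "R + S \<le> N" "1 - 3 * \<delta> \<le> R" "1 * q \<le> S" "V = p / 4" "V / 2 \<le> q"
        for p P N R S V :: real
      proof -
        have "q \<le> P - 1 + 3 * \<delta>" using that(1-4) by simp
        moreover have "p \<le> 8 * q" using that(5,6) by simp
        ultimately show ?thesis by simp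
      qed
      ultimately show ?thesis using q(2) by blast
    qed
    have "(\<lambda>n. (1 + norm (peirce2 f (y n))) ^ 3 - 1) \<longlonglongrightarrow> (1 + 0) ^ 3 - 1"
      by (intro tendsto_intros lim2)
    then have "\<forall>\<^sub>F n in sequentially. (1 + norm (peirce2 f (y n))) ^ 3 - 1 < \<delta>"
      using order_tendstoD(2)[of _ _ _ \<delta>] \<delta>(1) by simp
    moreover have "\<forall>\<^sub>F n in sequentially. norm (peirce2 f (y n)) < \<epsilon> / 16"
      using order_tendstoD(2)[OF lim2, of "\<epsilon> / 16"] \<epsilon> by simp
    moreover have "\<forall>\<^sub>F n in sequentially. norm (peirce0 f (y n)) < \<epsilon> / 16"
      using order_tendstoD(2)[OF lim0, of "\<epsilon> / 16"] \<epsilon> by simp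
    ultimately have "\<forall>\<^sub>F n in sequentially. norm (y n) < \<epsilon> / 2"
    proof eventually_elim
      case (elim n)
      note bound1[of n]
      also have "8 * ((1 + norm (peirce2 f (y n))) ^ 3 - 1 + 3 * \<delta>) \<le> 8 * (\<delta> + 3 * \<delta>)"
        using elim(1) by (intro mult_left_mono add_mono) auto
      also have "\<dots> = 32 * \<delta>" by simp
      also note \<delta>(3)
      finally have "(norm (peirce1 f (y n)))\<^sup>2 < (\<epsilon> / 4)\<^sup>2" .
      from power2_less_imp_less[OF this] have "norm (peirce1 f (y n)) < \<epsilon> / 4" using \<epsilon> by simp
      moreover have "norm (y n) \<le> norm (peirce2 f (y n)) + norm (peirce1 f (y n)) + norm (peirce0 f (y n))"
        by (subst (1) peirce_decomp[of "y n" f]) (intro norm_triangle_le add_mono order_refl)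
      ultimately show ?case using elim(2,3) \<epsilon> by simp
    qed
    then obtain N where N: "\<And>n. n \<ge> N \<Longrightarrow> norm (y n) < \<epsilon> / 2" by (auto simp: eventually_sequentially)
    \<comment> \<open>Two consecutive late members, each within \<epsilon> / 2 of l, already violate
      the separation.\<close>
    have "sep x \<le> norm (x N - x (Suc N))" by (rule sep_le) simp
    also have "\<dots> = norm (y N - y (Suc N))" by (simp add: y_def)
    also have "\<dots> \<le> norm (y N) + norm (y (Suc N))" by (rule norm_triangle_ineq4)
    also have "\<dots> < \<epsilon>" using N[of N] N[of "Suc N"] by simp
    finally show False using s by simp
  qed
  have "norm l < 1 - \<delta>"
    if "\<forall>n. x n \<in> cball 0 1" "sep x \<ge> \<epsilon>" "weakly_tendsto x l" for x :: "nat \<Rightarrow> 'a" and l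
    using main[OF that] by (rule not_le_imp_less[OF notI])
  then show "\<exists>\<delta>>0. \<forall>(x :: nat \<Rightarrow> 'a) l. (\<forall>n. x n \<in> cball 0 1) \<longrightarrow> sep x \<ge> \<epsilon> \<longrightarrow>
      weakly_tendsto x l \<longrightarrow> norm l < 1 - \<delta>"
    using \<delta>(1) by blast
qed

end

theorem corollary4p2:
  fixes triple :: "'a::complex_banach \<Rightarrow> 'a \<Rightarrow> 'a \<Rightarrow> 'a"
  assumes "jb_star_triple triple"
  shows "kadec_klee TYPE('a) \<longleftrightarrow> uniform_kadec_klee TYPE('a)"
  using jb_star_triple.kadec_klee_imp_uniform[OF assms] uniform_kadec_klee_imp_kadec_klee by blast

end
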